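(* Let $\mathbf C$ and $\mathbf D$ be $2$-categories, and let $L\colon\mathbf C\to\mathbf D$ be a normal pseudo-functor. The following statements are equivalent. (i) The normal pseudo-functor $L\colon \mathbf C\to\mathbf D$ has a right bi-adjoint $R\colon\mathbf D\to\mathbf C$. (ii) For all objects $D\in\mathbf D$, there is a bi-representation $(RD,\Psi^D)$ of $\mathbf D(L-,D)\colon\mathbf C^{\mathrm{op}}\to\mathbf{Cat}$, where $\Psi^D\colon\mathbf C(-,RD)\Rightarrow\mathbf D(L-,D)$ is a pseudo-natural adjoint equivalence in $\mathbf{Ps}(\mathbf C^{\mathrm{op}},\mathbf{Cat})$.
   Context: **$2$-categories.** $\mathbf{Cat}$ is the $2$-category of categories, functors and natural transformations; $\mathbf C^{\mathrm{op}}$ reverses morphisms but not $2$-morphisms. A normal pseudo-functor $F\colon\mathbf A\to\mathbf B$ between (strict) $2$-categories consists of an assignment on objects, functors $\mathbf A(A,A')\to\mathbf B(FA,FA')$, and invertible compositors $\phi_{a,a'}\colon (Fa')(Fa)\Rightarrow F(a'a)$ satisfying the usual naturality, associativity and unit axioms, with all unitors identities (so $F\mathrm{id}_A=\mathrm{id}_{FA}$). $\mathbf{Ps}(\mathbf A,\mathbf B)$ is the $2$-category of normal pseudo-functors, pseudo-natural transformations (with invertible $2$-morphism components) and modifications. **Bi-representation.** A bi-representation of a normal pseudo-functor $F\colon \mathbf C^{\mathrm{op}}\to\mathbf{Cat}$ is a pair $(I,\rho)$ of an object $I\in\mathbf C$ and a pseudo-natural adjoint equivalence $\rho\colon \mathbf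 C(-,I)\Rightarrow F$, i.e. an adjoint equivalence in $\mathbf{Ps}(\mathbf C^{\mathrm{op}},\mathbf{Cat})$. **Bi-adjunction.** A bi-adjunction between $\mathbf C$ and $\mathbf D$ comprises normal pseudo-functors $L\colon\mathbf C\to\mathbf D$ and $R\colon\mathbf D\to\mathbf C$, and adjoint equivalences of categories $\Phi_{C,D}\colon\mathbf C(C,RD)\to\mathbf D(LC,D)$ pseudo-natural in $C\in\mathbf C^{\mathrm{op}}$ and $D\in\mathbf D$ (i.e. a pseudo-natural adjoint equivalence $\mathbf C(-,R-)\Rightarrow\mathbf D(L-,-)$ in $\mathbf{Ps}(\mathbf C^{\mathrm{op}}\times\mathbf D,\mathbf{Cat})$). In that case $R$ is called a right bi-adjoint of $L$. *)

theory Defs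
  imports "HOL-Library.FuncSet"
begin

text \<open>
  Categories and strict 2-categories are given by carriers and hom-families. All operations are
  indexed by the objects involved, so cells need not carry their source and target and no
  disjointness of hom-sets is required.
  \<open>cmp X a b c g f\<close> is the composite of \<open>f : a \<rightarrow> b\<close> and \<open>g : b \<rightarrow> c\<close>.
  Records may take arbitrary values outside the carriers; wherever a function is itself a cell of
  a (2-)category (functors and natural transformations in \<open>CAT\<close>, pseudo-natural transformations
  and modifications in \<open>Ps\<close>) it is required to be undefined off its domain, so that HOL equality
  is the intended equality of cells.
\<close>

section \<open>Categories, functors, natural transformations\<close>

record ('a, 'x) cat =
  obj :: "'a set"
  arr :: "'a \<Rightarrow> 'a \<Rightarrow> 'x set"
  one :: "'a \<Rightarrow> 'x"
  cmp :: "'a \<Rightarrow> 'a \<Rightarrow> 'a \<Rightarrow> 'x \<Rightarrow> 'x \<Rightarrow> 'x"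

locale category =
  fixes X :: "('a, 'x) cat"
  assumes one_in: "a \<in> obj X \<Longrightarrow> one X a \<in> arr X a a"
    and cmp_in: "\<lbrakk>a \<in> obj X; b \<in> obj X; c \<in> obj X; f \<in> arr X a b; g \<in> arr X b c\<rbrakk>
      \<Longrightarrow> cmp X a b c g f \<in> arr X a c"
    and cmp_one_right: "\<lbrakk>a \<in> obj X; b \<in> obj X; f \<in> arr X a b\<rbrakk> \<Longrightarrow> cmp X a a b f (one X a) = f"
    and cmp_one_left: "\<lbrakk>a \<in> obj X; b \<in> obj X; f \<in> arr X a b\<rbrakk> \<Longrightarrow> cmp X a b b (one X b) f = f"
    and cmp_assoc: "\<lbrakk>a \<in> obj X; b \<in> obj X; c \<in> obj X; d \<in> obj X;
        f \<in> arr X a b; g \<in> arr X b c; h \<in> arr X c d\<rbrakk>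
      \<Longrightarrow> cmp X a b d (cmp X b c d h g) f = cmp X a c d h (cmp X a b c g f)"

definition is_iso :: "('a, 'x) cat \<Rightarrow> 'a \<Rightarrow> 'a \<Rightarrow> 'x \<Rightarrow> bool" where
  "is_iso X a b f \<longleftrightarrow> f \<in> arr X a b \<and>
    (\<exists>g \<in> arr X b a. cmp X a b a g f = one X a \<and> cmp X b a b f g = one X b)"

definition prod_cat :: "('a, 'x) cat \<Rightarrow> ('b, 'y) cat \<Rightarrow> ('a \<times> 'b, 'x \<times> 'y) cat" where
  "prod_cat X Y = \<lparr>
    obj = obj X \<times> obj Y,
    arr = (\<lambda>(a, b) (a', b'). arr X a a' \<times> arr Y b b'),
    one = (\<lambda>(a, b). (one X a, one Y b)),
    cmp = (\<lambda>(a, b) (a', b') (a'', b'') (g, k) (f, h). (cmp X a a' a'' g f, cmp Y b b' b'' k h))\<rparr>"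

record ('a, 'x, 'b, 'y) ftr =
  fob :: "'a \<Rightarrow> 'b"
  far :: "'a \<Rightarrow> 'a \<Rightarrow> 'x \<Rightarrow> 'y"

locale cat_functor =
  fixes X :: "('a, 'x) cat" and Y :: "('b, 'y) cat" and F :: "('a, 'x, 'b, 'y) ftr"
  assumes fob_in: "a \<in> obj X \<Longrightarrow> fob F a \<in> obj Y"
    and far_in: "\<lbrakk>a \<in> obj X; b \<in> obj X; f \<in> arr X a b\<rbrakk> \<Longrightarrow> far F a b f \<in> arr Y (fob F a) (fob F b)"
    and far_one: "a \<in> obj X \<Longrightarrow> far F a a (one X a) = one Y (fob F a)"
    and far_cmp: "\<lbrakk>a \<in> obj X; b \<in> obj X; c \<in> obj X; f \<in> arr X a b; g \<in> arr X b c\<rbrakk>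
      \<Longrightarrow> far F a c (cmp X a b c g f) =
          cmp Y (fob F a) (fob F b) (fob F c) (far F b c g) (far F a b f)"

definition id_ftr :: "('a, 'x, 'a, 'x) ftr" where
  "id_ftr = \<lparr>fob = (\<lambda>a. a), far = (\<lambda>a b f. f)\<rparr>"

definition comp_ftr ::
  "('b, 'y, 'c, 'z) ftr \<Rightarrow> ('a, 'x, 'b, 'y) ftr \<Rightarrow> ('a, 'x, 'c, 'z) ftr" where
  "comp_ftr G F = \<lparr>
    fob = (\<lambda>a. fob G (fob F a)),
    far = (\<lambda>a b f. far G (fob F a) (fob F b) (far F a b f))\<rparr>"

definition restrict_ftr :: "('a, 'x) cat \<Rightarrow> ('a, 'x, 'b, 'y) ftr \<Rightarrow> ('a, 'x, 'b, 'y) ftr" where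
  "restrict_ftr X F = \<lparr>
    fob = (\<lambda>a. if a \<in> obj X then fob F a else undefined),
    far = (\<lambda>a b f. if a \<in> obj X \<and> b \<in> obj X \<and> f \<in> arr X a b then far F a b f else undefined)\<rparr>"

locale nat_trans =
  fixes X :: "('a, 'x) cat" and Y :: "('b, 'y) cat"
    and F G :: "('a, 'x, 'b, 'y) ftr" and \<alpha> :: "'a \<Rightarrow> 'y"
  assumes component_in: "a \<in> obj X \<Longrightarrow> \<alpha> a \<in> arr Y (fob F a) (fob G a)"
    and naturality: "\<lbrakk>a \<in> obj X; b \<in> obj X; f \<in> arr X a b\<rbrakk>
      \<Longrightarrow> cmp Y (fob F a) (fob G a) (fob G b) (far G a b f) (\<alpha> a) =
          cmp Y (fob F a) (fob F b) (fob G b) (\<alpha> b) (far F a b f)"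

definition functor_cat ::
  "('a, 'x) cat \<Rightarrow> ('b, 'y) cat \<Rightarrow> (('a, 'x, 'b, 'y) ftr, 'a \<Rightarrow> 'y) cat" where
  "functor_cat X Y = \<lparr>
    obj = {F. cat_functor X Y F \<and> restrict_ftr X F = F},
    arr = (\<lambda>F G. {\<alpha> \<in> extensional (obj X). nat_trans X Y F G \<alpha>}),
    one = (\<lambda>F. \<lambda>a \<in> obj X. one Y (fob F a)),
    cmp = (\<lambda>F G H \<beta> \<alpha>. \<lambda>a \<in> obj X. cmp Y (fob F a) (fob G a) (fob H a) (\<beta> a) (\<alpha> a))\<rparr>"


section \<open>Strict 2-categories\<close>

text \<open>
  A strict 2-category is a category enriched in categories: \<open>Comp K A B C\<close> is the composition
  functor \<open>Hom B C \<times> Hom A B \<rightarrow> Hom A C\<close>. Objects of \<open>Hom K A B\<close> are the morphisms and its arrows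
  the 2-morphisms; vertical composition is composition in \<open>Hom K A B\<close>.
\<close>

record ('o, 'a, 'x) twocat =
  Ob :: "'o set"
  Hom :: "'o \<Rightarrow> 'o \<Rightarrow> ('a, 'x) cat"
  Id :: "'o \<Rightarrow> 'a"
  Comp :: "'o \<Rightarrow> 'o \<Rightarrow> 'o \<Rightarrow> ('a \<times> 'a, 'x \<times> 'x, 'a, 'x) ftr"

text \<open>\<open>comp2 K A B C g g' f f' \<beta> \<alpha>\<close> is the horizontal composite of \<open>\<alpha> : f \<Rightarrow> f'\<close> in \<open>Hom A B\<close> and
  \<open>\<beta> : g \<Rightarrow> g'\<close> in \<open>Hom B C\<close>.\<close>

abbreviation comp1 :: "('o, 'a, 'x) twocat \<Rightarrow> 'o \<Rightarrow> 'o \<Rightarrow> 'o \<Rightarrow> 'a \<Rightarrow> 'a \<Rightarrow> 'a" where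
  "comp1 K A B C g f \<equiv> fob (Comp K A B C) (g, f)"

abbreviation comp2 ::
  "('o, 'a, 'x) twocat \<Rightarrow> 'o \<Rightarrow> 'o \<Rightarrow> 'o \<Rightarrow> 'a \<Rightarrow> 'a \<Rightarrow> 'a \<Rightarrow> 'a \<Rightarrow> 'x \<Rightarrow> 'x \<Rightarrow> 'x" where
  "comp2 K A B C g g' f f' \<beta> \<alpha> \<equiv> far (Comp K A B C) (g, f) (g', f') (\<beta>, \<alpha>)"

abbreviation lwhisk ::
  "('o, 'a, 'x) twocat \<Rightarrow> 'o \<Rightarrow> 'o \<Rightarrow> 'o \<Rightarrow> 'a \<Rightarrow> 'a \<Rightarrow> 'a \<Rightarrow> 'x \<Rightarrow> 'x" where
  "lwhisk K A B C g f f' \<alpha> \<equiv> comp2 K A B C g g f f' (one (Hom K B C) g) \<alpha>"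

abbreviation rwhisk ::
  "('o, 'a, 'x) twocat \<Rightarrow> 'o \<Rightarrow> 'o \<Rightarrow> 'o \<Rightarrow> 'a \<Rightarrow> 'a \<Rightarrow> 'a \<Rightarrow> 'x \<Rightarrow> 'x" where
  "rwhisk K A B C g g' f \<beta> \<equiv> comp2 K A B C g g' f f \<beta> (one (Hom K A B) f)"

locale two_category =
  fixes K :: "('o, 'a, 'x) twocat"
  assumes hom_category: "\<lbrakk>A \<in> Ob K; B \<in> Ob K\<rbrakk> \<Longrightarrow> category (Hom K A B)"
    and Id_in: "A \<in> Ob K \<Longrightarrow> Id K A \<in> obj (Hom K A A)"
    and Comp_functor: "\<lbrakk>A \<in> Ob K; B \<in> Ob K; C \<in> Ob K\<rbrakk>
      \<Longrightarrow> cat_functor (prod_cat (Hom K B C) (Hom K A B)) (Hom K A C) (Comp K A B C)"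
    and comp1_Id_right: "\<lbrakk>A \<in> Ob K; B \<in> Ob K; f \<in> obj (Hom K A B)\<rbrakk>
      \<Longrightarrow> comp1 K A A B f (Id K A) = f"
    and comp1_Id_left: "\<lbrakk>A \<in> Ob K; B \<in> Ob K; f \<in> obj (Hom K A B)\<rbrakk>
      \<Longrightarrow> comp1 K A B B (Id K B) f = f"
    and comp2_Id_right: "\<lbrakk>A \<in> Ob K; B \<in> Ob K; f \<in> obj (Hom K A B); f' \<in> obj (Hom K A B);
        \<alpha> \<in> arr (Hom K A B) f f'\<rbrakk>
      \<Longrightarrow> rwhisk K A A B f f' (Id K A) \<alpha> = \<alpha>"
    and comp2_Id_left: "\<lbrakk>A \<in> Ob K; B \<in> Ob K; f \<in> obj (Hom K A B); f' \<in> obj (Hom K A B);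
        \<alpha> \<in> arr (Hom K A B) f f'\<rbrakk>
      \<Longrightarrow> lwhisk K A B B (Id K B) f f' \<alpha> = \<alpha>"
    and comp1_assoc: "\<lbrakk>A \<in> Ob K; B \<in> Ob K; C \<in> Ob K; D \<in> Ob K;
        f \<in> obj (Hom K A B); g \<in> obj (Hom K B C); h \<in> obj (Hom K C D)\<rbrakk>
      \<Longrightarrow> comp1 K A B D (comp1 K B C D h g) f = comp1 K A C D h (comp1 K A B C g f)"
    and comp2_assoc: "\<lbrakk>A \<in> Ob K; B \<in> Ob K; C \<in> Ob K; D \<in> Ob K;
        f \<in> obj (Hom K A B); g \<in> obj (Hom K B C); h \<in> obj (Hom K C D);
        f' \<in> obj (Hom K A B); g' \<in> obj (Hom K B C); h' \<in> obj (Hom K C D);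
        \<alpha> \<in> arr (Hom K A B) f f'; \<beta> \<in> arr (Hom K B C) g g'; \<gamma> \<in> arr (Hom K C D) h h'\<rbrakk>
      \<Longrightarrow> comp2 K A B D (comp1 K B C D h g) (comp1 K B C D h' g') f f'
            (comp2 K B C D h h' g g' \<gamma> \<beta>) \<alpha> =
          comp2 K A C D h h' (comp1 K A B C g f) (comp1 K A B C g' f')
            \<gamma> (comp2 K A B C g g' f f' \<beta> \<alpha>)"

definition op2 :: "('o, 'a, 'x) twocat \<Rightarrow> ('o, 'a, 'x) twocat" where
  "op2 K = \<lparr>
    Ob = Ob K,
    Hom = (\<lambda>A B. Hom K B A),
    Id = Id K,
    Comp = (\<lambda>A B C. \<lparr>
      fob = (\<lambda>(g, f). comp1 K C B A f g),
      far = (\<lambda>(g, f) (g', f') (\<beta>, \<alpha>). comp2 K C B A f f' g g' \<alpha> \<beta>)\<rparr>)\<rparr>"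

definition prod2 ::
  "('o, 'a, 'x) twocat \<Rightarrow> ('p, 'b, 'y) twocat \<Rightarrow> ('o \<times> 'p, 'a \<times> 'b, 'x \<times> 'y) twocat" where
  "prod2 K M = \<lparr>
    Ob = Ob K \<times> Ob M,
    Hom = (\<lambda>(A, B) (A', B'). prod_cat (Hom K A A') (Hom M B B')),
    Id = (\<lambda>(A, B). (Id K A, Id M B)),
    Comp = (\<lambda>(A, B) (A', B') (A'', B''). \<lparr>
      fob = (\<lambda>((g, k), (f, h)). (comp1 K A A' A'' g f, comp1 M B B' B'' k h)),
      far = (\<lambda>((g, k), (f, h)) ((g', k'), (f', h')) ((\<beta>, \<delta>), (\<alpha>, \<gamma>)).
        (comp2 K A A' A'' g g' f f' \<beta> \<alpha>, comp2 M B B' B'' k k' h h' \<delta> \<gamma>))\<rparr>)\<rparr>"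

text \<open>The 2-category of all categories with objects in \<open>'a\<close> and arrows in \<open>'x\<close>; the two types play
  the role of the universe bounding the size of its objects.\<close>

definition CAT :: "(('a, 'x) cat, ('a, 'x, 'a, 'x) ftr, 'a \<Rightarrow> 'x) twocat" where
  "CAT = \<lparr>
    Ob = {X. category X},
    Hom = functor_cat,
    Id = (\<lambda>X. restrict_ftr X id_ftr),
    Comp = (\<lambda>X Y Z. \<lparr>
      fob = (\<lambda>(G, F). restrict_ftr X (comp_ftr G F)),
      far = (\<lambda>(G, F) (G', F') (\<beta>, \<alpha>). \<lambda>a \<in> obj X.
        cmp Z (fob G (fob F a)) (fob G (fob F' a)) (fob G' (fob F' a))
          (\<beta> (fob F' a)) (far G (fob F a) (fob F' a) (\<alpha> a)))\<rparr>)\<rparr>"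

text \<open>The data of an adjoint equivalence: a morphism \<open>fwd\<close>, its adjoint inverse \<open>bwd\<close>,
  unit \<open>1 \<Rightarrow> bwd \<circ> fwd\<close> and counit \<open>fwd \<circ> bwd \<Rightarrow> 1\<close>.\<close>

record ('a, 'x) adj_eqv =
  fwd :: 'a
  bwd :: 'a
  unt :: 'x
  cou :: 'x

locale adjoint_equivalence =
  fixes K :: "('o, 'a, 'x) twocat" and A B :: 'o and E :: "('a, 'x) adj_eqv"
  assumes source_in: "A \<in> Ob K"
    and target_in: "B \<in> Ob K"
    and fwd_in: "fwd E \<in> obj (Hom K A B)"
    and bwd_in: "bwd E \<in> obj (Hom K B A)"
    and unt_iso: "is_iso (Hom K A A) (Id K A) (comp1 K A B A (bwd E) (fwd E)) (unt E)"
    and cou_iso: "is_iso (Hom K B B) (comp1 K B A B (fwd E) (bwd E)) (Id K B) (cou E)"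
    and triangle_fwd:
      "cmp (Hom K A B) (fwd E) (comp1 K A B B (comp1 K B A B (fwd E) (bwd E)) (fwd E)) (fwd E)
         (rwhisk K A B B (comp1 K B A B (fwd E) (bwd E)) (Id K B) (fwd E) (cou E))
         (lwhisk K A A B (fwd E) (Id K A) (comp1 K A B A (bwd E) (fwd E)) (unt E)) =
       one (Hom K A B) (fwd E)"
    and triangle_bwd:
      "cmp (Hom K B A) (bwd E) (comp1 K B A A (comp1 K A B A (bwd E) (fwd E)) (bwd E)) (bwd E)
         (lwhisk K B B A (bwd E) (comp1 K B A B (fwd E) (bwd E)) (Id K B) (cou E))
         (rwhisk K B A A (Id K A) (comp1 K A B A (bwd E) (fwd E)) (bwd E) (unt E)) =
       one (Hom K B A) (bwd E)"


section \<open>Normal pseudo-functors\<close>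

text \<open>\<open>pcomp F A B C g f\<close> is the compositor \<open>(F g)(F f) \<Rightarrow> F (g f)\<close>.\<close>

record ('o, 'a, 'x, 'p, 'b, 'y) psf =
  pob :: "'o \<Rightarrow> 'p"
  phom :: "'o \<Rightarrow> 'o \<Rightarrow> ('a, 'x, 'b, 'y) ftr"
  pcomp :: "'o \<Rightarrow> 'o \<Rightarrow> 'o \<Rightarrow> 'a \<Rightarrow> 'a \<Rightarrow> 'y"

abbreviation map1 :: "('o, 'a, 'x, 'p, 'b, 'y) psf \<Rightarrow> 'o \<Rightarrow> 'o \<Rightarrow> 'a \<Rightarrow> 'b" where
  "map1 F A B f \<equiv> fob (phom F A B) f"

abbreviation map2 :: "('o, 'a, 'x, 'p, 'b, 'y) psf \<Rightarrow> 'o \<Rightarrow> 'o \<Rightarrow> 'a \<Rightarrow> 'a \<Rightarrow> 'x \<Rightarrow> 'y" where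
  "map2 F A B f g \<alpha> \<equiv> far (phom F A B) f g \<alpha>"

locale normal_pseudo_functor =
  fixes K :: "('o, 'a, 'x) twocat" and M :: "('p, 'b, 'y) twocat"
    and F :: "('o, 'a, 'x, 'p, 'b, 'y) psf"
  assumes pob_in: "A \<in> Ob K \<Longrightarrow> pob F A \<in> Ob M"
    and phom_functor: "\<lbrakk>A \<in> Ob K; B \<in> Ob K\<rbrakk>
      \<Longrightarrow> cat_functor (Hom K A B) (Hom M (pob F A) (pob F B)) (phom F A B)"
    and map1_Id: "A \<in> Ob K \<Longrightarrow> map1 F A A (Id K A) = Id M (pob F A)"
    and pcomp_iso: "\<lbrakk>A \<in> Ob K; B \<in> Ob K; C \<in> Ob K; f \<in> obj (Hom K A B); g \<in> obj (Hom K B C)\<rbrakk>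
      \<Longrightarrow> is_iso (Hom M (pob F A) (pob F C))
            (comp1 M (pob F A) (pob F B) (pob F C) (map1 F B C g) (map1 F A B f))
            (map1 F A C (comp1 K A B C g f))
            (pcomp F A B C g f)"
    and pcomp_natural: "\<lbrakk>A \<in> Ob K; B \<in> Ob K; C \<in> Ob K;
        f \<in> obj (Hom K A B); f' \<in> obj (Hom K A B); g \<in> obj (Hom K B C); g' \<in> obj (Hom K B C);
        \<alpha> \<in> arr (Hom K A B) f f'; \<beta> \<in> arr (Hom K B C) g g'\<rbrakk>
      \<Longrightarrow> cmp (Hom M (pob F A) (pob F C))
            (comp1 M (pob F A) (pob F B) (pob F C) (map1 F B C g) (map1 F A B f))
            (comp1 M (pob F A) (pob F B) (pob F C) (map1 F B C g') (map1 F A B f'))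
            (map1 F A C (comp1 K A B C g' f'))
            (pcomp F A B C g' f')
            (comp2 M (pob F A) (pob F B) (pob F C)
               (map1 F B C g) (map1 F B C g') (map1 F A B f) (map1 F A B f')
               (map2 F B C g g' \<beta>) (map2 F A B f f' \<alpha>)) =
          cmp (Hom M (pob F A) (pob F C))
            (comp1 M (pob F A) (pob F B) (pob F C) (map1 F B C g) (map1 F A B f))
            (map1 F A C (comp1 K A B C g f))
            (map1 F A C (comp1 K A B C g' f'))
            (map2 F A C (comp1 K A B C g f) (comp1 K A B C g' f') (comp2 K A B C g g' f f' \<beta> \<alpha>))
            (pcomp F A B C g f)"
    and pcomp_assoc: "\<lbrakk>A \<in> Ob K; B \<in> Ob K; C \<in> Ob K; D \<in> Ob K;
        f \<in> obj (Hom K A B); g \<in> obj (Hom K B C); h \<in> obj (Hom K C D)\<rbrakk>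
      \<Longrightarrow> cmp (Hom M (pob F A) (pob F D))
            (comp1 M (pob F A) (pob F C) (pob F D) (map1 F C D h)
               (comp1 M (pob F A) (pob F B) (pob F C) (map1 F B C g) (map1 F A B f)))
            (comp1 M (pob F A) (pob F C) (pob F D) (map1 F C D h)
               (map1 F A C (comp1 K A B C g f)))
            (map1 F A D (comp1 K A C D h (comp1 K A B C g f)))
            (pcomp F A C D h (comp1 K A B C g f))
            (lwhisk M (pob F A) (pob F C) (pob F D) (map1 F C D h)
               (comp1 M (pob F A) (pob F B) (pob F C) (map1 F B C g) (map1 F A B f))
               (map1 F A C (comp1 K A B C g f))
               (pcomp F A B C g f)) =
          cmp (Hom M (pob F A) (pob F D))
            (comp1 M (pob F A) (pob F B) (pob F D)
               (comp1 M (pob F B) (pob F C) (pob F D) (map1 F C D h) (map1 F B C g))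
               (map1 F A B f))
            (comp1 M (pob F A) (pob F B) (pob F D)
               (map1 F B D (comp1 K B C D h g)) (map1 F A B f))
            (map1 F A D (comp1 K A B D (comp1 K B C D h g) f))
            (pcomp F A B D (comp1 K B C D h g) f)
            (rwhisk M (pob F A) (pob F B) (pob F D)
               (comp1 M (pob F B) (pob F C) (pob F D) (map1 F C D h) (map1 F B C g))
               (map1 F B D (comp1 K B C D h g))
               (map1 F A B f)
               (pcomp F B C D h g))"
    and pcomp_Id_right: "\<lbrakk>A \<in> Ob K; B \<in> Ob K; f \<in> obj (Hom K A B)\<rbrakk>
      \<Longrightarrow> pcomp F A A B f (Id K A) = one (Hom M (pob F A) (pob F B)) (map1 F A B f)"
    and pcomp_Id_left: "\<lbrakk>A \<in> Ob K; B \<in> Ob K; f \<in> obj (Hom K A B)\<rbrakk>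
      \<Longrightarrow> pcomp F A B B (Id K B) f = one (Hom M (pob F A) (pob F B)) (map1 F A B f)"

definition id_psf :: "('o, 'a, 'x) twocat \<Rightarrow> ('o, 'a, 'x, 'o, 'a, 'x) psf" where
  "id_psf K = \<lparr>
    pob = (\<lambda>A. A),
    phom = (\<lambda>A B. id_ftr),
    pcomp = (\<lambda>A B C g f. one (Hom K A C) (comp1 K A B C g f))\<rparr>"

text \<open>The composite of \<open>F : K \<rightarrow> M\<close> and \<open>G : M \<rightarrow> N\<close>; its compositor is
  \<open>(G F g)(G F f) \<Rightarrow> G ((F g)(F f)) \<Rightarrow> G F (g f)\<close>.\<close>

definition comp_psf ::
  "('o, 'a, 'x) twocat \<Rightarrow> ('p, 'b, 'y) twocat \<Rightarrow> ('q, 'c, 'z) twocat \<Rightarrow>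
   ('p, 'b, 'y, 'q, 'c, 'z) psf \<Rightarrow> ('o, 'a, 'x, 'p, 'b, 'y) psf \<Rightarrow>
   ('o, 'a, 'x, 'q, 'c, 'z) psf" where
  "comp_psf K M N G F = \<lparr>
    pob = (\<lambda>A. pob G (pob F A)),
    phom = (\<lambda>A B. comp_ftr (phom G (pob F A) (pob F B)) (phom F A B)),
    pcomp = (\<lambda>A B C g f.
      let FA = pob F A; FB = pob F B; FC = pob F C;
          FgFf = comp1 M FA FB FC (map1 F B C g) (map1 F A B f);
          Fgf = map1 F A C (comp1 K A B C g f)
      in cmp (Hom N (pob G FA) (pob G FC))
           (comp1 N (pob G FA) (pob G FB) (pob G FC)
              (map1 G FB FC (map1 F B C g)) (map1 G FA FB (map1 F A B f)))
           (map1 G FA FC FgFf)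
           (map1 G FA FC Fgf)
           (map2 G FA FC FgFf Fgf (pcomp F A B C g f))
           (pcomp G FA FB FC (map1 F B C g) (map1 F A B f)))\<rparr>"

definition op_psf :: "('o, 'a, 'x, 'p, 'b, 'y) psf \<Rightarrow> ('o, 'a, 'x, 'p, 'b, 'y) psf" where
  "op_psf F = \<lparr>
    pob = pob F,
    phom = (\<lambda>A B. phom F B A),
    pcomp = (\<lambda>A B C g f. pcomp F C B A f g)\<rparr>"

definition prod_psf ::
  "('o, 'a, 'x, 'p, 'b, 'y) psf \<Rightarrow> ('o', 'a', 'x', 'p', 'b', 'y') psf \<Rightarrow>
   ('o \<times> 'o', 'a \<times> 'a', 'x \<times> 'x', 'p \<times> 'p', 'b \<times> 'b', 'y \<times> 'y') psf" where
  "prod_psf F G = \<lparr>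
    pob = (\<lambda>(A, B). (pob F A, pob G B)),
    phom = (\<lambda>(A, B) (A', B'). \<lparr>
      fob = (\<lambda>(f, h). (map1 F A A' f, map1 G B B' h)),
      far = (\<lambda>(f, h) (f', h') (\<alpha>, \<gamma>). (map2 F A A' f f' \<alpha>, map2 G B B' h h' \<gamma>))\<rparr>),
    pcomp = (\<lambda>(A, B) (A', B') (A'', B'') (g, k) (f, h).
      (pcomp F A A' A'' g f, pcomp G B B' B'' k h))\<rparr>"

text \<open>The represented 2-functor \<open>K(-,Y) : K\<^sup>o\<^sup>p \<rightarrow> CAT\<close>: a morphism \<open>f : X' \<rightarrow> X\<close> acts by \<open>h \<mapsto> h f\<close>.\<close>

definition repr_psf ::
  "('o, 'a, 'x) twocat \<Rightarrow> 'o \<Rightarrow>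
   ('o, 'a, 'x, ('a, 'x) cat, ('a, 'x, 'a, 'x) ftr, 'a \<Rightarrow> 'x) psf" where
  "repr_psf K Y = (
    let act = (\<lambda>X X' f. restrict_ftr (Hom K X Y) \<lparr>
          fob = (\<lambda>h. comp1 K X' X Y h f),
          far = (\<lambda>h h' \<theta>. rwhisk K X' X Y h h' f \<theta>)\<rparr>)
    in \<lparr>
      pob = (\<lambda>X. Hom K X Y),
      phom = (\<lambda>X X'. \<lparr>
        fob = act X X',
        far = (\<lambda>f f' \<alpha>. \<lambda>h \<in> obj (Hom K X Y). lwhisk K X' X Y h f f' \<alpha>)\<rparr>),
      pcomp = (\<lambda>X X' X'' g f. one (Hom CAT (Hom K X Y) (Hom K X'' Y))
        (act X X'' (comp1 (op2 K) X X' X'' g f)))\<rparr>)"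

text \<open>The hom 2-functor \<open>K(-,-) : K\<^sup>o\<^sup>p \<times> K \<rightarrow> CAT\<close>: a pair of morphisms \<open>f : X' \<rightarrow> X\<close>, \<open>g : Y \<rightarrow> Y'\<close>
  acts by \<open>h \<mapsto> (g h) f\<close>.\<close>

definition hom_psf ::
  "('o, 'a, 'x) twocat \<Rightarrow>
   ('o \<times> 'o, 'a \<times> 'a, 'x \<times> 'x, ('a, 'x) cat, ('a, 'x, 'a, 'x) ftr, 'a \<Rightarrow> 'x) psf" where
  "hom_psf K = (
    let act = (\<lambda>(X, Y) (X', Y') (f, g). restrict_ftr (Hom K X Y) \<lparr>
          fob = (\<lambda>h. comp1 K X' X Y' (comp1 K X Y Y' g h) f),
          far = (\<lambda>h h' \<theta>. rwhisk K X' X Y' (comp1 K X Y Y' g h) (comp1 K X Y Y' g h') f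
                            (lwhisk K X Y Y' g h h' \<theta>))\<rparr>)
    in \<lparr>
      pob = (\<lambda>(X, Y). Hom K X Y),
      phom = (\<lambda>P P'. \<lparr>
        fob = act P P',
        far = (case P of (X, Y) \<Rightarrow> case P' of (X', Y') \<Rightarrow>
          (\<lambda>(f, g) (f', g') (\<alpha>, \<beta>). \<lambda>h \<in> obj (Hom K X Y).
            comp2 K X' X Y' (comp1 K X Y Y' g h) (comp1 K X Y Y' g' h) f f'
              (rwhisk K X Y Y' g g' h \<beta>) \<alpha>))\<rparr>),
      pcomp = (\<lambda>P P' P'' v u. one (Hom CAT (case_prod (Hom K) P) (case_prod (Hom K) P''))
        (act P P'' (comp1 (prod2 (op2 K) K) P P' P'' v u)))\<rparr>)"


section \<open>Pseudo-natural transformations, modifications and the 2-category \<open>Ps\<close>\<close>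

text \<open>\<open>tcell \<rho> A B f\<close> is the structure 2-morphism \<open>(G f) \<rho>\<^sub>A \<Rightarrow> \<rho>\<^sub>B (F f)\<close>.\<close>

record ('o, 'a, 'b, 'y) pnt =
  tob :: "'o \<Rightarrow> 'b"
  tcell :: "'o \<Rightarrow> 'o \<Rightarrow> 'a \<Rightarrow> 'y"

locale pseudo_nat_trans =
  fixes K :: "('o, 'a, 'x) twocat" and M :: "('p, 'b, 'y) twocat"
    and F G :: "('o, 'a, 'x, 'p, 'b, 'y) psf" and \<rho> :: "('o, 'a, 'b, 'y) pnt"
  assumes tob_in: "A \<in> Ob K \<Longrightarrow> tob \<rho> A \<in> obj (Hom M (pob F A) (pob G A))"
    and tcell_iso: "\<lbrakk>A \<in> Ob K; B \<in> Ob K; f \<in> obj (Hom K A B)\<rbrakk>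
      \<Longrightarrow> is_iso (Hom M (pob F A) (pob G B))
            (comp1 M (pob F A) (pob G A) (pob G B) (map1 G A B f) (tob \<rho> A))
            (comp1 M (pob F A) (pob F B) (pob G B) (tob \<rho> B) (map1 F A B f))
            (tcell \<rho> A B f)"
    and tcell_natural: "\<lbrakk>A \<in> Ob K; B \<in> Ob K; f \<in> obj (Hom K A B); f' \<in> obj (Hom K A B);
        \<alpha> \<in> arr (Hom K A B) f f'\<rbrakk>
      \<Longrightarrow> cmp (Hom M (pob F A) (pob G B))
            (comp1 M (pob F A) (pob G A) (pob G B) (map1 G A B f) (tob \<rho> A))
            (comp1 M (pob F A) (pob G A) (pob G B) (map1 G A B f') (tob \<rho> A))
            (comp1 M (pob F A) (pob F B) (pob G B) (tob \<rho> B) (map1 F A B f'))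
            (tcell \<rho> A B f')
            (rwhisk M (pob F A) (pob G A) (pob G B) (map1 G A B f) (map1 G A B f') (tob \<rho> A)
               (map2 G A B f f' \<alpha>)) =
          cmp (Hom M (pob F A) (pob G B))
            (comp1 M (pob F A) (pob G A) (pob G B) (map1 G A B f) (tob \<rho> A))
            (comp1 M (pob F A) (pob F B) (pob G B) (tob \<rho> B) (map1 F A B f))
            (comp1 M (pob F A) (pob F B) (pob G B) (tob \<rho> B) (map1 F A B f'))
            (lwhisk M (pob F A) (pob F B) (pob G B) (tob \<rho> B) (map1 F A B f) (map1 F A B f')
               (map2 F A B f f' \<alpha>))
            (tcell \<rho> A B f)"
    and tcell_Id: "A \<in> Ob K
      \<Longrightarrow> tcell \<rho> A A (Id K A) = one (Hom M (pob F A) (pob G A)) (tob \<rho> A)"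
    and tcell_comp: "\<lbrakk>A \<in> Ob K; B \<in> Ob K; C \<in> Ob K; f \<in> obj (Hom K A B); g \<in> obj (Hom K B C)\<rbrakk>
      \<Longrightarrow> cmp (Hom M (pob F A) (pob G C))
            (comp1 M (pob F A) (pob G A) (pob G C)
               (comp1 M (pob G A) (pob G B) (pob G C) (map1 G B C g) (map1 G A B f)) (tob \<rho> A))
            (comp1 M (pob F A) (pob G A) (pob G C) (map1 G A C (comp1 K A B C g f)) (tob \<rho> A))
            (comp1 M (pob F A) (pob F C) (pob G C) (tob \<rho> C) (map1 F A C (comp1 K A B C g f)))
            (tcell \<rho> A C (comp1 K A B C g f))
            (rwhisk M (pob F A) (pob G A) (pob G C)
               (comp1 M (pob G A) (pob G B) (pob G C) (map1 G B C g) (map1 G A B f))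
               (map1 G A C (comp1 K A B C g f)) (tob \<rho> A)
               (pcomp G A B C g f)) =
          cmp (Hom M (pob F A) (pob G C))
            (comp1 M (pob F A) (pob G A) (pob G C)
               (comp1 M (pob G A) (pob G B) (pob G C) (map1 G B C g) (map1 G A B f)) (tob \<rho> A))
            (comp1 M (pob F A) (pob F C) (pob G C) (tob \<rho> C)
               (comp1 M (pob F A) (pob F B) (pob F C) (map1 F B C g) (map1 F A B f)))
            (comp1 M (pob F A) (pob F C) (pob G C) (tob \<rho> C) (map1 F A C (comp1 K A B C g f)))
            (lwhisk M (pob F A) (pob F C) (pob G C) (tob \<rho> C)
               (comp1 M (pob F A) (pob F B) (pob F C) (map1 F B C g) (map1 F A B f))
               (map1 F A C (comp1 K A B C g f))
               (pcomp F A B C g f))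
            (cmp (Hom M (pob F A) (pob G C))
               (comp1 M (pob F A) (pob G A) (pob G C)
                  (comp1 M (pob G A) (pob G B) (pob G C) (map1 G B C g) (map1 G A B f)) (tob \<rho> A))
               (comp1 M (pob F A) (pob G B) (pob G C) (map1 G B C g)
                  (comp1 M (pob F A) (pob F B) (pob G B) (tob \<rho> B) (map1 F A B f)))
               (comp1 M (pob F A) (pob F C) (pob G C) (tob \<rho> C)
                  (comp1 M (pob F A) (pob F B) (pob F C) (map1 F B C g) (map1 F A B f)))
               (rwhisk M (pob F A) (pob F B) (pob G C)
                  (comp1 M (pob F B) (pob G B) (pob G C) (map1 G B C g) (tob \<rho> B))
                  (comp1 M (pob F B) (pob F C) (pob G C) (tob \<rho> C) (map1 F B C g))
                  (map1 F A B f)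
                  (tcell \<rho> B C g))
               (lwhisk M (pob F A) (pob G B) (pob G C) (map1 G B C g)
                  (comp1 M (pob F A) (pob G A) (pob G B) (map1 G A B f) (tob \<rho> A))
                  (comp1 M (pob F A) (pob F B) (pob G B) (tob \<rho> B) (map1 F A B f))
                  (tcell \<rho> A B f)))"

definition restrict_pnt ::
  "('o, 'a, 'x) twocat \<Rightarrow> ('o, 'a, 'b, 'y) pnt \<Rightarrow> ('o, 'a, 'b, 'y) pnt" where
  "restrict_pnt K \<rho> = \<lparr>
    tob = (\<lambda>A. if A \<in> Ob K then tob \<rho> A else undefined),
    tcell = (\<lambda>A B f. if A \<in> Ob K \<and> B \<in> Ob K \<and> f \<in> obj (Hom K A B)
                     then tcell \<rho> A B f else undefined)\<rparr>"

locale modification =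
  fixes K :: "('o, 'a, 'x) twocat" and M :: "('p, 'b, 'y) twocat"
    and F G :: "('o, 'a, 'x, 'p, 'b, 'y) psf" and \<rho> \<sigma> :: "('o, 'a, 'b, 'y) pnt"
    and \<Gamma> :: "'o \<Rightarrow> 'y"
  assumes component_in: "A \<in> Ob K
      \<Longrightarrow> \<Gamma> A \<in> arr (Hom M (pob F A) (pob G A)) (tob \<rho> A) (tob \<sigma> A)"
    and compatible: "\<lbrakk>A \<in> Ob K; B \<in> Ob K; f \<in> obj (Hom K A B)\<rbrakk>
      \<Longrightarrow> cmp (Hom M (pob F A) (pob G B))
            (comp1 M (pob F A) (pob G A) (pob G B) (map1 G A B f) (tob \<rho> A))
            (comp1 M (pob F A) (pob G A) (pob G B) (map1 G A B f) (tob \<sigma> A))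
            (comp1 M (pob F A) (pob F B) (pob G B) (tob \<sigma> B) (map1 F A B f))
            (tcell \<sigma> A B f)
            (lwhisk M (pob F A) (pob G A) (pob G B) (map1 G A B f) (tob \<rho> A) (tob \<sigma> A) (\<Gamma> A)) =
          cmp (Hom M (pob F A) (pob G B))
            (comp1 M (pob F A) (pob G A) (pob G B) (map1 G A B f) (tob \<rho> A))
            (comp1 M (pob F A) (pob F B) (pob G B) (tob \<rho> B) (map1 F A B f))
            (comp1 M (pob F A) (pob F B) (pob G B) (tob \<sigma> B) (map1 F A B f))
            (rwhisk M (pob F A) (pob F B) (pob G B) (tob \<rho> B) (tob \<sigma> B) (map1 F A B f) (\<Gamma> B))
            (tcell \<rho> A B f)"

definition id_pnt ::
  "('o, 'a, 'x) twocat \<Rightarrow> ('p, 'b, 'y) twocat \<Rightarrow> ('o, 'a, 'x, 'p, 'b, 'y) psf \<Rightarrow>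
   ('o, 'a, 'b, 'y) pnt" where
  "id_pnt K M F = restrict_pnt K \<lparr>
    tob = (\<lambda>A. Id M (pob F A)),
    tcell = (\<lambda>A B f. one (Hom M (pob F A) (pob F B)) (map1 F A B f))\<rparr>"

text \<open>For \<open>\<rho> : F \<Rightarrow> G\<close> and \<open>\<sigma> : G \<Rightarrow> H\<close>, the structure 2-morphism of the composite is
  \<open>(H f) \<sigma>\<^sub>A \<rho>\<^sub>A \<Rightarrow> \<sigma>\<^sub>B (G f) \<rho>\<^sub>A \<Rightarrow> \<sigma>\<^sub>B \<rho>\<^sub>B (F f)\<close>.\<close>

definition comp_pnt ::
  "('o, 'a, 'x) twocat \<Rightarrow> ('p, 'b, 'y) twocat \<Rightarrow>
   ('o, 'a, 'x, 'p, 'b, 'y) psf \<Rightarrow> ('o, 'a, 'x, 'p, 'b, 'y) psf \<Rightarrow> ('o, 'a, 'x, 'p, 'b, 'y) psf \<Rightarrow>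
   ('o, 'a, 'b, 'y) pnt \<Rightarrow> ('o, 'a, 'b, 'y) pnt \<Rightarrow> ('o, 'a, 'b, 'y) pnt" where
  "comp_pnt K M F G H \<sigma> \<rho> = restrict_pnt K \<lparr>
    tob = (\<lambda>A. comp1 M (pob F A) (pob G A) (pob H A) (tob \<sigma> A) (tob \<rho> A)),
    tcell = (\<lambda>A B f.
      let FA = pob F A; FB = pob F B; GA = pob G A; GB = pob G B; HA = pob H A; HB = pob H B;
          Ff = map1 F A B f; Gf = map1 G A B f; Hf = map1 H A B f
      in cmp (Hom M FA HB)
           (comp1 M FA GA HB (comp1 M GA HA HB Hf (tob \<sigma> A)) (tob \<rho> A))
           (comp1 M FA GA HB (comp1 M GA GB HB (tob \<sigma> B) Gf) (tob \<rho> A))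
           (comp1 M FA GB HB (tob \<sigma> B) (comp1 M FA FB GB (tob \<rho> B) Ff))
           (lwhisk M FA GB HB (tob \<sigma> B)
              (comp1 M FA GA GB Gf (tob \<rho> A)) (comp1 M FA FB GB (tob \<rho> B) Ff)
              (tcell \<rho> A B f))
           (rwhisk M FA GA HB
              (comp1 M GA HA HB Hf (tob \<sigma> A)) (comp1 M GA GB HB (tob \<sigma> B) Gf) (tob \<rho> A)
              (tcell \<sigma> A B f)))\<rparr>"

definition pnt_cat ::
  "('o, 'a, 'x) twocat \<Rightarrow> ('p, 'b, 'y) twocat \<Rightarrow>
   ('o, 'a, 'x, 'p, 'b, 'y) psf \<Rightarrow> ('o, 'a, 'x, 'p, 'b, 'y) psf \<Rightarrow>
   (('o, 'a, 'b, 'y) pnt, 'o \<Rightarrow> 'y) cat" where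
  "pnt_cat K M F G = \<lparr>
    obj = {\<rho>. pseudo_nat_trans K M F G \<rho> \<and> restrict_pnt K \<rho> = \<rho>},
    arr = (\<lambda>\<rho> \<sigma>. {\<Gamma> \<in> extensional (Ob K). modification K M F G \<rho> \<sigma> \<Gamma>}),
    one = (\<lambda>\<rho>. \<lambda>A \<in> Ob K. one (Hom M (pob F A) (pob G A)) (tob \<rho> A)),
    cmp = (\<lambda>\<rho> \<sigma> \<tau> \<Delta> \<Gamma>. \<lambda>A \<in> Ob K.
      cmp (Hom M (pob F A) (pob G A)) (tob \<rho> A) (tob \<sigma> A) (tob \<tau> A) (\<Delta> A) (\<Gamma> A))\<rparr>"

definition Ps ::
  "('o, 'a, 'x) twocat \<Rightarrow> ('p, 'b, 'y) twocat \<Rightarrow>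
   (('o, 'a, 'x, 'p, 'b, 'y) psf, ('o, 'a, 'b, 'y) pnt, 'o \<Rightarrow> 'y) twocat" where
  "Ps K M = \<lparr>
    Ob = {F. normal_pseudo_functor K M F},
    Hom = pnt_cat K M,
    Id = id_pnt K M,
    Comp = (\<lambda>F G H. \<lparr>
      fob = (\<lambda>(\<sigma>, \<rho>). comp_pnt K M F G H \<sigma> \<rho>),
      far = (\<lambda>(\<sigma>, \<rho>) (\<sigma>', \<rho>') (\<Delta>, \<Gamma>). \<lambda>A \<in> Ob K.
        comp2 M (pob F A) (pob G A) (pob H A)
          (tob \<sigma> A) (tob \<sigma>' A) (tob \<rho> A) (tob \<rho>' A) (\<Delta> A) (\<Gamma> A))\<rparr>)\<rparr>"


section \<open>Bi-representations and bi-adjunctions\<close>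

definition bi_representation ::
  "('o, 'a, 'x) twocat \<Rightarrow>
   ('o, 'a, 'x, ('a, 'x) cat, ('a, 'x, 'a, 'x) ftr, 'a \<Rightarrow> 'x) psf \<Rightarrow> 'o \<Rightarrow>
   (('o, 'a, ('a, 'x, 'a, 'x) ftr, 'a \<Rightarrow> 'x) pnt, 'o \<Rightarrow> 'a \<Rightarrow> 'x) adj_eqv \<Rightarrow> bool" where
  "bi_representation K F I \<rho> \<longleftrightarrow>
    I \<in> Ob K \<and> adjoint_equivalence (Ps (op2 K) CAT) (repr_psf K I) F \<rho>"

text \<open>\<open>D(L-,Y) : C\<^sup>o\<^sup>p \<rightarrow> CAT\<close>\<close>

definition hom_from_fixed ::
  "('c, 'a, 'x) twocat \<Rightarrow> ('d, 'b, 'y) twocat \<Rightarrow> ('c, 'a, 'x, 'd, 'b, 'y) psf \<Rightarrow> 'd \<Rightarrow>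
   ('c, 'a, 'x, ('b, 'y) cat, ('b, 'y, 'b, 'y) ftr, 'b \<Rightarrow> 'y) psf" where
  "hom_from_fixed C D L Y = comp_psf (op2 C) (op2 D) CAT (repr_psf D Y) (op_psf L)"

text \<open>\<open>D(L-,-) : C\<^sup>o\<^sup>p \<times> D \<rightarrow> CAT\<close>\<close>

definition hom_from ::
  "('c, 'a, 'x) twocat \<Rightarrow> ('d, 'b, 'y) twocat \<Rightarrow> ('c, 'a, 'x, 'd, 'b, 'y) psf \<Rightarrow>
   ('c \<times> 'd, 'a \<times> 'b, 'x \<times> 'y, ('b, 'y) cat, ('b, 'y, 'b, 'y) ftr, 'b \<Rightarrow> 'y) psf" where
  "hom_from C D L =
    comp_psf (prod2 (op2 C) D) (prod2 (op2 D) D) CAT (hom_psf D) (prod_psf (op_psf L) (id_psf D))"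

text \<open>\<open>C(-,R-) : C\<^sup>o\<^sup>p \<times> D \<rightarrow> CAT\<close>\<close>

definition hom_to ::
  "('c, 'a, 'x) twocat \<Rightarrow> ('d, 'b, 'y) twocat \<Rightarrow> ('d, 'b, 'y, 'c, 'a, 'x) psf \<Rightarrow>
   ('c \<times> 'd, 'a \<times> 'b, 'x \<times> 'y, ('a, 'x) cat, ('a, 'x, 'a, 'x) ftr, 'a \<Rightarrow> 'x) psf" where
  "hom_to C D R =
    comp_psf (prod2 (op2 C) D) (prod2 (op2 C) C) CAT (hom_psf C) (prod_psf (id_psf (op2 C)) R)"

text \<open>Since \<open>C(-,R-)\<close> and \<open>D(L-,-)\<close> have to take values in the same \<open>CAT\<close>, the hom-categories of
  \<open>C\<close> and \<open>D\<close> live over a common pair of types.\<close>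

definition bi_adjunction ::
  "('c, 'a, 'x) twocat \<Rightarrow> ('d, 'a, 'x) twocat \<Rightarrow>
   ('c, 'a, 'x, 'd, 'a, 'x) psf \<Rightarrow> ('d, 'a, 'x, 'c, 'a, 'x) psf \<Rightarrow>
   (('c \<times> 'd, 'a \<times> 'a, ('a, 'x, 'a, 'x) ftr, 'a \<Rightarrow> 'x) pnt, 'c \<times> 'd \<Rightarrow> 'a \<Rightarrow> 'x) adj_eqv \<Rightarrow> bool"
  where
  "bi_adjunction C D L R \<Phi> \<longleftrightarrow>
    normal_pseudo_functor C D L \<and> normal_pseudo_functor D C R \<and>
    adjoint_equivalence (Ps (prod2 (op2 C) D) CAT) (hom_to C D R) (hom_from C D L) \<Phi>"

definition right_bi_adjoint ::
  "('c, 'a, 'x) twocat \<Rightarrow> ('d, 'a, 'x) twocat \<Rightarrow>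
   ('c, 'a, 'x, 'd, 'a, 'x) psf \<Rightarrow> ('d, 'a, 'x, 'c, 'a, 'x) psf \<Rightarrow> bool" where
  "right_bi_adjoint C D L R \<longleftrightarrow> (\<exists>\<Phi>. bi_adjunction C D L R \<Phi>)"

end

theory Submission
  imports Defs
begin

text \<open>
  Both statements are equivalent to a third one, which mentions no pseudo-natural transformation: every
  \<open>Y\<close> admits a \<^emph>\<open>universal counit\<close>, that is an object \<open>Z\<close> and a morphism \<open>e : L Z \<rightarrow> Y\<close> such that, for
  all \<open>X\<close>, the functor \<open>h \<mapsto> e (L h) : C(X,Z) \<rightarrow> D(L X,Y)\<close> is fully faithful and essentially surjective
  (a weak equivalence).

  \<^item> A bi-representation or a bi-adjunction yields a universal counit by the Yoneda argument: put
    \<open>e = \<Psi>(1)\<close>. The structure cell of \<open>\<Psi>\<close> at \<open>h : X \<rightarrow> Z\<close>, evaluated at \<open>1\<close>, is an invertible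
    \<open>e (L h) \<Rightarrow> \<Psi>(h)\<close>, natural in \<open>h\<close>, and \<open>\<Psi>\<close> is a weak equivalence at \<open>X\<close>
    (\<open>bi_representation_universal\<close>). For a bi-adjunction the structure cells at the pairs \<open>(h, 1)\<close> do the same
    (\<open>bi_adjunction_universal\<close>).

  \<^item> A universal counit yields a bi-representation with \<open>\<Psi>(h) = e (L h)\<close>, whose structure cells come
    from the compositor of \<open>L\<close> (\<open>universal_bi_representation\<close>).

  \<^item> A universal counit \<open>e\<close> for each object yields \<open>R\<close> by choice and full faithfulness. For
    \<open>g : A \<rightarrow> B\<close> essential surjectivity gives \<open>R g\<close> with an invertible \<open>w : g e \<Rightarrow> e L(R g)\<close>, where
    identities are lifted to identities to make \<open>R\<close> normal. The value of \<open>R\<close> on 2-morphisms and its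
    compositor are the unique cells compatible with the \<open>w\<close>'s, so each axiom for \<open>R\<close> is an equation of
    cells that full faithfulness reduces to a computation in \<open>D\<close>. The same cells assemble to the structure
    cells of \<open>h \<mapsto> e (L h) : C(X,R Y) \<rightarrow> D(L X,Y)\<close>, pseudo-natural in \<open>X\<close> and \<open>Y\<close> (\<open>R_normal\<close>, \<open>\<Phi>_pnt\<close>).

  What remains is to pass between weak equivalences and adjoint equivalences in \<open>Ps\<close>. One direction
  is pointwise (\<open>Ps_equivalence_weak\<close>). For the other (\<open>weak_equivalence_Ps\<close>), a weak equivalence
  of categories is part of an adjoint equivalence, and a pseudo-natural transformation with a chosen adjoint
  inverse at each object has a pseudo-natural adjoint inverse: its structure cells are the mates of the inverses
  of the given ones (\<open>adjoint_equivalence_Ps\<close>).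
\<close>

section \<open>Cells with their boundary\<close>

text \<open>In the given records a composite is indexed by all objects and morphisms involved, so a pasting diagram of a few
  cells is unreadable and not amenable to rewriting. Here cells carry their boundary. The operations
  below then need no indices, sources and targets of composites compute by rewriting, and the laws of a
  2-category become conditional rewrite rules whose side conditions the simplifier decides. The normal form is a
  right-nested vertical composite of whiskered cells \<open>g |> \<alpha> <| f\<close>.\<close>

datatype ('o, 'a) mor = Mor (dm: 'o) (cd: 'o) (raw1: 'a)
datatype ('o, 'a, 'x) cell = Cell (src: "('o, 'a) mor") (trg: "('o, 'a) mor") (raw2: 'x)

definition is1 :: "('o, 'a, 'x) twocat \<Rightarrow> ('o, 'a) mor \<Rightarrow> bool" where
  "is1 K f \<longleftrightarrow> dm f \<in> Ob K \<and> cd f \<in> Ob K \<and> raw1 f \<in> obj (Hom K (dm f) (cd f))"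

definition is2 :: "('o, 'a, 'x) twocat \<Rightarrow> ('o, 'a, 'x) cell \<Rightarrow> bool" where
  "is2 K \<alpha> \<longleftrightarrow> is1 K (src \<alpha>) \<and> is1 K (trg \<alpha>) \<and> dm (trg \<alpha>) = dm (src \<alpha>) \<and> cd (trg \<alpha>) = cd (src \<alpha>) \<and>
     raw2 \<alpha> \<in> arr (Hom K (dm (src \<alpha>)) (cd (src \<alpha>))) (raw1 (src \<alpha>)) (raw1 (trg \<alpha>))"

definition id1 :: "('o, 'a, 'x) twocat \<Rightarrow> 'o \<Rightarrow> ('o, 'a) mor" where
  "id1 K A = Mor A A (Id K A)"

definition id2 :: "('o, 'a, 'x) twocat \<Rightarrow> ('o, 'a) mor \<Rightarrow> ('o, 'a, 'x) cell" where
  "id2 K f = Cell f f (one (Hom K (dm f) (cd f)) (raw1 f))"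

definition o1 :: "('o, 'a, 'x) twocat \<Rightarrow> ('o, 'a) mor \<Rightarrow> ('o, 'a) mor \<Rightarrow> ('o, 'a) mor"
    (infixr "\<odot>\<index>" 75) where
  "g \<odot>\<^bsub>K\<^esub> f = Mor (dm f) (cd g) (comp1 K (dm f) (cd f) (cd g) (raw1 g) (raw1 f))"

definition vc :: "('o, 'a, 'x) twocat \<Rightarrow> ('o, 'a, 'x) cell \<Rightarrow> ('o, 'a, 'x) cell \<Rightarrow> ('o, 'a, 'x) cell"
    (infixr "\<bullet>\<index>" 65) where
  "\<beta> \<bullet>\<^bsub>K\<^esub> \<alpha> = Cell (src \<alpha>) (trg \<beta>) (cmp (Hom K (dm (src \<alpha>)) (cd (src \<alpha>)))
     (raw1 (src \<alpha>)) (raw1 (trg \<alpha>)) (raw1 (trg \<beta>)) (raw2 \<beta>) (raw2 \<alpha>))"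

definition hc :: "('o, 'a, 'x) twocat \<Rightarrow> ('o, 'a, 'x) cell \<Rightarrow> ('o, 'a, 'x) cell \<Rightarrow> ('o, 'a, 'x) cell"
    (infixr "\<star>\<index>" 70) where
  "\<beta> \<star>\<^bsub>K\<^esub> \<alpha> = Cell (src \<beta> \<odot>\<^bsub>K\<^esub> src \<alpha>) (trg \<beta> \<odot>\<^bsub>K\<^esub> trg \<alpha>)
     (comp2 K (dm (src \<alpha>)) (cd (src \<alpha>)) (cd (src \<beta>))
       (raw1 (src \<beta>)) (raw1 (trg \<beta>)) (raw1 (src \<alpha>)) (raw1 (trg \<alpha>)) (raw2 \<beta>) (raw2 \<alpha>))"

definition lw :: "('o, 'a, 'x) twocat \<Rightarrow> ('o, 'a) mor \<Rightarrow> ('o, 'a, 'x) cell \<Rightarrow> ('o, 'a, 'x) cell"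
    (infixr "|>\<index>" 72) where
  "g |>\<^bsub>K\<^esub> \<alpha> = id2 K g \<star>\<^bsub>K\<^esub> \<alpha>"

definition rw :: "('o, 'a, 'x) twocat \<Rightarrow> ('o, 'a, 'x) cell \<Rightarrow> ('o, 'a) mor \<Rightarrow> ('o, 'a, 'x) cell"
    (infixl "<|\<index>" 73) where
  "\<beta> <|\<^bsub>K\<^esub> f = \<beta> \<star>\<^bsub>K\<^esub> id2 K f"

definition iso2 :: "('o, 'a, 'x) twocat \<Rightarrow> ('o, 'a, 'x) cell \<Rightarrow> bool" where
  "iso2 K \<alpha> \<longleftrightarrow> is2 K \<alpha> \<and> (\<exists>\<beta>. is2 K \<beta> \<and> src \<beta> = trg \<alpha> \<and> trg \<beta> = src \<alpha> \<and>
     \<beta> \<bullet>\<^bsub>K\<^esub> \<alpha> = id2 K (src \<alpha>) \<and> \<alpha> \<bullet>\<^bsub>K\<^esub> \<beta> = id2 K (trg \<alpha>))"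

definition inv2 :: "('o, 'a, 'x) twocat \<Rightarrow> ('o, 'a, 'x) cell \<Rightarrow> ('o, 'a, 'x) cell" where
  "inv2 K \<alpha> = (SOME \<beta>. is2 K \<beta> \<and> src \<beta> = trg \<alpha> \<and> trg \<beta> = src \<alpha> \<and>
     \<beta> \<bullet>\<^bsub>K\<^esub> \<alpha> = id2 K (src \<alpha>) \<and> \<alpha> \<bullet>\<^bsub>K\<^esub> \<beta> = id2 K (trg \<alpha>))"

lemma frame [simp]:
  "dm (id1 K A) = A" "cd (id1 K A) = A"
  "src (id2 K f) = f" "trg (id2 K f) = f"
  "dm (g \<odot>\<^bsub>K\<^esub> f) = dm f" "cd (g \<odot>\<^bsub>K\<^esub> f) = cd g"
  "src (\<beta> \<bullet>\<^bsub>K\<^esub> \<alpha>) = src \<alpha>" "trg (\<beta> \<bullet>\<^bsub>K\<^esub> \<alpha>) = trg \<beta>"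
  "src (\<beta> \<star>\<^bsub>K\<^esub> \<alpha>) = src \<beta> \<odot>\<^bsub>K\<^esub> src \<alpha>" "trg (\<beta> \<star>\<^bsub>K\<^esub> \<alpha>) = trg \<beta> \<odot>\<^bsub>K\<^esub> trg \<alpha>"
  "src (g |>\<^bsub>K\<^esub> \<alpha>) = g \<odot>\<^bsub>K\<^esub> src \<alpha>" "trg (g |>\<^bsub>K\<^esub> \<alpha>) = g \<odot>\<^bsub>K\<^esub> trg \<alpha>"
  "src (\<beta> <|\<^bsub>K\<^esub> f) = src \<beta> \<odot>\<^bsub>K\<^esub> f" "trg (\<beta> <|\<^bsub>K\<^esub> f) = trg \<beta> \<odot>\<^bsub>K\<^esub> f"
  by (simp_all add: id1_def id2_def o1_def vc_def hc_def lw_def rw_def)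

lemma is1_Mor: "is1 K (Mor A B f) \<longleftrightarrow> A \<in> Ob K \<and> B \<in> Ob K \<and> f \<in> obj (Hom K A B)"
  by (simp add: is1_def)

lemma is2_Cell: "is2 K (Cell (Mor A B f) (Mor A B g) \<alpha>) \<longleftrightarrow>
    A \<in> Ob K \<and> B \<in> Ob K \<and> f \<in> obj (Hom K A B) \<and> g \<in> obj (Hom K A B) \<and> \<alpha> \<in> arr (Hom K A B) f g"
  by (auto simp: is2_def is1_def)

lemma is1E [consumes 1]:
  assumes "is1 K f"
  obtains A B f' where "f = Mor A B f'" "A \<in> Ob K" "B \<in> Ob K" "f' \<in> obj (Hom K A B)"
  using assms by (cases f) (simp add: is1_def)

lemma is2E [consumes 1]:
  assumes "is2 K \<alpha>"
  obtains A B f g a where "\<alpha> = Cell (Mor A B f) (Mor A B g) a" "A \<in> Ob K" "B \<in> Ob K"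
    "f \<in> obj (Hom K A B)" "g \<in> obj (Hom K A B)" "a \<in> arr (Hom K A B) f g"
proof (cases \<alpha>)
  case (Cell f g a)
  with assms that show ?thesis
    by (cases f; cases g) (auto simp: is2_def is1_def)
qed

lemma is2_is1: "is2 K \<alpha> \<Longrightarrow> is1 K (src \<alpha>)" "is2 K \<alpha> \<Longrightarrow> is1 K (trg \<alpha>)"
  by (simp_all add: is2_def)

lemma is2_frame:
  "is2 K \<alpha> \<Longrightarrow> dm (trg \<alpha>) = dm (src \<alpha>)" "is2 K \<alpha> \<Longrightarrow> cd (trg \<alpha>) = cd (src \<alpha>)"
  by (simp_all add: is2_def)

lemma is1_Ob: "is1 K f \<Longrightarrow> dm f \<in> Ob K" "is1 K f \<Longrightarrow> cd f \<in> Ob K"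
  by (simp_all add: is1_def)

locale two_cat = two_category K for K :: "('o, 'a, 'x) twocat" (structure)
begin

lemma cat: "A \<in> Ob K \<Longrightarrow> B \<in> Ob K \<Longrightarrow> category (Hom K A B)"
  by (rule hom_category)

lemma is1_id1 [simp]: "A \<in> Ob K \<Longrightarrow> is1 K (id1 K A)"
  by (simp add: is1_def id1_def Id_in)

lemma is1_o1 [simp]: "is1 K f \<Longrightarrow> is1 K g \<Longrightarrow> cd f = dm g \<Longrightarrow> is1 K (g \<odot> f)"
  using cat_functor.fob_in[OF Comp_functor, of "dm f" "cd f" "cd g" "(raw1 g, raw1 f)"]
  by (simp add: is1_def o1_def prod_cat_def)

lemma is2_id2 [simp]: "is1 K f \<Longrightarrow> is2 K (id2 K f)"
  by (auto simp: is1_def is2_def id2_def intro: category.one_in cat)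

lemma is2_vc [simp]: "is2 K \<alpha> \<Longrightarrow> is2 K \<beta> \<Longrightarrow> trg \<alpha> = src \<beta> \<Longrightarrow> is2 K (\<beta> \<bullet> \<alpha>)"
  by (auto simp: is1_def is2_def vc_def intro: category.cmp_in cat)

lemma is2_hc [simp]:
  assumes "is2 K \<alpha>" "is2 K \<beta>" "cd (src \<alpha>) = dm (src \<beta>)"
  shows "is2 K (\<beta> \<star> \<alpha>)"
proof -
  have "cd (trg \<alpha>) = dm (trg \<beta>)"
    using assms by (simp add: is2_frame[where K = K])
  with assms have "is1 K (src \<beta> \<odot> src \<alpha>)" "is1 K (trg \<beta> \<odot> trg \<alpha>)"
    by (simp_all add: is2_is1)
  moreover have "raw2 (\<beta> \<star> \<alpha>) \<in> arr (Hom K (dm (src \<alpha>)) (cd (src \<beta>)))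
      (raw1 (src \<beta> \<odot> src \<alpha>)) (raw1 (trg \<beta> \<odot> trg \<alpha>))"
    using assms cat_functor.far_in[OF Comp_functor, of "dm (src \<alpha>)" "cd (src \<alpha>)" "cd (src \<beta>)"
        "(raw1 (src \<beta>), raw1 (src \<alpha>))" "(raw1 (trg \<beta>), raw1 (trg \<alpha>))" "(raw2 \<beta>, raw2 \<alpha>)"]
    by (auto simp: hc_def o1_def is2_def is1_def prod_cat_def)
  ultimately show ?thesis
    using assms by (simp add: is2_def)
qed

lemma is2_lw [simp]: "is2 K \<alpha> \<Longrightarrow> is1 K g \<Longrightarrow> cd (src \<alpha>) = dm g \<Longrightarrow> is2 K (g |> \<alpha>)"
  by (simp add: lw_def)

lemma is2_rw [simp]: "is2 K \<alpha> \<Longrightarrow> is1 K f \<Longrightarrow> cd f = dm (src \<alpha>) \<Longrightarrow> is2 K (\<alpha> <| f)"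
  by (simp add: rw_def)

lemma o1_assoc [simp]: "is1 K f \<Longrightarrow> is1 K g \<Longrightarrow> is1 K h \<Longrightarrow> cd f = dm g \<Longrightarrow> cd g = dm h \<Longrightarrow>
    (h \<odot> g) \<odot> f = h \<odot> g \<odot> f"
  using comp1_assoc[of "dm f" "cd f" "cd g" "cd h" "raw1 f" "raw1 g" "raw1 h"]
  by (simp add: is1_def o1_def)

lemma o1_id1 [simp]: "is1 K f \<Longrightarrow> A = dm f \<Longrightarrow> f \<odot> id1 K A = f"
    "is1 K f \<Longrightarrow> A = cd f \<Longrightarrow> id1 K A \<odot> f = f"
  using comp1_Id_right[of "dm f" "cd f" "raw1 f"] comp1_Id_left[of "dm f" "cd f" "raw1 f"]
  by (simp_all add: is1_def o1_def id1_def)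

lemma vc_assoc [simp]: "is2 K \<alpha> \<Longrightarrow> is2 K \<beta> \<Longrightarrow> is2 K \<gamma> \<Longrightarrow> trg \<alpha> = src \<beta> \<Longrightarrow> trg \<beta> = src \<gamma> \<Longrightarrow>
    (\<gamma> \<bullet> \<beta>) \<bullet> \<alpha> = \<gamma> \<bullet> \<beta> \<bullet> \<alpha>"
  using category.cmp_assoc[OF cat, of "dm (src \<alpha>)" "cd (src \<alpha>)" "raw1 (src \<alpha>)" "raw1 (trg \<alpha>)"
      "raw1 (trg \<beta>)" "raw1 (trg \<gamma>)" "raw2 \<alpha>" "raw2 \<beta>" "raw2 \<gamma>"]
  by (auto simp: is2_def is1_def vc_def)

lemma vc_id2 [simp]: "is2 K \<alpha> \<Longrightarrow> src \<alpha> = f \<Longrightarrow> \<alpha> \<bullet> id2 K f = \<alpha>"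
    "is2 K \<alpha> \<Longrightarrow> trg \<alpha> = f \<Longrightarrow> id2 K f \<bullet> \<alpha> = \<alpha>"
  using category.cmp_one_right[OF cat, of "dm (src \<alpha>)" "cd (src \<alpha>)" "raw1 (src \<alpha>)" "raw1 (trg \<alpha>)" "raw2 \<alpha>"]
    category.cmp_one_left[OF cat, of "dm (src \<alpha>)" "cd (src \<alpha>)" "raw1 (src \<alpha>)" "raw1 (trg \<alpha>)" "raw2 \<alpha>"]
  by (auto simp: is2_def is1_def vc_def id2_def cell.expand)

lemma interchange:
  assumes "is2 K \<alpha>" "is2 K \<beta>" "is2 K \<gamma>" "is2 K \<delta>"
    "trg \<alpha> = src \<beta>" "trg \<gamma> = src \<delta>" "cd (src \<alpha>) = dm (src \<gamma>)"
  shows "(\<delta> \<bullet> \<gamma>) \<star> (\<beta> \<bullet> \<alpha>) = (\<delta> \<star> \<beta>) \<bullet> (\<gamma> \<star> \<alpha>)"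
  using assms cat_functor.far_cmp[OF Comp_functor, of "dm (src \<alpha>)" "cd (src \<alpha>)" "cd (src \<gamma>)"
    "(raw1 (src \<gamma>), raw1 (src \<alpha>))" "(raw1 (trg \<gamma>), raw1 (trg \<alpha>))" "(raw1 (trg \<delta>), raw1 (trg \<beta>))"
    "(raw2 \<gamma>, raw2 \<alpha>)" "(raw2 \<delta>, raw2 \<beta>)"]
  by (auto simp: is2_def is1_def vc_def hc_def prod_cat_def o1_def)

lemma hc_id2: "is1 K f \<Longrightarrow> is1 K g \<Longrightarrow> cd f = dm g \<Longrightarrow> id2 K g \<star> id2 K f = id2 K (g \<odot> f)"
  using cat_functor.far_one[OF Comp_functor, of "dm f" "cd f" "cd g" "(raw1 g, raw1 f)"]
  by (simp add: is2_def is1_def id2_def hc_def prod_cat_def o1_def)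

lemma hc_assoc:
  assumes "is2 K \<alpha>" "is2 K \<beta>" "is2 K \<gamma>" "cd (src \<alpha>) = dm (src \<beta>)" "cd (src \<beta>) = dm (src \<gamma>)"
  shows "(\<gamma> \<star> \<beta>) \<star> \<alpha> = \<gamma> \<star> \<beta> \<star> \<alpha>"
proof -
  have "src ((\<gamma> \<star> \<beta>) \<star> \<alpha>) = src (\<gamma> \<star> \<beta> \<star> \<alpha>)" "trg ((\<gamma> \<star> \<beta>) \<star> \<alpha>) = trg (\<gamma> \<star> \<beta> \<star> \<alpha>)"
    using assms by (simp_all add: is2_is1 is2_frame)
  moreover have "raw2 ((\<gamma> \<star> \<beta>) \<star> \<alpha>) = raw2 (\<gamma> \<star> \<beta> \<star> \<alpha>)"
    using assms comp2_assoc[of "dm (src \<alpha>)" "cd (src \<alpha>)" "cd (src \<beta>)" "cd (src \<gamma>)" "raw1 (src \<alpha>)"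
      "raw1 (src \<beta>)" "raw1 (src \<gamma>)" "raw1 (trg \<alpha>)" "raw1 (trg \<beta>)" "raw1 (trg \<gamma>)"
      "raw2 \<alpha>" "raw2 \<beta>" "raw2 \<gamma>"]
    by (auto simp: is2_def hc_def is1_def o1_def)
  ultimately show ?thesis
    by (simp add: cell.expand)
qed

lemmas [simp] = is2_is1 is1_Ob is2_frame[where K = K]

lemma lw_rw_id2 [simp]: "is1 K f \<Longrightarrow> is1 K g \<Longrightarrow> cd f = dm g \<Longrightarrow> g |> id2 K f = id2 K (g \<odot> f)"
    "is1 K f \<Longrightarrow> is1 K g \<Longrightarrow> cd f = dm g \<Longrightarrow> id2 K g <| f = id2 K (g \<odot> f)"
  by (simp_all add: lw_def rw_def hc_id2)

lemma lw_rw_id1 [simp]: "is2 K \<alpha> \<Longrightarrow> A = cd (src \<alpha>) \<Longrightarrow> id1 K A |> \<alpha> = \<alpha>"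
    "is2 K \<alpha> \<Longrightarrow> A = dm (src \<alpha>) \<Longrightarrow> \<alpha> <| id1 K A = \<alpha>"
  using comp2_Id_left[of "dm (src \<alpha>)" "cd (src \<alpha>)" "raw1 (src \<alpha>)" "raw1 (trg \<alpha>)" "raw2 \<alpha>"]
    comp2_Id_right[of "dm (src \<alpha>)" "cd (src \<alpha>)" "raw1 (src \<alpha>)" "raw1 (trg \<alpha>)" "raw2 \<alpha>"]
    o1_id1[of "src \<alpha>"] o1_id1[of "trg \<alpha>"]
  by (auto simp del: is2_is1 is1_Ob is2_frame[where K = K] simp: is2_def is1_def lw_def rw_def hc_def id2_def id1_def cell.expand)

lemma lw_vc [simp]: "is2 K \<alpha> \<Longrightarrow> is2 K \<beta> \<Longrightarrow> trg \<alpha> = src \<beta> \<Longrightarrow> is1 K g \<Longrightarrow> cd (src \<alpha>) = dm g \<Longrightarrow>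
    g |> (\<beta> \<bullet> \<alpha>) = g |> \<beta> \<bullet> g |> \<alpha>"
  using interchange[of \<alpha> \<beta> "id2 K g" "id2 K g"] by (simp add: lw_def)

lemma rw_vc [simp]: "is2 K \<alpha> \<Longrightarrow> is2 K \<beta> \<Longrightarrow> trg \<alpha> = src \<beta> \<Longrightarrow> is1 K f \<Longrightarrow> cd f = dm (src \<alpha>) \<Longrightarrow>
    (\<beta> \<bullet> \<alpha>) <| f = \<beta> <| f \<bullet> \<alpha> <| f"
  using interchange[of "id2 K f" "id2 K f" \<alpha> \<beta>] by (simp add: rw_def)

lemma lw_lw [simp]: "is2 K \<alpha> \<Longrightarrow> is1 K g \<Longrightarrow> is1 K h \<Longrightarrow> cd (src \<alpha>) = dm g \<Longrightarrow> cd g = dm h \<Longrightarrow>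
    h |> g |> \<alpha> = (h \<odot> g) |> \<alpha>"
  by (simp add: lw_def hc_assoc[symmetric] hc_id2)

lemma rw_rw [simp]: "is2 K \<alpha> \<Longrightarrow> is1 K f \<Longrightarrow> is1 K g \<Longrightarrow> cd f = dm g \<Longrightarrow> cd g = dm (src \<alpha>) \<Longrightarrow>
    \<alpha> <| g <| f = \<alpha> <| (g \<odot> f)"
  by (simp add: rw_def hc_assoc hc_id2)

lemma lw_rw [simp]: "is2 K \<alpha> \<Longrightarrow> is1 K f \<Longrightarrow> is1 K g \<Longrightarrow> cd f = dm (src \<alpha>) \<Longrightarrow> cd (src \<alpha>) = dm g \<Longrightarrow>
    (g |> \<alpha>) <| f = g |> (\<alpha> <| f)"
  by (simp add: lw_def rw_def hc_assoc)

lemma hc_left_first: "is2 K \<alpha> \<Longrightarrow> is2 K \<beta> \<Longrightarrow> cd (src \<alpha>) = dm (src \<beta>) \<Longrightarrow>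
    \<beta> \<star> \<alpha> = \<beta> <| trg \<alpha> \<bullet> src \<beta> |> \<alpha>"
  using interchange[of \<alpha> "id2 K (trg \<alpha>)" "id2 K (src \<beta>)" \<beta>] by (simp add: lw_def rw_def)

lemma hc_right_first: "is2 K \<alpha> \<Longrightarrow> is2 K \<beta> \<Longrightarrow> cd (src \<alpha>) = dm (src \<beta>) \<Longrightarrow>
    \<beta> \<star> \<alpha> = trg \<beta> |> \<alpha> \<bullet> \<beta> <| src \<alpha>"
  using interchange[of "id2 K (src \<alpha>)" \<alpha> \<beta> "id2 K (trg \<beta>)"] by (simp add: lw_def rw_def)

text \<open>This law has no preferred direction, so it is applied explicitly.\<close>

lemma exchange: "is2 K \<alpha> \<Longrightarrow> is2 K \<beta> \<Longrightarrow> cd (src \<alpha>) = dm (src \<beta>) \<Longrightarrow>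
    \<beta> <| trg \<alpha> \<bullet> src \<beta> |> \<alpha> = trg \<beta> |> \<alpha> \<bullet> \<beta> <| src \<alpha>"
  using hc_left_first hc_right_first by metis

text \<open>A commuting square of cells can be used inside a right-nested composite.\<close>

lemma vc_extend: "\<delta> \<bullet> \<gamma> = \<beta> \<bullet> \<alpha> \<Longrightarrow> is2 K \<delta> \<Longrightarrow> is2 K \<gamma> \<Longrightarrow> is2 K \<beta> \<Longrightarrow> is2 K \<alpha> \<Longrightarrow>
    trg \<gamma> = src \<delta> \<Longrightarrow> trg \<alpha> = src \<beta> \<Longrightarrow> is2 K \<xi> \<Longrightarrow> trg \<xi> = src \<gamma> \<Longrightarrow>
    \<delta> \<bullet> \<gamma> \<bullet> \<xi> = \<beta> \<bullet> \<alpha> \<bullet> \<xi>"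
  by (metis frame(7) vc_assoc)

lemma iso2_is2 [simp]: "iso2 K \<alpha> \<Longrightarrow> is2 K \<alpha>"
  by (simp add: iso2_def)

lemma iso2I: "is2 K \<alpha> \<Longrightarrow> is2 K \<beta> \<Longrightarrow> src \<beta> = trg \<alpha> \<Longrightarrow> trg \<beta> = src \<alpha> \<Longrightarrow>
     \<beta> \<bullet> \<alpha> = id2 K (src \<alpha>) \<Longrightarrow> \<alpha> \<bullet> \<beta> = id2 K (trg \<alpha>) \<Longrightarrow> iso2 K \<alpha>"
  unfolding iso2_def by blast

lemma inv2:
  assumes "iso2 K \<alpha>"
  shows is2_inv2 [simp]: "is2 K (inv2 K \<alpha>)" and src_inv2 [simp]: "src (inv2 K \<alpha>) = trg \<alpha>"
    and trg_inv2 [simp]: "trg (inv2 K \<alpha>) = src \<alpha>"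
    and inv2_left [simp]: "inv2 K \<alpha> \<bullet> \<alpha> = id2 K (src \<alpha>)"
    and inv2_right [simp]: "\<alpha> \<bullet> inv2 K \<alpha> = id2 K (trg \<alpha>)"
proof -
  have "\<exists>\<beta>. is2 K \<beta> \<and> src \<beta> = trg \<alpha> \<and> trg \<beta> = src \<alpha> \<and>
     \<beta> \<bullet> \<alpha> = id2 K (src \<alpha>) \<and> \<alpha> \<bullet> \<beta> = id2 K (trg \<alpha>)"
    using assms unfolding iso2_def by blast
  from someI_ex[OF this] show "is2 K (inv2 K \<alpha>)" "src (inv2 K \<alpha>) = trg \<alpha>" "trg (inv2 K \<alpha>) = src \<alpha>"
    "inv2 K \<alpha> \<bullet> \<alpha> = id2 K (src \<alpha>)" "\<alpha> \<bullet> inv2 K \<alpha> = id2 K (trg \<alpha>)"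
    unfolding inv2_def by auto
qed

lemma iso2_inv2 [simp]: "iso2 K \<alpha> \<Longrightarrow> iso2 K (inv2 K \<alpha>)"
  by (rule iso2I[of _ \<alpha>]) simp_all

lemma inv2_cancel [simp]:
  "iso2 K \<alpha> \<Longrightarrow> is2 K \<xi> \<Longrightarrow> trg \<xi> = src \<alpha> \<Longrightarrow> inv2 K \<alpha> \<bullet> \<alpha> \<bullet> \<xi> = \<xi>"
  "iso2 K \<alpha> \<Longrightarrow> is2 K \<xi> \<Longrightarrow> trg \<xi> = trg \<alpha> \<Longrightarrow> \<alpha> \<bullet> inv2 K \<alpha> \<bullet> \<xi> = \<xi>"
  by (metis vc_assoc inv2 vc_id2(2) iso2_is2)+

lemma iso2_id2 [simp]: "is1 K f \<Longrightarrow> iso2 K (id2 K f)"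
  by (rule iso2I[of _ "id2 K f"]) simp_all

lemma inv2_eqI: "iso2 K \<alpha> \<Longrightarrow> is2 K \<beta> \<Longrightarrow> src \<beta> = trg \<alpha> \<Longrightarrow> trg \<beta> = src \<alpha> \<Longrightarrow>
    \<alpha> \<bullet> \<beta> = id2 K (trg \<alpha>) \<Longrightarrow> inv2 K \<alpha> = \<beta>"
  by (metis inv2_cancel(1) inv2 vc_id2(1))

lemma inv2_id2 [simp]: "is1 K f \<Longrightarrow> inv2 K (id2 K f) = id2 K f"
  by (rule inv2_eqI) simp_all

lemma iso2_vc [simp]: "iso2 K \<alpha> \<Longrightarrow> iso2 K \<beta> \<Longrightarrow> trg \<alpha> = src \<beta> \<Longrightarrow> iso2 K (\<beta> \<bullet> \<alpha>)"
  by (rule iso2I[of _ "inv2 K \<alpha> \<bullet> inv2 K \<beta>"]) simp_all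

lemma lw_inv2:
  assumes "iso2 K \<alpha>" "is1 K g" "cd (src \<alpha>) = dm g"
  shows "iso2 K (g |> \<alpha>)" "inv2 K (g |> \<alpha>) = g |> inv2 K \<alpha>"
proof -
  have [simp]: "cd (trg \<alpha>) = dm g"
    using assms by (simp add: is2_frame[where K = K])
  show i: "iso2 K (g |> \<alpha>)"
    by (rule iso2I[of _ "g |> inv2 K \<alpha>"]) (use assms in \<open>simp_all flip: lw_vc\<close>)
  show "inv2 K (g |> \<alpha>) = g |> inv2 K \<alpha>"
    by (rule inv2_eqI) (use assms i in \<open>simp_all flip: lw_vc\<close>)
qed

lemma rw_inv2:
  assumes "iso2 K \<alpha>" "is1 K f" "cd f = dm (src \<alpha>)"
  shows "iso2 K (\<alpha> <| f)" "inv2 K (\<alpha> <| f) = inv2 K \<alpha> <| f"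
proof -
  have [simp]: "dm (trg \<alpha>) = dm (src \<alpha>)"
    using assms by (simp add: is2_frame[where K = K])
  show i: "iso2 K (\<alpha> <| f)"
    by (rule iso2I[of _ "inv2 K \<alpha> <| f"]) (use assms in \<open>simp_all flip: rw_vc\<close>)
  show "inv2 K (\<alpha> <| f) = inv2 K \<alpha> <| f"
    by (rule inv2_eqI) (use assms i in \<open>simp_all flip: rw_vc\<close>)
qed

lemmas iso2_whisker [simp] = lw_inv2(1) rw_inv2(1)

lemma inv2_vc:
  "iso2 K \<alpha> \<Longrightarrow> iso2 K \<beta> \<Longrightarrow> trg \<alpha> = src \<beta> \<Longrightarrow> inv2 K (\<beta> \<bullet> \<alpha>) = inv2 K \<alpha> \<bullet> inv2 K \<beta>"
  by (rule inv2_eqI) simp_all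

lemma iso2_epi: "\<beta> \<bullet> \<alpha> = \<gamma> \<bullet> \<alpha> \<Longrightarrow> iso2 K \<alpha> \<Longrightarrow> is2 K \<beta> \<Longrightarrow> is2 K \<gamma> \<Longrightarrow> src \<beta> = trg \<alpha> \<Longrightarrow> src \<gamma> = trg \<alpha> \<Longrightarrow>
    \<beta> = \<gamma>"
  by (metis inv2_right inv2(1-5) vc_assoc vc_id2(1) iso2_is2)

text \<open>Inverting two opposite sides of a commuting square.\<close>

lemma inv2_swap: "\<beta> \<bullet> \<gamma> = \<delta> \<bullet> \<alpha> \<Longrightarrow> iso2 K \<alpha> \<Longrightarrow> iso2 K \<beta> \<Longrightarrow> is2 K \<gamma> \<Longrightarrow> is2 K \<delta> \<Longrightarrow>
    trg \<gamma> = src \<beta> \<Longrightarrow> trg \<alpha> = src \<delta> \<Longrightarrow> src \<gamma> = src \<alpha> \<Longrightarrow> trg \<delta> = trg \<beta> \<Longrightarrow>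
    inv2 K \<beta> \<bullet> \<delta> = \<gamma> \<bullet> inv2 K \<alpha>"
  by (rule iso2_epi[of _ \<alpha>]) (simp_all, metis inv2_cancel(1))

lemma iso2_iff: "iso2 K \<alpha> \<longleftrightarrow> is2 K \<alpha> \<and>
    is_iso (Hom K (dm (src \<alpha>)) (cd (src \<alpha>))) (raw1 (src \<alpha>)) (raw1 (trg \<alpha>)) (raw2 \<alpha>)"
proof (intro iffI conjI)
  assume "iso2 K \<alpha>"
  then obtain \<beta> where "is2 K \<alpha>" "is2 K \<beta>" "src \<beta> = trg \<alpha>" "trg \<beta> = src \<alpha>"
     "\<beta> \<bullet> \<alpha> = id2 K (src \<alpha>)" "\<alpha> \<bullet> \<beta> = id2 K (trg \<alpha>)"
    unfolding iso2_def by blast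
  then show "is_iso (Hom K (dm (src \<alpha>)) (cd (src \<alpha>))) (raw1 (src \<alpha>)) (raw1 (trg \<alpha>)) (raw2 \<alpha>)"
    unfolding is_iso_def by (intro conjI bexI[of _ "raw2 \<beta>"]) (auto simp del: is2_is1 is1_Ob is2_frame[where K = K] simp: is2_def vc_def id2_def)
next
  assume R: "is2 K \<alpha> \<and>
    is_iso (Hom K (dm (src \<alpha>)) (cd (src \<alpha>))) (raw1 (src \<alpha>)) (raw1 (trg \<alpha>)) (raw2 \<alpha>)"
  then obtain b where "b \<in> arr (Hom K (dm (src \<alpha>)) (cd (src \<alpha>))) (raw1 (trg \<alpha>)) (raw1 (src \<alpha>))"
    "cmp (Hom K (dm (src \<alpha>)) (cd (src \<alpha>))) (raw1 (src \<alpha>)) (raw1 (trg \<alpha>)) (raw1 (src \<alpha>)) b (raw2 \<alpha>) =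
       one (Hom K (dm (src \<alpha>)) (cd (src \<alpha>))) (raw1 (src \<alpha>))"
    "cmp (Hom K (dm (src \<alpha>)) (cd (src \<alpha>))) (raw1 (trg \<alpha>)) (raw1 (src \<alpha>)) (raw1 (trg \<alpha>)) (raw2 \<alpha>) b =
       one (Hom K (dm (src \<alpha>)) (cd (src \<alpha>))) (raw1 (trg \<alpha>))"
    unfolding is_iso_def by blast
  with R show "iso2 K \<alpha>"
    by (intro iso2I[of _ "Cell (trg \<alpha>) (src \<alpha>) b"]) (auto simp del: is2_is1 is1_Ob is2_frame[where K = K] simp: is2_def vc_def id2_def)
qed auto

end

section \<open>Pseudo-functors on cells with boundary\<close>

definition app1 :: "('o, 'a, 'x, 'p, 'b, 'y) psf \<Rightarrow> ('o, 'a) mor \<Rightarrow> ('p, 'b) mor" where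
  "app1 F f = Mor (pob F (dm f)) (pob F (cd f)) (map1 F (dm f) (cd f) (raw1 f))"

definition app2 :: "('o, 'a, 'x, 'p, 'b, 'y) psf \<Rightarrow> ('o, 'a, 'x) cell \<Rightarrow> ('p, 'b, 'y) cell" where
  "app2 F \<alpha> = Cell (app1 F (src \<alpha>)) (app1 F (trg \<alpha>))
     (map2 F (dm (src \<alpha>)) (cd (src \<alpha>)) (raw1 (src \<alpha>)) (raw1 (trg \<alpha>)) (raw2 \<alpha>))"

definition coh :: "('o, 'a, 'x) twocat \<Rightarrow> ('p, 'b, 'y) twocat \<Rightarrow> ('o, 'a, 'x, 'p, 'b, 'y) psf \<Rightarrow>
    ('o, 'a) mor \<Rightarrow> ('o, 'a) mor \<Rightarrow> ('p, 'b, 'y) cell" where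
  "coh K M F g f = Cell (app1 F g \<odot>\<^bsub>M\<^esub> app1 F f) (app1 F (g \<odot>\<^bsub>K\<^esub> f))
     (pcomp F (dm f) (cd f) (cd g) (raw1 g) (raw1 f))"

lemma app_frame [simp]:
  "dm (app1 F f) = pob F (dm f)" "cd (app1 F f) = pob F (cd f)"
  "src (app2 F \<alpha>) = app1 F (src \<alpha>)" "trg (app2 F \<alpha>) = app1 F (trg \<alpha>)"
  "src (coh K M F g f) = app1 F g \<odot>\<^bsub>M\<^esub> app1 F f" "trg (coh K M F g f) = app1 F (g \<odot>\<^bsub>K\<^esub> f)"
  by (simp_all add: app1_def app2_def coh_def)

lemmas app_defs = app1_def app2_def coh_def

lemma cell_eqI: "src \<alpha> = src \<beta> \<Longrightarrow> trg \<alpha> = trg \<beta> \<Longrightarrow> raw2 \<alpha> = raw2 \<beta> \<Longrightarrow> \<alpha> = \<beta>"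
  by (simp add: cell.expand)

lemma is_iso_arr: "is_iso X a b f \<Longrightarrow> f \<in> arr X a b"
  by (simp add: is_iso_def)

locale psf = K: two_cat K + M: two_cat M + normal_pseudo_functor K M F
  for K :: "('o, 'a, 'x) twocat" and M :: "('p, 'b, 'y) twocat" (structure) and F
begin

lemmas [simp] = pob_in

lemma is1_app1 [simp]: "is1 K f \<Longrightarrow> is1 M (app1 F f)"
  by (elim is1E) (simp add: is1_Mor app1_def cat_functor.fob_in[OF phom_functor])

lemma is2_app2 [simp]: "is2 K \<alpha> \<Longrightarrow> is2 M (app2 F \<alpha>)"
  by (elim is2E)
    (simp add: is2_Cell app_defs cat_functor.fob_in[OF phom_functor] cat_functor.far_in[OF phom_functor])

lemma app1_id1 [simp]: "A \<in> Ob K \<Longrightarrow> app1 F (id1 K A) = id1 M (pob F A)"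
  by (simp add: app1_def id1_def map1_Id)

lemma app2_id2 [simp]: "is1 K f \<Longrightarrow> app2 F (id2 K f) = id2 M (app1 F f)"
  by (elim is1E) (simp add: app_defs id2_def cat_functor.far_one[OF phom_functor])

lemma app2_vc [simp]: 
  "is2 K \<alpha> \<Longrightarrow> is2 K \<beta> \<Longrightarrow> trg \<alpha> = src \<beta> \<Longrightarrow> app2 F (\<beta> \<bullet>\<^bsub>K\<^esub> \<alpha>) = app2 F \<beta> \<bullet> app2 F \<alpha>"
  by (elim is2E) (clarsimp simp: app_defs vc_def cat_functor.far_cmp[OF phom_functor])

lemma app2_iso [simp]: "iso2 K \<alpha> \<Longrightarrow> iso2 M (app2 F \<alpha>)"
  by (rule M.iso2I[of _ "app2 F (inv2 K \<alpha>)"]) (simp_all flip: app2_vc)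

lemma coh_iso [simp]:
  assumes "is1 K f" "is1 K g" "cd f = dm g"
  shows "iso2 M (coh K M F g f)"
proof -
  have "is1 M (app1 F g \<odot> app1 F f)" "is1 M (app1 F (g \<odot>\<^bsub>K\<^esub> f))"
    using assms by simp_all
  then show ?thesis
    using assms
    by (elim is1E)
      (auto simp: M.iso2_iff is2_Cell app_defs o1_def pcomp_iso is_iso_arr[OF pcomp_iso])
qed

lemma coh_natural:
  assumes "is2 K \<alpha>" "is2 K \<beta>" "cd (src \<alpha>) = dm (src \<beta>)"
  shows "coh K M F (trg \<beta>) (trg \<alpha>) \<bullet> (app2 F \<beta> \<star> app2 F \<alpha>) =
    app2 F (\<beta> \<star>\<^bsub>K\<^esub> \<alpha>) \<bullet> coh K M F (src \<beta>) (src \<alpha>)"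
  using assms by (elim is2E) (auto simp: app_defs o1_def vc_def hc_def pcomp_natural)

lemma coh_lw:
  assumes "is1 K g" "is2 K \<alpha>" "cd (src \<alpha>) = dm g"
  shows "coh K M F g (trg \<alpha>) \<bullet> app1 F g |> app2 F \<alpha> =
    app2 F (g |>\<^bsub>K\<^esub> \<alpha>) \<bullet> coh K M F g (src \<alpha>)"
  using coh_natural[of \<alpha> "id2 K g"] assms by (simp add: lw_def)

lemma coh_rw:
  assumes "is1 K f" "is2 K \<beta>" "cd f = dm (src \<beta>)"
  shows "coh K M F (trg \<beta>) f \<bullet> app2 F \<beta> <| app1 F f =
    app2 F (\<beta> <|\<^bsub>K\<^esub> f) \<bullet> coh K M F (src \<beta>) f"
  using coh_natural[of "id2 K f" \<beta>] assms by (simp add: rw_def)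

lemma coh_assoc:
  assumes "is1 K f" "is1 K g" "is1 K h" "cd f = dm g" "cd g = dm h"
  shows "coh K M F h (g \<odot>\<^bsub>K\<^esub> f) \<bullet> app1 F h |> coh K M F g f =
    coh K M F (h \<odot>\<^bsub>K\<^esub> g) f \<bullet> coh K M F h g <| app1 F f"
proof (rule cell_eqI)
  show "raw2 (coh K M F h (g \<odot>\<^bsub>K\<^esub> f) \<bullet> app1 F h |> coh K M F g f) =
    raw2 (coh K M F (h \<odot>\<^bsub>K\<^esub> g) f \<bullet> coh K M F h g <| app1 F f)"
    using assms
    by (elim is1E) (auto simp: app_defs o1_def vc_def hc_def lw_def rw_def id2_def pcomp_assoc)
qed (use assms in simp_all)

lemma coh_id1 [simp]:
  assumes "is1 K f"
  shows "A = dm f \<Longrightarrow> coh K M F f (id1 K A) = id2 M (app1 F f)"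
    and "A = cd f \<Longrightarrow> coh K M F (id1 K A) f = id2 M (app1 F f)"
proof -
  have "src (coh K M F f (id1 K (dm f))) = app1 F f" "src (coh K M F (id1 K (cd f)) f) = app1 F f"
    "trg (coh K M F f (id1 K (dm f))) = app1 F f" "trg (coh K M F (id1 K (cd f)) f) = app1 F f"
    using assms by simp_all
  moreover have "raw2 (coh K M F f (id1 K (dm f))) = raw2 (id2 M (app1 F f))"
    "raw2 (coh K M F (id1 K (cd f)) f) = raw2 (id2 M (app1 F f))"
    using assms
    by (elim is1E; simp add: app_defs id1_def id2_def pcomp_Id_left pcomp_Id_right)+
  ultimately show "A = dm f \<Longrightarrow> coh K M F f (id1 K A) = id2 M (app1 F f)"
    "A = cd f \<Longrightarrow> coh K M F (id1 K A) f = id2 M (app1 F f)"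
    by (simp_all add: cell.expand)
qed

end

text \<open>The axioms in terms of cells with boundary. Naturality of the compositor is asked in each variable
  separately; naturality in both follows by factoring a horizontal composite into two whiskerings.\<close>

lemma psfI:
  fixes M :: "('p, 'b, 'y) twocat" (structure)
  assumes "two_cat K" "two_cat M"
    and ob: "\<And>A. A \<in> Ob K \<Longrightarrow> pob F A \<in> Ob M"
    and a1: "\<And>f. is1 K f \<Longrightarrow> is1 M (app1 F f)"
    and a2: "\<And>\<alpha>. is2 K \<alpha> \<Longrightarrow> is2 M (app2 F \<alpha>)"
    and a1_id: "\<And>A. A \<in> Ob K \<Longrightarrow> app1 F (id1 K A) = id1 M (pob F A)"
    and a2_id: "\<And>f. is1 K f \<Longrightarrow> app2 F (id2 K f) = id2 M (app1 F f)"
    and a2_vc: "\<And>\<alpha> \<beta>. is2 K \<alpha> \<Longrightarrow> is2 K \<beta> \<Longrightarrow> trg \<alpha> = src \<beta> \<Longrightarrow>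
      app2 F (\<beta> \<bullet>\<^bsub>K\<^esub> \<alpha>) = app2 F \<beta> \<bullet> app2 F \<alpha>"
    and iso: "\<And>f g. is1 K f \<Longrightarrow> is1 K g \<Longrightarrow> cd f = dm g \<Longrightarrow> iso2 M (coh K M F g f)"
    and lw: "\<And>g \<alpha>. is1 K g \<Longrightarrow> is2 K \<alpha> \<Longrightarrow> cd (src \<alpha>) = dm g \<Longrightarrow>
      coh K M F g (trg \<alpha>) \<bullet> app1 F g |> app2 F \<alpha> = app2 F (g |>\<^bsub>K\<^esub> \<alpha>) \<bullet> coh K M F g (src \<alpha>)"
    and rw: "\<And>f \<beta>. is1 K f \<Longrightarrow> is2 K \<beta> \<Longrightarrow> cd f = dm (src \<beta>) \<Longrightarrow>
      coh K M F (trg \<beta>) f \<bullet> app2 F \<beta> <| app1 F f = app2 F (\<beta> <|\<^bsub>K\<^esub> f) \<bullet> coh K M F (src \<beta>) f"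
    and assoc: "\<And>f g h. is1 K f \<Longrightarrow> is1 K g \<Longrightarrow> is1 K h \<Longrightarrow> cd f = dm g \<Longrightarrow> cd g = dm h \<Longrightarrow>
      coh K M F h (g \<odot>\<^bsub>K\<^esub> f) \<bullet> app1 F h |> coh K M F g f =
      coh K M F (h \<odot>\<^bsub>K\<^esub> g) f \<bullet> coh K M F h g <| app1 F f"
    and id_right: "\<And>f. is1 K f \<Longrightarrow> coh K M F f (id1 K (dm f)) = id2 M (app1 F f)"
    and id_left: "\<And>f. is1 K f \<Longrightarrow> coh K M F (id1 K (cd f)) f = id2 M (app1 F f)"
  shows "normal_pseudo_functor K M F"
proof -
  interpret K: two_cat K by fact
  interpret M: two_cat M by fact
  have lwF: "app1 F g |> app2 F \<alpha> = id2 M (app1 F g) \<star> app2 F \<alpha>" for g \<alpha>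
    by (simp add: lw_def)
  have hc: "coh K M F (trg \<beta>) (trg \<alpha>) \<bullet> (app2 F \<beta> \<star> app2 F \<alpha>) =
      app2 F (\<beta> \<star>\<^bsub>K\<^esub> \<alpha>) \<bullet> coh K M F (src \<beta>) (src \<alpha>)"
    if "is2 K \<alpha>" "is2 K \<beta>" "cd (src \<alpha>) = dm (src \<beta>)" for \<alpha> \<beta>
  proof -
    have "coh K M F (trg \<beta>) (trg \<alpha>) \<bullet> (app2 F \<beta> \<star> app2 F \<alpha>) =
        (coh K M F (trg \<beta>) (trg \<alpha>) \<bullet> app2 F \<beta> <| app1 F (trg \<alpha>)) \<bullet> app1 F (src \<beta>) |> app2 F \<alpha>"
      using that by (simp add: M.hc_left_first a1 a2 iso)
    also have "\<dots> = app2 F (\<beta> <|\<^bsub>K\<^esub> trg \<alpha>) \<bullet> coh K M F (src \<beta>) (trg \<alpha>) \<bullet> app1 F (src \<beta>) |> app2 F \<alpha>"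
      using that by (simp add: rw a1 a2 iso)
    also have "\<dots> = app2 F (\<beta> <|\<^bsub>K\<^esub> trg \<alpha> \<bullet>\<^bsub>K\<^esub> src \<beta> |>\<^bsub>K\<^esub> \<alpha>) \<bullet> coh K M F (src \<beta>) (src \<alpha>)"
      using that by (simp add: lw a1 a2 iso a2_vc)
    also have "\<dots> = app2 F (\<beta> \<star>\<^bsub>K\<^esub> \<alpha>) \<bullet> coh K M F (src \<beta>) (src \<alpha>)"
      using that by (simp add: K.hc_left_first)
    finally show ?thesis .
  qed
  note raw = app_defs o1_def vc_def hc_def lw_def rw_def id2_def id1_def
  show ?thesis
  proof (rule normal_pseudo_functor.intro, goal_cases)
    case (2 A B)
    show ?case
    proof (unfold_locales, goal_cases)
      case (1 f)
      with 2 show ?case using a1[of "Mor A B f"] by (simp add: is1_Mor app1_def)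
    next
      case (2 f g \<alpha>)
      with \<open>A \<in> Ob K\<close> \<open>B \<in> Ob K\<close> show ?case
        using a2[of "Cell (Mor A B f) (Mor A B g) \<alpha>"] by (simp add: is2_Cell app_defs)
    next
      case (3 f)
      with 2 show ?case using a2_id[of "Mor A B f"] by (simp add: is1_Mor raw)
    next
      case (4 f g h \<alpha> \<beta>)
      with 2 show ?case
        using a2_vc[of "Cell (Mor A B f) (Mor A B g) \<alpha>" "Cell (Mor A B g) (Mor A B h) \<beta>"]
        by (simp add: is2_Cell raw)
    qed
  next
    case (3 A)
    then show ?case using a1_id[of A] by (simp add: raw)
  next
    case (4 A B C f g)
    then show ?case
      using iso[of "Mor A B f" "Mor B C g"] unfolding M.iso2_iff by (simp add: is1_Mor raw)
  next
    case (5 A B C f f' g g' \<alpha> \<beta>)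
    then show ?case
      using hc[of "Cell (Mor A B f) (Mor A B f') \<alpha>" "Cell (Mor B C g) (Mor B C g') \<beta>"]
      by (simp add: is2_Cell raw)
  next
    case (6 A B C D f g h)
    then show ?case
      using arg_cong[OF assoc[of "Mor A B f" "Mor B C g" "Mor C D h"], of raw2] by (simp add: is1_Mor raw)
  next
    case (7 A B f)
    then show ?case using id_right[of "Mor A B f"] by (simp add: is1_Mor raw)
  next
    case (8 A B f)
    then show ?case using id_left[of "Mor A B f"] by (simp add: is1_Mor raw)
  qed (rule ob)
qed

section \<open>Pseudo-natural transformations on cells with boundary\<close>

text \<open>In the axiom for composites the records bracket some triple composites of morphisms to the left. The two
  bracketings agree only by associativity, so this axiom needs an extra step in both translations.\<close>

definition p0 :: "('o, 'a, 'x, 'p, 'b, 'y) psf \<Rightarrow> ('o, 'a, 'x, 'p, 'b, 'y) psf \<Rightarrow> ('o, 'a, 'b, 'y) pnt \<Rightarrow>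
    'o \<Rightarrow> ('p, 'b) mor" where
  "p0 F G \<rho> A = Mor (pob F A) (pob G A) (tob \<rho> A)"

definition pc :: "('p, 'b, 'y) twocat \<Rightarrow> ('o, 'a, 'x, 'p, 'b, 'y) psf \<Rightarrow> ('o, 'a, 'x, 'p, 'b, 'y) psf \<Rightarrow>
    ('o, 'a, 'b, 'y) pnt \<Rightarrow> ('o, 'a) mor \<Rightarrow> ('p, 'b, 'y) cell" where
  "pc M F G \<rho> f = Cell (app1 G f \<odot>\<^bsub>M\<^esub> p0 F G \<rho> (dm f)) (p0 F G \<rho> (cd f) \<odot>\<^bsub>M\<^esub> app1 F f)
     (tcell \<rho> (dm f) (cd f) (raw1 f))"

lemma pnt_frame [simp]:
  "dm (p0 F G \<rho> A) = pob F A" "cd (p0 F G \<rho> A) = pob G A"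
  "src (pc M F G \<rho> f) = app1 G f \<odot>\<^bsub>M\<^esub> p0 F G \<rho> (dm f)"
  "trg (pc M F G \<rho> f) = p0 F G \<rho> (cd f) \<odot>\<^bsub>M\<^esub> app1 F f"
  by (simp_all add: p0_def pc_def)

lemmas pnt_defs = p0_def pc_def app_defs
lemmas op_defs = o1_def vc_def hc_def lw_def rw_def id1_def id2_def

locale pnt = F: psf K M F + G: psf K M G + pseudo_nat_trans K M F G \<rho>
  for K :: "('o, 'a, 'x) twocat" and M :: "('p, 'b, 'y) twocat" (structure) and F G \<rho>
begin

lemma is1_p0 [simp]: "A \<in> Ob K \<Longrightarrow> is1 M (p0 F G \<rho> A)"
  by (simp add: p0_def is1_Mor tob_in)

lemma pc_iso [simp]:
  assumes "is1 K f"
  shows "iso2 M (pc M F G \<rho> f)"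
proof -
  have "is1 M (app1 G f \<odot> p0 F G \<rho> (dm f))" "is1 M (p0 F G \<rho> (cd f) \<odot> app1 F f)"
    using assms by simp_all
  then show ?thesis
    using assms
    by (elim is1E)
      (auto simp: F.M.iso2_iff is2_Cell pnt_defs o1_def tcell_iso is_iso_arr[OF tcell_iso])
qed

lemma pc_natural:
  "is2 K \<alpha> \<Longrightarrow> pc M F G \<rho> (trg \<alpha>) \<bullet> app2 G \<alpha> <| p0 F G \<rho> (dm (src \<alpha>)) =
     p0 F G \<rho> (cd (src \<alpha>)) |> app2 F \<alpha> \<bullet> pc M F G \<rho> (src \<alpha>)"
  by (elim is2E) (simp add: pnt_defs op_defs tcell_natural)

lemma pc_id1 [simp]:
  assumes "A \<in> Ob K"
  shows "pc M F G \<rho> (id1 K A) = id2 M (p0 F G \<rho> A)"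
proof (rule cell_eqI)
  show "raw2 (pc M F G \<rho> (id1 K A)) = raw2 (id2 M (p0 F G \<rho> A))"
    using assms by (simp add: pnt_defs op_defs tcell_Id)
qed (use assms in simp_all)

lemma pc_comp:
  assumes "is1 K f" "is1 K g" "cd f = dm g"
  shows "pc M F G \<rho> (g \<odot>\<^bsub>K\<^esub> f) \<bullet> coh K M G g f <| p0 F G \<rho> (dm f) =
    p0 F G \<rho> (cd g) |> coh K M F g f \<bullet> pc M F G \<rho> g <| app1 F f \<bullet> app1 G g |> pc M F G \<rho> f"
proof (rule cell_eqI)
  have e: "raw1 (app1 G g \<odot> app1 G f \<odot> p0 F G \<rho> (dm f)) = raw1 ((app1 G g \<odot> app1 G f) \<odot> p0 F G \<rho> (dm f))"
    "raw1 (p0 F G \<rho> (cd g) \<odot> app1 F g \<odot> app1 F f) = raw1 ((p0 F G \<rho> (cd g) \<odot> app1 F g) \<odot> app1 F f)"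
    using assms by simp_all
  show "raw2 (pc M F G \<rho> (g \<odot>\<^bsub>K\<^esub> f) \<bullet> coh K M G g f <| p0 F G \<rho> (dm f)) =
    raw2 (p0 F G \<rho> (cd g) |> coh K M F g f \<bullet> pc M F G \<rho> g <| app1 F f \<bullet> app1 G g |> pc M F G \<rho> f)"
    using assms e by (elim is1E) (auto simp: pnt_defs op_defs tcell_comp)
qed (use assms in simp_all)

end

lemma pntI:
  fixes M :: "('p, 'b, 'y) twocat" (structure)
  assumes "psf K M F" "psf K M G"
    and is1: "\<And>A. A \<in> Ob K \<Longrightarrow> is1 M (p0 F G \<rho> A)"
    and iso: "\<And>f. is1 K f \<Longrightarrow> iso2 M (pc M F G \<rho> f)"
    and nat: "\<And>\<alpha>. is2 K \<alpha> \<Longrightarrow> pc M F G \<rho> (trg \<alpha>) \<bullet> app2 G \<alpha> <| p0 F G \<rho> (dm (src \<alpha>)) =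
       p0 F G \<rho> (cd (src \<alpha>)) |> app2 F \<alpha> \<bullet> pc M F G \<rho> (src \<alpha>)"
    and id: "\<And>A. A \<in> Ob K \<Longrightarrow> pc M F G \<rho> (id1 K A) = id2 M (p0 F G \<rho> A)"
    and comp: "\<And>f g. is1 K f \<Longrightarrow> is1 K g \<Longrightarrow> cd f = dm g \<Longrightarrow>
      pc M F G \<rho> (g \<odot>\<^bsub>K\<^esub> f) \<bullet> coh K M G g f <| p0 F G \<rho> (dm f) =
      p0 F G \<rho> (cd g) |> coh K M F g f \<bullet> pc M F G \<rho> g <| app1 F f \<bullet> app1 G g |> pc M F G \<rho> f"
  shows "pseudo_nat_trans K M F G \<rho>"
proof -
  interpret F: psf K M F by fact
  interpret G: psf K M G by fact
  note raw = pnt_defs op_defs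
  show ?thesis
  proof (rule pseudo_nat_trans.intro, goal_cases)
    case (1 A)
    then show ?case using is1[of A] by (simp add: is1_Mor raw)
  next
    case (2 A B f)
    then show ?case
      using iso[of "Mor A B f"] unfolding F.M.iso2_iff by (simp add: is1_Mor raw)
  next
    case (3 A B f f' \<alpha>)
    then show ?case
      using arg_cong[OF nat[of "Cell (Mor A B f) (Mor A B f') \<alpha>"], of raw2] by (simp add: is2_Cell raw)
  next
    case (4 A)
    then show ?case using id[of A] by (simp add: raw)
  next
    case (5 A B C f g)
    let ?f = "Mor A B f" and ?g = "Mor B C g"
    have "raw1 (app1 G ?g \<odot> app1 G ?f \<odot> p0 F G \<rho> A) =
        raw1 ((app1 G ?g \<odot> app1 G ?f) \<odot> p0 F G \<rho> A)"
      "raw1 (p0 F G \<rho> C \<odot> app1 F ?g \<odot> app1 F ?f) =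
       raw1 ((p0 F G \<rho> C \<odot> app1 F ?g) \<odot> app1 F ?f)"
      using 5 by (simp_all add: is1 is1_Mor)
    then show ?case
      using arg_cong[OF comp[of ?f ?g], of raw2] 5 by (simp add: is1_Mor raw)
  qed
qed

section \<open>Pointwise adjoint equivalences\<close>

locale adj = two_cat K for K :: "('o, 'a, 'x) twocat" (structure) +
  fixes r s :: "('o, 'a) mor" and \<eta> \<epsilon> :: "('o, 'a, 'x) cell"
  assumes r [simp]: "is1 K r" and s [simp]: "is1 K s" "dm s = cd r" "cd s = dm r"
    and \<eta> [simp]: "iso2 K \<eta>" "src \<eta> = id1 K (dm r)" "trg \<eta> = s \<odot> r"
    and \<epsilon> [simp]: "iso2 K \<epsilon>" "src \<epsilon> = r \<odot> s" "trg \<epsilon> = id1 K (cd r)"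
    and tri1: "\<epsilon> <| r \<bullet> r |> \<eta> = id2 K r"
    and tri2: "s |> \<epsilon> \<bullet> \<eta> <| s = id2 K s"
begin

lemma is2_\<eta>\<epsilon> [simp]: "is2 K \<eta>" "is2 K \<epsilon>"
  by simp_all

lemma tri2_whisker:
  "is1 K k \<Longrightarrow> cd k = cd r \<Longrightarrow> is2 K \<xi> \<Longrightarrow> trg \<xi> = s \<odot> k \<Longrightarrow> s |> \<epsilon> <| k \<bullet> \<eta> <| (s \<odot> k) \<bullet> \<xi> = \<xi>"
  using arg_cong[OF tri2, of "\<lambda>x. x <| k \<bullet> \<xi>"] by simp

lemma tri1_whisker:
  "is1 K k \<Longrightarrow> cd k = dm r \<Longrightarrow> is2 K \<xi> \<Longrightarrow> trg \<xi> = r \<odot> k \<Longrightarrow> \<epsilon> <| (r \<odot> k) \<bullet> r |> \<eta> <| k \<bullet> \<xi> = \<xi>"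
  using arg_cong[OF tri1, of "\<lambda>x. x <| k \<bullet> \<xi>"] by simp

text \<open>Passing to the mate \<open>(\<epsilon> k) (r x) : r u \<Rightarrow> k\<close> of \<open>x : u \<Rightarrow> s k\<close> is injective, as one triangle identity
  recovers \<open>x\<close> from it. Below, equations between cells into \<open>s k\<close> are proved by comparing mates, where the counit
  cancels the unit hidden in the definition of the cells.\<close>

lemma mate_recover:
  assumes x: "is2 K x" "trg x = s \<odot> k" and k: "is1 K k" "cd k = cd r"
  shows "x = s |> (\<epsilon> <| k \<bullet> r |> x) \<bullet> \<eta> <| src x"
proof -
  have fr: "cd (src x) = dm r" "dm (src x) = dm k"
    using is2_frame[OF x(1)] x(2) k by simp_all
  have "(s \<odot> r) |> x \<bullet> \<eta> <| src x = \<eta> <| (s \<odot> k) \<bullet> x"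
    using exchange[of x \<eta>] x k fr by simp
  then show ?thesis
    using x k fr tri2_whisker[of k x] by simp
qed

lemma mate_inj:
  assumes "is2 K x" "is2 K y" "src x = src y" "trg x = s \<odot> k" "trg y = s \<odot> k" "is1 K k" "cd k = cd r"
    "\<epsilon> <| k \<bullet> r |> x = \<epsilon> <| k \<bullet> r |> y"
  shows "x = y"
  using mate_recover[of x k] mate_recover[of y k] assms by metis

end

text \<open>In index-free form the triangle identities lose their bracketing, so translating them uses the
  associativity and unit laws.\<close>

lemma adjoint_equivalence_iff:
  fixes K :: "('o, 'a, 'x) twocat" (structure)
  assumes "two_cat K" "A \<in> Ob K" "B \<in> Ob K"
  shows "adjoint_equivalence K A B E \<longleftrightarrow>
    adj K (Mor A B (fwd E)) (Mor B A (bwd E))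
      (Cell (id1 K A) (Mor B A (bwd E) \<odot> Mor A B (fwd E)) (unt E))
      (Cell (Mor A B (fwd E) \<odot> Mor B A (bwd E)) (id1 K B) (cou E))" (is "?L \<longleftrightarrow> ?R")
proof -
  interpret two_cat K by fact
  let ?r = "Mor A B (fwd E)" and ?s = "Mor B A (bwd E)"
  let ?u = "Cell (id1 K A) (?s \<odot> ?r) (unt E)" and ?c = "Cell (?r \<odot> ?s) (id1 K B) (cou E)"
  show ?thesis
  proof
    assume ?L
    then interpret E: adjoint_equivalence K A B E .
    have rs: "is1 K ?r" "is1 K ?s"
      using assms E.fwd_in E.bwd_in by (simp_all add: is1_Mor)
    then have "is1 K (?s \<odot> ?r)" "is1 K (?r \<odot> ?s)"
      by simp_all
    then have i: "iso2 K ?u" "iso2 K ?c"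
      using assms E.unt_iso E.cou_iso is_iso_arr[OF E.unt_iso] is_iso_arr[OF E.cou_iso]
      by (simp_all add: iso2_iff is2_Cell op_defs Id_in is1_Mor)
    have "?c <| ?r \<bullet> ?r |> ?u = id2 K ?r"
    proof (rule cell_eqI)
      show "raw2 (?c <| ?r \<bullet> ?r |> ?u) = raw2 (id2 K ?r)"
        using assms rs E.triangle_fwd comp1_assoc comp1_Id_left comp1_Id_right
        by (simp add: op_defs is1_Mor)
    qed (use assms rs in simp_all)
    moreover have "?s |> ?c \<bullet> ?u <| ?s = id2 K ?s"
    proof (rule cell_eqI)
      show "raw2 (?s |> ?c \<bullet> ?u <| ?s) = raw2 (id2 K ?s)"
        using assms rs E.triangle_bwd comp1_assoc comp1_Id_left comp1_Id_right
        by (simp add: op_defs is1_Mor)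
    qed (use assms rs in simp_all)
    ultimately show ?R
      using i rs by unfold_locales simp_all
  next
    assume ?R
    then interpret E: adj K ?r ?s ?u ?c .
    have rs: "fwd E \<in> obj (Hom K A B)" "bwd E \<in> obj (Hom K B A)"
      using E.r E.s by (simp_all add: is1_Mor)
    show ?L
    proof (rule adjoint_equivalence.intro, goal_cases)
      case 7
      show ?case
        using arg_cong[OF E.tri1, of raw2] assms rs
        by (simp add: op_defs comp1_Id_right comp1_Id_left comp1_assoc)
    next
      case 8
      show ?case
        using arg_cong[OF E.tri2, of raw2] assms rs
        by (simp add: op_defs comp1_Id_right comp1_Id_left comp1_assoc)
    qed (use assms rs E.\<eta>(1) E.\<epsilon>(1) in \<open>simp_all add: iso2_iff op_defs\<close>)
  qed
qed

locale pointwise_adj = pnt K M F G \<rho>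
  for K :: "('o, 'a, 'x) twocat" and M :: "('p, 'b, 'y) twocat" (structure) and F G \<rho> +
  fixes e :: "'o \<Rightarrow> ('b, 'y) adj_eqv"
  assumes eqv: "A \<in> Ob K \<Longrightarrow> adjoint_equivalence M (pob F A) (pob G A) (e A)"
    and fwd_e: "A \<in> Ob K \<Longrightarrow> fwd (e A) = tob \<rho> A"
begin

abbreviation "r A \<equiv> p0 F G \<rho> A"
abbreviation "s A \<equiv> Mor (pob G A) (pob F A) (bwd (e A))"
abbreviation "\<eta> A \<equiv> Cell (id1 M (pob F A)) (s A \<odot> r A) (unt (e A))"
abbreviation "\<epsilon> A \<equiv> Cell (r A \<odot> s A) (id1 M (pob G A)) (cou (e A))"
abbreviation "\<rho>c f \<equiv> pc M F G \<rho> f"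

lemma adj: "A \<in> Ob K \<Longrightarrow> adj M (r A) (s A) (\<eta> A) (\<epsilon> A)"
  using eqv[of A] adjoint_equivalence_iff[of M "pob F A" "pob G A" "e A"] fwd_e[of A] F.M.two_cat_axioms
  by (simp add: p0_def)

lemma adj_simps [simp]:
  assumes "A \<in> Ob K"
  shows "is1 M (s A)" "iso2 M (\<eta> A)" "iso2 M (\<epsilon> A)" "is2 M (\<eta> A)" "is2 M (\<epsilon> A)"
proof -
  interpret adj M "r A" "s A" "\<eta> A" "\<epsilon> A" by (rule adj) fact
  show "is1 M (s A)" "iso2 M (\<eta> A)" "iso2 M (\<epsilon> A)" "is2 M (\<eta> A)" "is2 M (\<epsilon> A)"
    using s(1) \<eta>(1) \<epsilon>(1) by simp_all
qed

text \<open>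
  The structure cell of the adjoint inverse: \<open>\<rho>c f : G f r \<Rightarrow> r F f\<close> is inverted and then transposed along
  both adjunctions.
\<close>

definition sc :: "('o, 'a) mor \<Rightarrow> ('p, 'b, 'y) cell" where
  "sc f = s (cd f) |> app1 G f |> \<epsilon> (dm f) \<bullet> s (cd f) |> (inv2 M (\<rho>c f) <| s (dm f)) \<bullet>
     \<eta> (cd f) <| (app1 F f \<odot> s (dm f))"

lemma sc [simp]:
  assumes "is1 K f"
  shows "iso2 M (sc f)" "is2 M (sc f)"
    "src (sc f) = app1 F f \<odot> s (dm f)" "trg (sc f) = s (cd f) \<odot> app1 G f"
proof -
  show "iso2 M (sc f)"
    unfolding sc_def using assms by (intro F.M.iso2_vc) simp_all
  then show "is2 M (sc f)"
    by simp
qed (use assms in \<open>simp_all add: sc_def\<close>)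

text \<open>This equation characterises \<open>sc f\<close> (by injectivity of mates) and contains no unit; it is what the
  axioms for \<open>sc\<close> are derived from.\<close>

lemma sc_mate:
  assumes f: "is1 K f"
  shows "\<epsilon> (cd f) <| app1 G f \<bullet> r (cd f) |> sc f =
    app1 G f |> \<epsilon> (dm f) \<bullet> inv2 M (\<rho>c f) <| s (dm f)"
proof -
  let ?A = "dm f" and ?B = "cd f" and ?i = "inv2 M (\<rho>c f)"
  interpret B: adj M "r ?B" "s ?B" "\<eta> ?B" "\<epsilon> ?B"
    using f by (intro adj) simp
  have 1: "\<epsilon> ?B <| app1 G f \<bullet> (r ?B \<odot> s ?B) |> (app1 G f |> \<epsilon> ?A) =
      app1 G f |> \<epsilon> ?A \<bullet> \<epsilon> ?B <| (app1 G f \<odot> r ?A \<odot> s ?A)"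
    using f F.M.exchange[of "app1 G f |> \<epsilon> ?A" "\<epsilon> ?B"] by simp
  have 2: "\<epsilon> ?B <| (app1 G f \<odot> r ?A \<odot> s ?A) \<bullet> (r ?B \<odot> s ?B) |> (?i <| s ?A) =
      ?i <| s ?A \<bullet> \<epsilon> ?B <| (r ?B \<odot> app1 F f \<odot> s ?A)"
    using f F.M.exchange[of "?i <| s ?A" "\<epsilon> ?B"] by simp
  have 3: "\<epsilon> ?B <| (r ?B \<odot> app1 F f \<odot> s ?A) \<bullet> r ?B |> \<eta> ?B <| (app1 F f \<odot> s ?A) =
      id2 M (r ?B \<odot> app1 F f \<odot> s ?A)"
    using f B.tri1_whisker[of "app1 F f \<odot> s ?A" "id2 M (r ?B \<odot> app1 F f \<odot> s ?A)"] by simp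
  have "\<epsilon> ?B <| app1 G f \<bullet> r ?B |> sc f =
    (\<epsilon> ?B <| app1 G f \<bullet> (r ?B \<odot> s ?B) |> (app1 G f |> \<epsilon> ?A)) \<bullet> (r ?B \<odot> s ?B) |> (?i <| s ?A) \<bullet>
       r ?B |> \<eta> ?B <| (app1 F f \<odot> s ?A)"
    using f by (simp add: sc_def)
  also have "\<dots> = app1 G f |> \<epsilon> ?A \<bullet> (\<epsilon> ?B <| (app1 G f \<odot> r ?A \<odot> s ?A) \<bullet> (r ?B \<odot> s ?B) |> (?i <| s ?A)) \<bullet>
       r ?B |> \<eta> ?B <| (app1 F f \<odot> s ?A)"
    unfolding 1 using f by simp
  also have "\<dots> = app1 G f |> \<epsilon> ?A \<bullet> ?i <| s ?A \<bullet>
      (\<epsilon> ?B <| (r ?B \<odot> app1 F f \<odot> s ?A) \<bullet> r ?B |> \<eta> ?B <| (app1 F f \<odot> s ?A))"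
    unfolding 2 using f by simp
  also have "\<dots> = app1 G f |> \<epsilon> ?A \<bullet> ?i <| s ?A"
    unfolding 3 using f by simp
  finally show ?thesis .
qed


lemma sc_natural:
  assumes \<alpha>: "is2 K \<alpha>"
  shows "sc (trg \<alpha>) \<bullet> app2 F \<alpha> <| s (dm (src \<alpha>)) = s (cd (src \<alpha>)) |> app2 G \<alpha> \<bullet> sc (src \<alpha>)"
proof -
  let ?A = "dm (src \<alpha>)" and ?B = "cd (src \<alpha>)" and ?f = "src \<alpha>" and ?g = "trg \<alpha>"
  have f: "is1 K ?f" "is1 K ?g" "?A \<in> Ob K" "?B \<in> Ob K" "dm ?g = ?A" "cd ?g = ?B"
    using \<alpha> by simp_all
  interpret B: adj M "r ?B" "s ?B" "\<eta> ?B" "\<epsilon> ?B"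
    using f by (intro adj) simp
  have nat: "inv2 M (\<rho>c ?g) \<bullet> r ?B |> app2 F \<alpha> = app2 G \<alpha> <| r ?A \<bullet> inv2 M (\<rho>c ?f)"
    by (rule F.M.inv2_swap[OF pc_natural]) (use \<alpha> f in simp_all)
  have nat': "inv2 M (\<rho>c ?g) <| s ?A \<bullet> r ?B |> (app2 F \<alpha> <| s ?A) =
      app2 G \<alpha> <| (r ?A \<odot> s ?A) \<bullet> inv2 M (\<rho>c ?f) <| s ?A"
    using arg_cong[OF nat, of "\<lambda>x. x <| s ?A"] \<alpha> f by simp
  have ex: "\<epsilon> ?B <| app1 G ?g \<bullet> (r ?B \<odot> s ?B) |> app2 G \<alpha> = app2 G \<alpha> \<bullet> \<epsilon> ?B <| app1 G ?f"
    using F.M.exchange[of "app2 G \<alpha>" "\<epsilon> ?B"] \<alpha> f by simp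
  have ex': "app1 G ?g |> \<epsilon> ?A \<bullet> app2 G \<alpha> <| (r ?A \<odot> s ?A) = app2 G \<alpha> \<bullet> app1 G ?f |> \<epsilon> ?A"
    using F.M.exchange[of "\<epsilon> ?A" "app2 G \<alpha>"] \<alpha> f by simp
  show ?thesis
  proof (rule B.mate_inj)
    have "\<epsilon> ?B <| app1 G ?g \<bullet> r ?B |> (sc ?g \<bullet> app2 F \<alpha> <| s ?A) =
        (\<epsilon> ?B <| app1 G ?g \<bullet> r ?B |> sc ?g) \<bullet> r ?B |> (app2 F \<alpha> <| s ?A)"
      using \<alpha> f by simp
    also have "\<dots> = app1 G ?g |> \<epsilon> ?A \<bullet> app2 G \<alpha> <| (r ?A \<odot> s ?A) \<bullet> inv2 M (\<rho>c ?f) <| s ?A"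
      using sc_mate[OF f(2)] nat' \<alpha> f by simp
    also have "\<dots> = app2 G \<alpha> \<bullet> app1 G ?f |> \<epsilon> ?A \<bullet> inv2 M (\<rho>c ?f) <| s ?A"
      by (rule F.M.vc_extend[OF ex']) (use \<alpha> f in simp_all)
    also have "\<dots> = app2 G \<alpha> \<bullet> \<epsilon> ?B <| app1 G ?f \<bullet> r ?B |> sc ?f"
      using sc_mate[OF f(1)] \<alpha> f by simp
    also have "\<dots> = \<epsilon> ?B <| app1 G ?g \<bullet> (r ?B \<odot> s ?B) |> app2 G \<alpha> \<bullet> r ?B |> sc ?f"
      by (rule F.M.vc_extend[OF ex[symmetric]]) (use \<alpha> f in simp_all)
    finally show "\<epsilon> ?B <| app1 G ?g \<bullet> r ?B |> (sc ?g \<bullet> app2 F \<alpha> <| s ?A) =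
        \<epsilon> ?B <| app1 G ?g \<bullet> r ?B |> (s ?B |> app2 G \<alpha> \<bullet> sc ?f)"
      using \<alpha> f by simp
  qed (use \<alpha> f in simp_all)
qed

lemma sc_id1:
  assumes A: "A \<in> Ob K"
  shows "sc (id1 K A) = id2 M (s A)"
proof -
  interpret A: adj M "r A" "s A" "\<eta> A" "\<epsilon> A"
    using A by (rule adj)
  show ?thesis
    using A A.tri2 by (simp add: sc_def)
qed

lemma sc_comp:
  assumes fg: "is1 K f" "is1 K g" "cd f = dm g"
  shows "sc (g \<odot>\<^bsub>K\<^esub> f) \<bullet> coh K M F g f <| s (dm f) =
    s (cd g) |> coh K M G g f \<bullet> sc g <| app1 G f \<bullet> app1 F g |> sc f"
proof -
  let ?A = "dm f" and ?B = "dm g" and ?C = "cd g"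
  let ?if = "inv2 M (\<rho>c f)" and ?ig = "inv2 M (\<rho>c g)" and ?igf = "inv2 M (\<rho>c (g \<odot>\<^bsub>K\<^esub> f))"
  let ?F = "coh K M F g f" and ?G = "coh K M G g f"
  interpret C: adj M "r ?C" "s ?C" "\<eta> ?C" "\<epsilon> ?C"
    using fg by (intro adj) simp
  have comp: "?igf \<bullet> r ?C |> ?F = ?G <| r ?A \<bullet> app1 G g |> ?if \<bullet> ?ig <| app1 F f"
  proof -
    have "?igf \<bullet> r ?C |> ?F = ?G <| r ?A \<bullet> inv2 M (\<rho>c g <| app1 F f \<bullet> app1 G g |> \<rho>c f)"
      by (rule F.M.inv2_swap[OF pc_comp]) (use fg in simp_all)
    then show ?thesis
      using fg by (simp add: F.M.inv2_vc F.M.lw_inv2(2) F.M.rw_inv2(2))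
  qed
  have comp': "?igf <| s ?A \<bullet> r ?C |> (?F <| s ?A) =
      ?G <| (r ?A \<odot> s ?A) \<bullet> app1 G g |> (?if <| s ?A) \<bullet> ?ig <| (app1 F f \<odot> s ?A)"
    using arg_cong[OF comp, of "\<lambda>x. x <| s ?A"] fg by simp
  have mf: "(app1 G g \<odot> app1 G f) |> \<epsilon> ?A \<bullet> app1 G g |> (?if <| s ?A) =
      app1 G g |> (\<epsilon> ?B <| app1 G f) \<bullet> (app1 G g \<odot> r ?B) |> sc f"
    using arg_cong[OF sc_mate[OF fg(1)], of "\<lambda>x. app1 G g |> x"] fg by simp
  have mg: "\<epsilon> ?C <| (app1 G g \<odot> app1 G f) \<bullet> r ?C |> (sc g <| app1 G f) =
      app1 G g |> (\<epsilon> ?B <| app1 G f) \<bullet> ?ig <| (s ?B \<odot> app1 G f)"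
    using arg_cong[OF sc_mate[OF fg(2)], of "\<lambda>x. x <| app1 G f"] fg by simp
  have ex1: "app1 G (g \<odot>\<^bsub>K\<^esub> f) |> \<epsilon> ?A \<bullet> ?G <| (r ?A \<odot> s ?A) = ?G \<bullet> (app1 G g \<odot> app1 G f) |> \<epsilon> ?A"
    using F.M.exchange[of "\<epsilon> ?A" "?G"] fg by simp
  have ex2: "(app1 G g \<odot> r ?B) |> sc f \<bullet> ?ig <| (app1 F f \<odot> s ?A) =
      ?ig <| (s ?B \<odot> app1 G f) \<bullet> (r ?C \<odot> app1 F g) |> sc f"
    using F.M.exchange[of "sc f" "?ig"] fg by simp
  have ex3: "\<epsilon> ?C <| app1 G (g \<odot>\<^bsub>K\<^esub> f) \<bullet> (r ?C \<odot> s ?C) |> ?G = ?G \<bullet> \<epsilon> ?C <| (app1 G g \<odot> app1 G f)"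
    using F.M.exchange[of ?G "\<epsilon> ?C"] fg by simp
  show ?thesis
  proof (rule C.mate_inj)
    have "\<epsilon> ?C <| app1 G (g \<odot>\<^bsub>K\<^esub> f) \<bullet> r ?C |> (sc (g \<odot>\<^bsub>K\<^esub> f) \<bullet> ?F <| s ?A) =
        (\<epsilon> ?C <| app1 G (g \<odot>\<^bsub>K\<^esub> f) \<bullet> r ?C |> sc (g \<odot>\<^bsub>K\<^esub> f)) \<bullet> r ?C |> (?F <| s ?A)"
      using fg by simp
    also have "\<dots> = app1 G (g \<odot>\<^bsub>K\<^esub> f) |> \<epsilon> ?A \<bullet> ?igf <| s ?A \<bullet> r ?C |> (?F <| s ?A)"
      using sc_mate[of "g \<odot>\<^bsub>K\<^esub> f"] fg by simp
    also have "\<dots> = app1 G (g \<odot>\<^bsub>K\<^esub> f) |> \<epsilon> ?A \<bullet> ?G <| (r ?A \<odot> s ?A) \<bullet> app1 G g |> (?if <| s ?A) \<bullet>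
        ?ig <| (app1 F f \<odot> s ?A)"
      unfolding comp' ..
    also have "\<dots> = ?G \<bullet> (app1 G g \<odot> app1 G f) |> \<epsilon> ?A \<bullet> app1 G g |> (?if <| s ?A) \<bullet>
        ?ig <| (app1 F f \<odot> s ?A)"
      by (rule F.M.vc_extend[OF ex1]) (use fg in simp_all)
    also have "\<dots> = ?G \<bullet> app1 G g |> (\<epsilon> ?B <| app1 G f) \<bullet> (app1 G g \<odot> r ?B) |> sc f \<bullet>
        ?ig <| (app1 F f \<odot> s ?A)"
      by (subst F.M.vc_extend[OF mf]) (use fg in simp_all)
    also have "\<dots> = ?G \<bullet> (\<epsilon> ?C <| (app1 G g \<odot> app1 G f) \<bullet> r ?C |> (sc g <| app1 G f)) \<bullet>
        (r ?C \<odot> app1 F g) |> sc f"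
      unfolding ex2 mg using fg by simp
    also have "\<dots> = ?G \<bullet> \<epsilon> ?C <| (app1 G g \<odot> app1 G f) \<bullet> r ?C |> (sc g <| app1 G f) \<bullet>
        (r ?C \<odot> app1 F g) |> sc f"
      using fg by simp
    also have "\<dots> = \<epsilon> ?C <| app1 G (g \<odot>\<^bsub>K\<^esub> f) \<bullet> (r ?C \<odot> s ?C) |> ?G \<bullet> r ?C |> (sc g <| app1 G f) \<bullet>
        (r ?C \<odot> app1 F g) |> sc f"
      by (rule F.M.vc_extend[OF ex3[symmetric]]) (use fg in simp_all)
    finally show "\<epsilon> ?C <| app1 G (g \<odot>\<^bsub>K\<^esub> f) \<bullet> r ?C |> (sc (g \<odot>\<^bsub>K\<^esub> f) \<bullet> ?F <| s ?A) =
       \<epsilon> ?C <| app1 G (g \<odot>\<^bsub>K\<^esub> f) \<bullet> r ?C |> (s ?C |> ?G \<bullet> sc g <| app1 G f \<bullet> app1 F g |> sc f)"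
      using fg by simp
  qed (use fg in simp_all)
qed

lemma unit_compatible:
  assumes f: "is1 K f"
  shows "s (cd f) |> \<rho>c f \<bullet> sc f <| r (dm f) \<bullet> app1 F f |> \<eta> (dm f) = \<eta> (cd f) <| app1 F f"
proof -
  let ?A = "dm f" and ?B = "cd f" and ?i = "inv2 M (\<rho>c f)"
  interpret A: adj M "r ?A" "s ?A" "\<eta> ?A" "\<epsilon> ?A"
    using f by (intro adj) simp
  have 1: "\<eta> ?B <| (app1 F f \<odot> s ?A \<odot> r ?A) \<bullet> app1 F f |> \<eta> ?A =
      (s ?B \<odot> r ?B \<odot> app1 F f) |> \<eta> ?A \<bullet> \<eta> ?B <| app1 F f"
    using F.M.exchange[of "app1 F f |> \<eta> ?A" "\<eta> ?B"] f by simp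
  have 2: "s ?B |> (?i <| (s ?A \<odot> r ?A)) \<bullet> (s ?B \<odot> r ?B \<odot> app1 F f) |> \<eta> ?A =
      (s ?B \<odot> app1 G f \<odot> r ?A) |> \<eta> ?A \<bullet> s ?B |> ?i"
    using arg_cong[OF F.M.exchange[of "\<eta> ?A" ?i], of "\<lambda>x. s ?B |> x"] f by simp
  have 3: "(s ?B \<odot> app1 G f) |> (\<epsilon> ?A <| r ?A) \<bullet> (s ?B \<odot> app1 G f \<odot> r ?A) |> \<eta> ?A =
      id2 M (s ?B \<odot> app1 G f \<odot> r ?A)"
    using arg_cong[OF A.tri1, of "\<lambda>x. (s ?B \<odot> app1 G f) |> x"] f by simp
  have 4: "s ?B |> \<rho>c f \<bullet> s ?B |> ?i = id2 M (s ?B \<odot> r ?B \<odot> app1 F f)"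
    using f by (simp flip: F.M.lw_vc)
  have "s ?B |> \<rho>c f \<bullet> sc f <| r ?A \<bullet> app1 F f |> \<eta> ?A =
      s ?B |> \<rho>c f \<bullet> (s ?B \<odot> app1 G f) |> (\<epsilon> ?A <| r ?A) \<bullet> s ?B |> (?i <| (s ?A \<odot> r ?A)) \<bullet>
        (\<eta> ?B <| (app1 F f \<odot> s ?A \<odot> r ?A) \<bullet> app1 F f |> \<eta> ?A)"
    using f by (simp add: sc_def)
  also have "\<dots> = s ?B |> \<rho>c f \<bullet> (s ?B \<odot> app1 G f) |> (\<epsilon> ?A <| r ?A) \<bullet>
      (s ?B |> (?i <| (s ?A \<odot> r ?A)) \<bullet> (s ?B \<odot> r ?B \<odot> app1 F f) |> \<eta> ?A) \<bullet> \<eta> ?B <| app1 F f"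
    unfolding 1 using f by simp
  also have "\<dots> = s ?B |> \<rho>c f \<bullet> ((s ?B \<odot> app1 G f) |> (\<epsilon> ?A <| r ?A) \<bullet>
      (s ?B \<odot> app1 G f \<odot> r ?A) |> \<eta> ?A) \<bullet> s ?B |> ?i \<bullet> \<eta> ?B <| app1 F f"
    unfolding 2 using f by simp
  also have "\<dots> = (s ?B |> \<rho>c f \<bullet> s ?B |> ?i) \<bullet> \<eta> ?B <| app1 F f"
    unfolding 3 using f by simp
  also have "\<dots> = \<eta> ?B <| app1 F f"
    unfolding 4 using f by simp
  finally show ?thesis .
qed

lemma counit_compatible:
  assumes f: "is1 K f"
  shows "\<epsilon> (cd f) <| app1 G f \<bullet> r (cd f) |> sc f \<bullet> \<rho>c f <| s (dm f) = app1 G f |> \<epsilon> (dm f)"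
proof -
  have "\<epsilon> (cd f) <| app1 G f \<bullet> r (cd f) |> sc f \<bullet> \<rho>c f <| s (dm f) =
      (app1 G f |> \<epsilon> (dm f) \<bullet> inv2 M (\<rho>c f) <| s (dm f)) \<bullet> \<rho>c f <| s (dm f)"
    using F.M.vc_extend[OF sc_mate[OF f], of "\<rho>c f <| s (dm f)"] f by simp
  also have "\<dots> = app1 G f |> \<epsilon> (dm f) \<bullet> (inv2 M (\<rho>c f) \<bullet> \<rho>c f) <| s (dm f)"
    using f by (simp del: F.M.inv2_left)
  also have "\<dots> = app1 G f |> \<epsilon> (dm f)"
    using f by simp
  finally show ?thesis .
qed

end

section \<open>Adjoint equivalences in Ps\<close>

definition mc :: "('o, 'a, 'x, 'p, 'b, 'y) psf \<Rightarrow> ('o, 'a, 'x, 'p, 'b, 'y) psf \<Rightarrow> ('o, 'a, 'b, 'y) pnt \<Rightarrow>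
    ('o, 'a, 'b, 'y) pnt \<Rightarrow> ('o \<Rightarrow> 'y) \<Rightarrow> 'o \<Rightarrow> ('p, 'b, 'y) cell" where
  "mc F G \<rho> \<sigma> \<Gamma> A = Cell (p0 F G \<rho> A) (p0 F G \<sigma> A) (\<Gamma> A)"

lemma mc_frame [simp]: "src (mc F G \<rho> \<sigma> \<Gamma> A) = p0 F G \<rho> A" "trg (mc F G \<rho> \<sigma> \<Gamma> A) = p0 F G \<sigma> A"
  by (simp_all add: mc_def)

lemma modificationI:
  fixes M :: "('p, 'b, 'y) twocat" (structure)
  assumes "\<And>A. A \<in> Ob K \<Longrightarrow> is2 M (mc F G \<rho> \<sigma> \<Gamma> A)"
    and "\<And>f. is1 K f \<Longrightarrow>
      pc M F G \<sigma> f \<bullet> app1 G f |> mc F G \<rho> \<sigma> \<Gamma> (dm f) =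
      mc F G \<rho> \<sigma> \<Gamma> (cd f) <| app1 F f \<bullet> pc M F G \<rho> f"
  shows "modification K M F G \<rho> \<sigma> \<Gamma>"
proof (rule modification.intro, goal_cases)
  case (1 A)
  then show ?case
    using assms(1)[of A] by (simp add: mc_def p0_def is2_Cell)
next
  case (2 A B f)
  then show ?case
    using arg_cong[OF assms(2)[of "Mor A B f"], of raw2]
    by (simp add: is1_Mor mc_def pnt_defs op_defs)
qed

text \<open>The inverse components commute with the structure cells because the given ones do, so they again form a
  modification.\<close>

lemma is_iso_modification:
  fixes M :: "('p, 'b, 'y) twocat" (structure)
  assumes "psf K M F" "psf K M G"
    and ob: "\<And>A. A \<in> Ob K \<Longrightarrow> is1 M (p0 F G \<rho> A)" "\<And>A. A \<in> Ob K \<Longrightarrow> is1 M (p0 F G \<sigma> A)"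
    and pc: "\<And>f. is1 K f \<Longrightarrow> is2 M (pc M F G \<rho> f)" "\<And>f. is1 K f \<Longrightarrow> is2 M (pc M F G \<sigma> f)"
    and ext: "\<Gamma> \<in> extensional (Ob K)"
    and iso: "\<And>A. A \<in> Ob K \<Longrightarrow> iso2 M (mc F G \<rho> \<sigma> \<Gamma> A)"
    and compat: "\<And>f. is1 K f \<Longrightarrow>
      pc M F G \<sigma> f \<bullet> app1 G f |> mc F G \<rho> \<sigma> \<Gamma> (dm f) =
      mc F G \<rho> \<sigma> \<Gamma> (cd f) <| app1 F f \<bullet> pc M F G \<rho> f"
  shows "is_iso (pnt_cat K M F G) \<rho> \<sigma> \<Gamma>"
proof -
  interpret F: psf K M F by fact
  interpret G: psf K M G by fact
  let ?i = "\<lambda>A. inv2 M (mc F G \<rho> \<sigma> \<Gamma> A)"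
  define \<Delta> where "\<Delta> = (\<lambda>A \<in> Ob K. raw2 (?i A))"
  have \<Delta>_ext: "\<Delta> \<in> extensional (Ob K)"
    by (simp add: \<Delta>_def)
  have mc: "mc F G \<sigma> \<rho> \<Delta> A = ?i A" if "A \<in> Ob K" for A
    using that iso[OF that] by (auto simp: mc_def \<Delta>_def intro: cell_eqI)
  have mod: "modification K M F G \<rho> \<sigma> \<Gamma>"
    by (rule modificationI) (use iso compat in simp_all)
  have mod': "modification K M F G \<sigma> \<rho> \<Delta>"
  proof (rule modificationI)
    fix A assume "A \<in> Ob K"
    then show "is2 M (mc F G \<sigma> \<rho> \<Delta> A)"
      using iso by (simp add: mc)
  next
    fix f assume f: "is1 K f"
    have i: "iso2 M (mc F G \<rho> \<sigma> \<Gamma> (dm f))" "iso2 M (mc F G \<rho> \<sigma> \<Gamma> (cd f))"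
      using f iso by simp_all
    have "inv2 M (mc F G \<rho> \<sigma> \<Gamma> (cd f) <| app1 F f) \<bullet> pc M F G \<sigma> f =
        pc M F G \<rho> f \<bullet> inv2 M (app1 G f |> mc F G \<rho> \<sigma> \<Gamma> (dm f))"
      by (rule F.M.inv2_swap[OF compat[OF f, symmetric]]) (use f ob pc i in simp_all)
    then show "pc M F G \<rho> f \<bullet> app1 G f |> mc F G \<sigma> \<rho> \<Delta> (dm f) =
        mc F G \<sigma> \<rho> \<Delta> (cd f) <| app1 F f \<bullet> pc M F G \<sigma> f"
      using f i by (simp add: mc F.M.lw_inv2(2) F.M.rw_inv2(2))
  qed
  have inv: "cmp (Hom M (pob F A) (pob G A)) (tob \<rho> A) (tob \<sigma> A) (tob \<rho> A) (\<Delta> A) (\<Gamma> A) =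
      one (Hom M (pob F A) (pob G A)) (tob \<rho> A)"
    "cmp (Hom M (pob F A) (pob G A)) (tob \<sigma> A) (tob \<rho> A) (tob \<sigma> A) (\<Gamma> A) (\<Delta> A) =
      one (Hom M (pob F A) (pob G A)) (tob \<sigma> A)" if A: "A \<in> Ob K" for A
    using arg_cong[OF F.M.inv2_left[OF iso[OF A], folded mc[OF A]], of raw2]
      arg_cong[OF F.M.inv2_right[OF iso[OF A], folded mc[OF A]], of raw2]
    by (simp_all add: mc_def p0_def op_defs)
  show ?thesis
    unfolding is_iso_def
    by (intro conjI bexI[of _ \<Delta>])
      (use mod mod' ext in \<open>auto simp: pnt_cat_def inv \<Delta>_ext intro!: restrict_ext\<close>)
qed

lemma restrict_pnt_idem [simp]: "restrict_pnt K (restrict_pnt K \<rho>) = restrict_pnt K \<rho>"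
  by (auto simp: restrict_pnt_def fun_eq_iff)

lemma p0_restrict [simp]: "A \<in> Ob K \<Longrightarrow> p0 F G (restrict_pnt K \<rho>) A = p0 F G \<rho> A"
  by (simp add: p0_def restrict_pnt_def)

lemma pc_restrict [simp]: "is1 K f \<Longrightarrow> pc M F G (restrict_pnt K \<rho>) f = pc M F G \<rho> f"
  by (elim is1E) (simp add: pnt_defs restrict_pnt_def)

lemma (in pnt) pnt_restrict: "pseudo_nat_trans K M F G (restrict_pnt K \<rho>)"
  by (rule pntI) (simp_all add: F.psf_axioms G.psf_axioms pc_natural pc_comp)

lemma p0_comp_pnt [simp]:
  "A \<in> Ob K \<Longrightarrow> p0 F H (comp_pnt K M F G H \<sigma> \<rho>) A = p0 G H \<sigma> A \<odot>\<^bsub>M\<^esub> p0 F G \<rho> A"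
  by (simp add: comp_pnt_def) (simp add: p0_def o1_def)

lemma p0_id_pnt [simp]: "A \<in> Ob K \<Longrightarrow> p0 F F (id_pnt K M F) A = id1 M (pob F A)"
  by (simp add: id_pnt_def) (simp add: p0_def id1_def)

lemma pc_id_pnt [simp]:
  fixes M :: "('p, 'b, 'y) twocat" (structure)
  assumes "psf K M F" and f: "is1 K f"
  shows "pc M F F (id_pnt K M F) f = id2 M (app1 F f)"
proof -
  interpret psf K M F by fact
  show ?thesis
  proof (rule cell_eqI)
    show "raw2 (pc M F F (id_pnt K M F) f) = raw2 (id2 M (app1 F f))"
      unfolding id_pnt_def pc_restrict[OF f] using f by (simp add: pnt_defs op_defs)
  qed (use f in simp_all)
qed

lemma pc_comp_pnt [simp]:
  fixes M :: "('p, 'b, 'y) twocat" (structure)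
  assumes "psf K M F" "psf K M G" "psf K M H" and f: "is1 K f"
    and [simp]: "\<And>A. A \<in> Ob K \<Longrightarrow> is1 M (p0 F G \<rho> A)" "\<And>A. A \<in> Ob K \<Longrightarrow> is1 M (p0 G H \<sigma> A)"
  shows "pc M F H (comp_pnt K M F G H \<sigma> \<rho>) f =
    p0 G H \<sigma> (cd f) |> pc M F G \<rho> f \<bullet> pc M G H \<sigma> f <| p0 F G \<rho> (dm f)"
proof -
  interpret F: psf K M F by fact
  interpret G: psf K M G by fact
  interpret H: psf K M H by fact
  show ?thesis
  proof (rule cell_eqI)
    show "raw2 (pc M F H (comp_pnt K M F G H \<sigma> \<rho>) f) =
        raw2 (p0 G H \<sigma> (cd f) |> pc M F G \<rho> f \<bullet> pc M G H \<sigma> f <| p0 F G \<rho> (dm f))"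
      unfolding comp_pnt_def pc_restrict[OF f] using f by (simp add: pnt_defs op_defs Let_def)
  qed (use f in simp_all)
qed

context pointwise_adj
begin

definition \<sigma> where
  "\<sigma> = restrict_pnt K \<lparr>tob = \<lambda>A. bwd (e A), tcell = \<lambda>A B f. raw2 (sc (Mor A B f))\<rparr>"

lemma p0_\<sigma> [simp]: "A \<in> Ob K \<Longrightarrow> p0 G F \<sigma> A = s A"
  by (simp add: \<sigma>_def) (simp add: p0_def)

lemma pc_\<sigma> [simp]: "is1 K f \<Longrightarrow> pc M G F \<sigma> f = sc f"
  unfolding \<sigma>_def pc_restrict
  by (rule cell_eqI) (simp_all add: pc_def p0_def mor.collapse)

lemma pnt_\<sigma>: "pseudo_nat_trans K M G F \<sigma>"
  by (rule pntI) (simp_all add: F.psf_axioms G.psf_axioms sc_natural sc_comp sc_id1)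

text \<open>The chosen units and counits are modifications by the two compatibility lemmas; the triangle identities in
  \<open>Ps\<close> are those at each object.\<close>

theorem adjoint_equivalence_Ps:
  "adjoint_equivalence (Ps K M) F G
     \<lparr>fwd = restrict_pnt K \<rho>, bwd = \<sigma>, unt = \<lambda>A \<in> Ob K. unt (e A), cou = \<lambda>A \<in> Ob K. cou (e A)\<rparr>"
proof -
  let ?\<rho> = "restrict_pnt K \<rho>"
  have mu: "mc F F (id_pnt K M F) (comp_pnt K M F G F \<sigma> ?\<rho>) (\<lambda>A \<in> Ob K. unt (e A)) A = \<eta> A"
    and mcou: "mc G G (comp_pnt K M G F G ?\<rho> \<sigma>) (id_pnt K M G) (\<lambda>A \<in> Ob K. cou (e A)) A = \<epsilon> A"
    if "A \<in> Ob K" for A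
    using that by (simp_all add: mc_def)
  have u: "is_iso (pnt_cat K M F F) (id_pnt K M F) (comp_pnt K M F G F \<sigma> ?\<rho>) (\<lambda>A \<in> Ob K. unt (e A))"
    by (rule is_iso_modification)
      (simp_all add: F.psf_axioms G.psf_axioms mu unit_compatible)
  have c: "is_iso (pnt_cat K M G G) (comp_pnt K M G F G ?\<rho> \<sigma>) (id_pnt K M G) (\<lambda>A \<in> Ob K. cou (e A))"
    by (rule is_iso_modification)
      (simp_all add: F.psf_axioms G.psf_axioms mcou counit_compatible)
  have r\<sigma>: "restrict_pnt K \<sigma> = \<sigma>"
    by (simp add: \<sigma>_def)
  have tob: "tob ?\<rho> A = fwd (e A)" "tob \<sigma> A = bwd (e A)" "tob (id_pnt K M F) A = Id M (pob F A)"
    "tob (id_pnt K M G) A = Id M (pob G A)"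
    if "A \<in> Ob K" for A
    using that fwd_e by (simp_all add: restrict_pnt_def \<sigma>_def id_pnt_def)
  have tobc: "tob (comp_pnt K M F G F \<sigma> ?\<rho>) A = comp1 M (pob F A) (pob G A) (pob F A) (bwd (e A)) (fwd (e A))"
     "tob (comp_pnt K M G F G ?\<rho> \<sigma>) A = comp1 M (pob G A) (pob F A) (pob G A) (fwd (e A)) (bwd (e A))"
     "tob (comp_pnt K M F G G (comp_pnt K M G F G ?\<rho> \<sigma>) ?\<rho>) A = comp1 M (pob F A) (pob G A) (pob G A)
        (comp1 M (pob G A) (pob F A) (pob G A) (fwd (e A)) (bwd (e A))) (fwd (e A))"
     "tob (comp_pnt K M G F F (comp_pnt K M F G F \<sigma> ?\<rho>) \<sigma>) A = comp1 M (pob G A) (pob F A) (pob F A)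
        (comp1 M (pob F A) (pob G A) (pob F A) (bwd (e A)) (fwd (e A))) (bwd (e A))"
    if "A \<in> Ob K" for A
    using that tob by (simp_all add: comp_pnt_def restrict_pnt_def)
  show ?thesis
  proof
    show "F \<in> Ob (Ps K M)" "G \<in> Ob (Ps K M)"
      using F.normal_pseudo_functor_axioms G.normal_pseudo_functor_axioms by (simp_all add: Ps_def)
  qed (use u c pnt_restrict pnt_\<sigma> adjoint_equivalence.triangle_fwd[OF eqv] adjoint_equivalence.triangle_bwd[OF eqv]
    in \<open>auto simp: Ps_def pnt_cat_def r\<sigma> tob tobc intro!: restrict_ext\<close>)
qed

end

section \<open>The 2-category of categories\<close>

lemma fob_restrict [simp]: "a \<in> obj X \<Longrightarrow> fob (restrict_ftr X F) a = fob F a"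
  by (simp add: restrict_ftr_def)

lemma far_restrict [simp]:
  "a \<in> obj X \<Longrightarrow> b \<in> obj X \<Longrightarrow> f \<in> arr X a b \<Longrightarrow> far (restrict_ftr X F) a b f = far F a b f"
  by (simp add: restrict_ftr_def)

lemma restrict_ftr_idem [simp]: "restrict_ftr X (restrict_ftr X F) = restrict_ftr X F"
  by (auto simp: restrict_ftr_def fun_eq_iff)

text \<open>Functors in \<open>CAT\<close> are undefined off their domain, so they agree once they agree on it.\<close>

lemma ftr_eqI:
  assumes "restrict_ftr X F = F" "restrict_ftr X G = G"
    and "\<And>a. a \<in> obj X \<Longrightarrow> fob F a = fob G a"
    and "\<And>a b f. a \<in> obj X \<Longrightarrow> b \<in> obj X \<Longrightarrow> f \<in> arr X a b \<Longrightarrow> far F a b f = far G a b f"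
  shows "F = G"
proof -
  have "restrict_ftr X F = restrict_ftr X G"
    unfolding restrict_ftr_def using assms(3,4) by (intro arg_cong2[of _ _ _ _ "\<lambda>x y. \<lparr>fob = x, far = y\<rparr>"] ext) auto
  with assms(1,2) show ?thesis by metis
qed

lemma cat_functor_restrict [simp]:
  assumes "category X"
  shows "cat_functor X Y (restrict_ftr X F) \<longleftrightarrow> cat_functor X Y F"
proof -
  interpret category X by fact
  show ?thesis
    by (auto simp: cat_functor_def one_in cmp_in)
qed

lemma cat_functor_comp: "cat_functor X Y F \<Longrightarrow> cat_functor Y Z G \<Longrightarrow> cat_functor X Z (comp_ftr G F)"
  by (simp add: cat_functor_def comp_ftr_def)

lemma cat_functor_id: "cat_functor X X id_ftr"
  by (simp add: cat_functor_def id_ftr_def)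

lemma functor_cat_simps:
  "F \<in> obj (functor_cat X Y) \<longleftrightarrow> cat_functor X Y F \<and> restrict_ftr X F = F"
  "\<alpha> \<in> arr (functor_cat X Y) F G \<longleftrightarrow> \<alpha> \<in> extensional (obj X) \<and> nat_trans X Y F G \<alpha>"
  "one (functor_cat X Y) F = (\<lambda>a \<in> obj X. one Y (fob F a))"
  "cmp (functor_cat X Y) F G H \<beta> \<alpha> =
     (\<lambda>a \<in> obj X. cmp Y (fob F a) (fob G a) (fob H a) (\<beta> a) (\<alpha> a))"
  by (auto simp: functor_cat_def)

lemma category_functor_cat:
  assumes "category X" "category Y"
  shows "category (functor_cat X Y)"
proof -
  interpret X: category X by fact
  interpret Y: category Y by fact
  show ?thesis
  proof
    fix F assume F: "F \<in> obj (functor_cat X Y)"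
    then interpret F: cat_functor X Y F by (simp add: functor_cat_simps)
    show "one (functor_cat X Y) F \<in> arr (functor_cat X Y) F F"
      by (auto simp: functor_cat_simps nat_trans_def F.fob_in F.far_in Y.one_in Y.cmp_one_left Y.cmp_one_right)
    fix G assume "G \<in> obj (functor_cat X Y)"
    then interpret G: cat_functor X Y G by (simp add: functor_cat_simps)
    fix \<alpha> assume \<alpha>: "\<alpha> \<in> arr (functor_cat X Y) F G"
    then interpret \<alpha>: nat_trans X Y F G \<alpha> by (simp add: functor_cat_simps)
    show "cmp (functor_cat X Y) F F G \<alpha> (one (functor_cat X Y) F) = \<alpha>"
      "cmp (functor_cat X Y) F G G (one (functor_cat X Y) G) \<alpha> = \<alpha>"
      using \<alpha> by (auto simp: functor_cat_simps fun_eq_iff extensional_def restrict_def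
          F.fob_in G.fob_in \<alpha>.component_in Y.cmp_one_left Y.cmp_one_right)
    fix H assume "H \<in> obj (functor_cat X Y)"
    then interpret H: cat_functor X Y H by (simp add: functor_cat_simps)
    fix \<beta> assume \<beta>: "\<beta> \<in> arr (functor_cat X Y) G H"
    then interpret \<beta>: nat_trans X Y G H \<beta> by (simp add: functor_cat_simps)
    show "cmp (functor_cat X Y) F G H \<beta> \<alpha> \<in> arr (functor_cat X Y) F H"
      unfolding functor_cat_simps
    proof (intro conjI)
      show "nat_trans X Y F H (\<lambda>a\<in>obj X. cmp Y (fob F a) (fob G a) (fob H a) (\<beta> a) (\<alpha> a))"
      proof
        fix a b f assume *: "a \<in> obj X" "b \<in> obj X" "f \<in> arr X a b"
        have "cmp Y (fob F a) (fob H a) (fob H b) (far H a b f) (cmp Y (fob F a) (fob G a) (fob H a) (\<beta> a) (\<alpha> a))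
          = cmp Y (fob F a) (fob G a) (fob H b) (cmp Y (fob G a) (fob H a) (fob H b) (far H a b f) (\<beta> a)) (\<alpha> a)"
          using * by (simp add: F.fob_in G.fob_in H.fob_in H.far_in \<alpha>.component_in \<beta>.component_in Y.cmp_assoc)
        also have "\<dots> = cmp Y (fob F a) (fob G b) (fob H b) (\<beta> b) (cmp Y (fob F a) (fob G a) (fob G b) (far G a b f) (\<alpha> a))"
          using * by (simp add: F.fob_in G.fob_in H.fob_in G.far_in \<alpha>.component_in \<beta>.component_in Y.cmp_assoc \<beta>.naturality)
        also have "\<dots> = cmp Y (fob F a) (fob F b) (fob H b) (cmp Y (fob F b) (fob G b) (fob H b) (\<beta> b) (\<alpha> b)) (far F a b f)"
          using * by (simp add: F.fob_in G.fob_in H.fob_in F.far_in \<alpha>.component_in \<beta>.component_in Y.cmp_assoc \<alpha>.naturality)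
        finally show "cmp Y (fob F a) (fob H a) (fob H b) (far H a b f)
            ((\<lambda>a\<in>obj X. cmp Y (fob F a) (fob G a) (fob H a) (\<beta> a) (\<alpha> a)) a) =
          cmp Y (fob F a) (fob F b) (fob H b)
            ((\<lambda>a\<in>obj X. cmp Y (fob F a) (fob G a) (fob H a) (\<beta> a) (\<alpha> a)) b) (far F a b f)"
          using * by simp
      qed (simp add: F.fob_in G.fob_in H.fob_in \<alpha>.component_in \<beta>.component_in Y.cmp_in)
    qed simp
    fix I \<gamma> assume "I \<in> obj (functor_cat X Y)" and \<gamma>: "\<gamma> \<in> arr (functor_cat X Y) H I"
    then interpret I: cat_functor X Y I + \<gamma>: nat_trans X Y H I \<gamma> by (simp_all add: functor_cat_simps)
    show "cmp (functor_cat X Y) F G I (cmp (functor_cat X Y) G H I \<gamma> \<beta>) \<alpha> =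
      cmp (functor_cat X Y) F H I \<gamma> (cmp (functor_cat X Y) F G H \<beta> \<alpha>)"
      by (auto simp: functor_cat_simps F.fob_in G.fob_in H.fob_in I.fob_in \<alpha>.component_in \<beta>.component_in
          \<gamma>.component_in Y.cmp_assoc intro!: restrict_ext)
  qed
qed

lemma CAT_simps:
  "Ob CAT = {X. category X}"
  "Hom CAT = functor_cat"
  "Id CAT X = restrict_ftr X id_ftr"
  "comp1 CAT X Y Z G F = restrict_ftr X (comp_ftr G F)"
  "comp2 CAT X Y Z G G' F F' \<beta> \<alpha> = (\<lambda>a \<in> obj X.
     cmp Z (fob G (fob F a)) (fob G (fob F' a)) (fob G' (fob F' a))
       (\<beta> (fob F' a)) (far G (fob F a) (fob F' a) (\<alpha> a)))"
  by (simp_all add: CAT_def)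

lemma prod_cat_simps:
  "obj (prod_cat X Y) = obj X \<times> obj Y"
  "arr (prod_cat X Y) p q = arr X (fst p) (fst q) \<times> arr Y (snd p) (snd q)"
  "one (prod_cat X Y) p = (one X (fst p), one Y (snd p))"
  "cmp (prod_cat X Y) p q r u v =
     (cmp X (fst p) (fst q) (fst r) (fst u) (fst v), cmp Y (snd p) (snd q) (snd r) (snd u) (snd v))"
  by (auto simp: prod_cat_def split: prod.splits)

lemma two_category_CAT: "two_category CAT"
proof (rule two_category.intro)
  fix X :: "('a, 'x) cat" assume X: "X \<in> Ob CAT"
  then interpret X: category X by (simp add: CAT_simps)
  show "Id CAT X \<in> obj (Hom CAT X X)"
    using X.category_axioms by (simp add: CAT_simps functor_cat_simps cat_functor_id)
  fix Y :: "('a, 'x) cat" assume Y: "Y \<in> Ob CAT"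
  then interpret Y: category Y by (simp add: CAT_simps)
  show "category (Hom CAT X Y)"
    using X Y by (simp add: CAT_simps category_functor_cat)
  {
    fix F assume F: "F \<in> obj (Hom CAT X Y)"
    then interpret F: cat_functor X Y F by (simp add: CAT_simps functor_cat_simps)
    have rF: "restrict_ftr X F = F" using F by (simp add: CAT_simps functor_cat_simps)
    show "comp1 CAT X X Y F (Id CAT X) = F"
      unfolding CAT_simps by (rule ftr_eqI[of X]) (simp_all add: rF, simp_all add: comp_ftr_def id_ftr_def)
    show "comp1 CAT X Y Y (Id CAT Y) F = F"
      unfolding CAT_simps by (rule ftr_eqI[of X])
        (simp_all add: rF, simp_all add: comp_ftr_def id_ftr_def F.fob_in F.far_in)
    fix F' \<alpha> assume F': "F' \<in> obj (Hom CAT X Y)" and \<alpha>: "\<alpha> \<in> arr (Hom CAT X Y) F F'"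
    then interpret F': cat_functor X Y F' by (simp add: CAT_simps functor_cat_simps)
    interpret \<alpha>: nat_trans X Y F F' \<alpha> using \<alpha> by (simp add: CAT_simps functor_cat_simps)
    have e\<alpha>: "\<alpha> \<in> extensional (obj X)" using \<alpha> by (simp add: CAT_simps functor_cat_simps)
    show "rwhisk CAT X X Y F F' (Id CAT X) \<alpha> = \<alpha>"
      using e\<alpha> by (auto simp: CAT_simps functor_cat_simps id_ftr_def fun_eq_iff extensional_def X.one_in
          F.far_one F.fob_in F'.fob_in \<alpha>.component_in Y.cmp_one_right)
    show "lwhisk CAT X Y Y (Id CAT Y) F F' \<alpha> = \<alpha>"
      using e\<alpha> by (auto simp: CAT_simps functor_cat_simps id_ftr_def fun_eq_iff extensional_def
          F.fob_in F'.fob_in \<alpha>.component_in Y.cmp_one_left)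
  }
  fix Z :: "('a, 'x) cat" assume Z: "Z \<in> Ob CAT"
  then interpret Z: category Z by (simp add: CAT_simps)
  show "cat_functor (prod_cat (Hom CAT Y Z) (Hom CAT X Y)) (Hom CAT X Z) (Comp CAT X Y Z)"
  proof
    fix p assume "p \<in> obj (prod_cat (Hom CAT Y Z) (Hom CAT X Y))"
    then obtain G F where p: "p = (G, F)" and F: "cat_functor X Y F" and G: "cat_functor Y Z G"
      by (auto simp: prod_cat_simps CAT_simps functor_cat_simps)
    interpret F: cat_functor X Y F by fact
    interpret G: cat_functor Y Z G by fact
    show "fob (Comp CAT X Y Z) p \<in> obj (Hom CAT X Z)"
      using F G X.category_axioms by (simp add: p CAT_simps functor_cat_simps cat_functor_comp)
    show "far (Comp CAT X Y Z) p p (one (prod_cat (Hom CAT Y Z) (Hom CAT X Y)) p) =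
         one (Hom CAT X Z) (fob (Comp CAT X Y Z) p)"
      by (auto simp: p CAT_simps functor_cat_simps prod_cat_simps F.fob_in G.fob_in G.far_one Z.one_in
          Z.cmp_one_left comp_ftr_def intro!: restrict_ext)
    fix p' q assume "p' \<in> obj (prod_cat (Hom CAT Y Z) (Hom CAT X Y))"
      "q \<in> arr (prod_cat (Hom CAT Y Z) (Hom CAT X Y)) p p'"
    then obtain G' F' \<beta> \<alpha> where p': "p' = (G', F')" and q: "q = (\<beta>, \<alpha>)"
      and "cat_functor X Y F'" "cat_functor Y Z G'" "nat_trans Y Z G G' \<beta>" "nat_trans X Y F F' \<alpha>"
      by (auto simp: p prod_cat_simps CAT_simps functor_cat_simps)
    then interpret F': cat_functor X Y F' + G': cat_functor Y Z G' +
      \<alpha>: nat_trans X Y F F' \<alpha> + \<beta>: nat_trans Y Z G G' \<beta> by simp_all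
    show "far (Comp CAT X Y Z) p p' q \<in> arr (Hom CAT X Z) (fob (Comp CAT X Y Z) p) (fob (Comp CAT X Y Z) p')"
      unfolding p p' q CAT_simps functor_cat_simps
    proof (intro conjI)
      show "nat_trans X Z (restrict_ftr X (comp_ftr G F)) (restrict_ftr X (comp_ftr G' F'))
         (\<lambda>a\<in>obj X. cmp Z (fob G (fob F a)) (fob G (fob F' a)) (fob G' (fob F' a)) (\<beta> (fob F' a))
                      (far G (fob F a) (fob F' a) (\<alpha> a)))"
      proof
        fix a b f assume *: "a \<in> obj X" "b \<in> obj X" "f \<in> arr X a b"
        note [simp] = * F.fob_in G.fob_in F'.fob_in G'.fob_in F.far_in G.far_in F'.far_in G'.far_in
          \<alpha>.component_in \<beta>.component_in
        have "cmp Z (fob G (fob F a)) (fob G' (fob F' a)) (fob G' (fob F' b))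
            (far G' (fob F' a) (fob F' b) (far F' a b f))
            (cmp Z (fob G (fob F a)) (fob G (fob F' a)) (fob G' (fob F' a)) (\<beta> (fob F' a))
               (far G (fob F a) (fob F' a) (\<alpha> a))) =
          cmp Z (fob G (fob F a)) (fob G (fob F' a)) (fob G' (fob F' b))
            (cmp Z (fob G (fob F' a)) (fob G' (fob F' a)) (fob G' (fob F' b))
               (far G' (fob F' a) (fob F' b) (far F' a b f)) (\<beta> (fob F' a)))
            (far G (fob F a) (fob F' a) (\<alpha> a))"
          by (simp add: Z.cmp_assoc)
        also have "\<dots> = cmp Z (fob G (fob F a)) (fob G (fob F' b)) (fob G' (fob F' b)) (\<beta> (fob F' b))
            (far G (fob F a) (fob F' b) (cmp Y (fob F a) (fob F' a) (fob F' b) (far F' a b f) (\<alpha> a)))"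
          by (simp add: \<beta>.naturality Z.cmp_assoc G.far_cmp)
        also have "\<dots> = cmp Z (fob G (fob F a)) (fob G (fob F b)) (fob G' (fob F' b))
            (cmp Z (fob G (fob F b)) (fob G (fob F' b)) (fob G' (fob F' b)) (\<beta> (fob F' b))
               (far G (fob F b) (fob F' b) (\<alpha> b)))
            (far G (fob F a) (fob F b) (far F a b f))"
          by (simp add: \<alpha>.naturality Z.cmp_assoc G.far_cmp)
        finally show "cmp Z (fob (restrict_ftr X (comp_ftr G F)) a) (fob (restrict_ftr X (comp_ftr G' F')) a)
             (fob (restrict_ftr X (comp_ftr G' F')) b) (far (restrict_ftr X (comp_ftr G' F')) a b f)
             ((\<lambda>a\<in>obj X. cmp Z (fob G (fob F a)) (fob G (fob F' a)) (fob G' (fob F' a)) (\<beta> (fob F' a))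
                      (far G (fob F a) (fob F' a) (\<alpha> a))) a) =
           cmp Z (fob (restrict_ftr X (comp_ftr G F)) a) (fob (restrict_ftr X (comp_ftr G F)) b)
             (fob (restrict_ftr X (comp_ftr G' F')) b)
             ((\<lambda>a\<in>obj X. cmp Z (fob G (fob F a)) (fob G (fob F' a)) (fob G' (fob F' a)) (\<beta> (fob F' a))
                      (far G (fob F a) (fob F' a) (\<alpha> a))) b)
             (far (restrict_ftr X (comp_ftr G F)) a b f)"
          by (simp add: comp_ftr_def)
      qed (simp add: comp_ftr_def F.fob_in G.fob_in F'.fob_in G'.fob_in G.far_in \<alpha>.component_in
          \<beta>.component_in Z.cmp_in)
    qed simp
    fix p'' q' assume "p'' \<in> obj (prod_cat (Hom CAT Y Z) (Hom CAT X Y))"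
      "q' \<in> arr (prod_cat (Hom CAT Y Z) (Hom CAT X Y)) p' p''"
    then obtain G'' F'' \<beta>' \<alpha>' where p'': "p'' = (G'', F'')" and q': "q' = (\<beta>', \<alpha>')"
      and "cat_functor X Y F''" "cat_functor Y Z G''" "nat_trans Y Z G' G'' \<beta>'" "nat_trans X Y F' F'' \<alpha>'"
      by (auto simp: p' prod_cat_simps CAT_simps functor_cat_simps)
    then interpret F'': cat_functor X Y F'' + G'': cat_functor Y Z G'' +
      \<alpha>': nat_trans X Y F' F'' \<alpha>' + \<beta>': nat_trans Y Z G' G'' \<beta>' by simp_all
    show "far (Comp CAT X Y Z) p p'' (cmp (prod_cat (Hom CAT Y Z) (Hom CAT X Y)) p p' p'' q' q) =
      cmp (Hom CAT X Z) (fob (Comp CAT X Y Z) p) (fob (Comp CAT X Y Z) p') (fob (Comp CAT X Y Z) p'')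
        (far (Comp CAT X Y Z) p' p'' q') (far (Comp CAT X Y Z) p p' q)"
      unfolding p p' p'' q q' CAT_simps functor_cat_simps prod_cat_simps fst_conv snd_conv
    proof (rule restrict_ext)
      fix a assume a: "a \<in> obj X"
      note [simp] = a F.fob_in G.fob_in F'.fob_in G'.fob_in F''.fob_in G''.fob_in
        F.far_in G.far_in F'.far_in G'.far_in
        \<alpha>.component_in \<beta>.component_in \<alpha>'.component_in \<beta>'.component_in
      have "cmp Z (fob G (fob F a)) (fob G (fob F'' a)) (fob G'' (fob F'' a))
          (cmp Z (fob G (fob F'' a)) (fob G' (fob F'' a)) (fob G'' (fob F'' a)) (\<beta>' (fob F'' a)) (\<beta> (fob F'' a)))
          (far G (fob F a) (fob F'' a) (cmp Y (fob F a) (fob F' a) (fob F'' a) (\<alpha>' a) (\<alpha> a))) =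
        cmp Z (fob G (fob F a)) (fob G' (fob F'' a)) (fob G'' (fob F'' a)) (\<beta>' (fob F'' a))
          (cmp Z (fob G (fob F a)) (fob G (fob F' a)) (fob G' (fob F'' a))
            (cmp Z (fob G (fob F' a)) (fob G (fob F'' a)) (fob G' (fob F'' a)) (\<beta> (fob F'' a))
              (far G (fob F' a) (fob F'' a) (\<alpha>' a)))
            (far G (fob F a) (fob F' a) (\<alpha> a)))"
        by (simp add: G.far_cmp Z.cmp_assoc Z.cmp_in)
      also have "\<dots> = cmp Z (fob G (fob F a)) (fob G' (fob F' a)) (fob G'' (fob F'' a))
          (cmp Z (fob G' (fob F' a)) (fob G' (fob F'' a)) (fob G'' (fob F'' a)) (\<beta>' (fob F'' a))
             (far G' (fob F' a) (fob F'' a) (\<alpha>' a)))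
          (cmp Z (fob G (fob F a)) (fob G (fob F' a)) (fob G' (fob F' a)) (\<beta> (fob F' a))
             (far G (fob F a) (fob F' a) (\<alpha> a)))"
        by (simp add: Z.cmp_assoc Z.cmp_in flip: \<beta>.naturality)
      finally show "cmp Z (fob G (fob F a)) (fob G (fob F'' a)) (fob G'' (fob F'' a))
          ((\<lambda>a\<in>obj Y. cmp Z (fob G a) (fob G' a) (fob G'' a) (\<beta>' a) (\<beta> a)) (fob F'' a))
          (far G (fob F a) (fob F'' a)
            ((\<lambda>a\<in>obj X. cmp Y (fob F a) (fob F' a) (fob F'' a) (\<alpha>' a) (\<alpha> a)) a)) =
        cmp Z (fob (restrict_ftr X (comp_ftr G F)) a) (fob (restrict_ftr X (comp_ftr G' F')) a)
          (fob (restrict_ftr X (comp_ftr G'' F'')) a)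
          ((\<lambda>a\<in>obj X. cmp Z (fob G' (fob F' a)) (fob G' (fob F'' a)) (fob G'' (fob F'' a))
              (\<beta>' (fob F'' a)) (far G' (fob F' a) (fob F'' a) (\<alpha>' a))) a)
          ((\<lambda>a\<in>obj X. cmp Z (fob G (fob F a)) (fob G (fob F' a)) (fob G' (fob F' a))
              (\<beta> (fob F' a)) (far G (fob F a) (fob F' a) (\<alpha> a))) a)"
        by (simp add: comp_ftr_def)
    qed
  qed
  fix W :: "('a, 'x) cat" assume W: "W \<in> Ob CAT"
  then interpret W: category W by (simp add: CAT_simps)
  fix F G H assume "F \<in> obj (Hom CAT X Y)" "G \<in> obj (Hom CAT Y Z)" "H \<in> obj (Hom CAT Z W)"
  then interpret F: cat_functor X Y F + G: cat_functor Y Z G + H: cat_functor Z W H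
    by (simp_all add: CAT_simps functor_cat_simps)
  show "comp1 CAT X Y W (comp1 CAT Y Z W H G) F = comp1 CAT X Z W H (comp1 CAT X Y Z G F)"
    unfolding CAT_simps
    by (rule ftr_eqI[of X]) (simp_all, simp_all add: comp_ftr_def F.fob_in G.fob_in F.far_in G.far_in)
  fix F' G' H' \<alpha> \<beta> \<gamma>
  assume "F' \<in> obj (Hom CAT X Y)" "G' \<in> obj (Hom CAT Y Z)" "H' \<in> obj (Hom CAT Z W)"
    "\<alpha> \<in> arr (Hom CAT X Y) F F'" "\<beta> \<in> arr (Hom CAT Y Z) G G'" "\<gamma> \<in> arr (Hom CAT Z W) H H'"
  then interpret F': cat_functor X Y F' + G': cat_functor Y Z G' + H': cat_functor Z W H' +
    \<alpha>: nat_trans X Y F F' \<alpha> + \<beta>: nat_trans Y Z G G' \<beta> + \<gamma>: nat_trans Z W H H' \<gamma>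
    by (simp_all add: CAT_simps functor_cat_simps)
  show "comp2 CAT X Y W (comp1 CAT Y Z W H G) (comp1 CAT Y Z W H' G') F F'
            (comp2 CAT Y Z W H H' G G' \<gamma> \<beta>) \<alpha> =
          comp2 CAT X Z W H H' (comp1 CAT X Y Z G F) (comp1 CAT X Y Z G' F')
            \<gamma> (comp2 CAT X Y Z G G' F F' \<beta> \<alpha>)"
    unfolding CAT_simps
    by (rule restrict_ext) (simp add: comp_ftr_def F.fob_in G.fob_in H.fob_in F'.fob_in G'.fob_in H'.fob_in
        G.far_in H.far_in \<alpha>.component_in \<beta>.component_in \<gamma>.component_in H.far_cmp W.cmp_assoc)
qed

section \<open>Opposites, products and composites\<close>

lemma op2_simps [simp]:
  "Ob (op2 K) = Ob K" "Hom (op2 K) A B = Hom K B A" "Id (op2 K) = Id K"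
  "comp1 (op2 K) A B C g f = comp1 K C B A f g"
  "comp2 (op2 K) A B C g g' f f' \<beta> \<alpha> = comp2 K C B A f f' g g' \<alpha> \<beta>"
  by (simp_all add: op2_def)

lemma prod2_simps:
  "Ob (prod2 K M) = Ob K \<times> Ob M"
  "Hom (prod2 K M) P Q = prod_cat (Hom K (fst P) (fst Q)) (Hom M (snd P) (snd Q))"
  "Id (prod2 K M) P = (Id K (fst P), Id M (snd P))"
  "comp1 (prod2 K M) P Q R u v =
     (comp1 K (fst P) (fst Q) (fst R) (fst u) (fst v), comp1 M (snd P) (snd Q) (snd R) (snd u) (snd v))"
  "comp2 (prod2 K M) P Q R u u' v v' \<delta> \<gamma> =
     (comp2 K (fst P) (fst Q) (fst R) (fst u) (fst u') (fst v) (fst v') (fst \<delta>) (fst \<gamma>),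
      comp2 M (snd P) (snd Q) (snd R) (snd u) (snd u') (snd v) (snd v') (snd \<delta>) (snd \<gamma>))"
  by (auto simp: prod2_def split: prod.splits)

context two_category
begin

lemma comp1_in: "\<lbrakk>A \<in> Ob K; B \<in> Ob K; C \<in> Ob K; f \<in> obj (Hom K A B); g \<in> obj (Hom K B C)\<rbrakk> \<Longrightarrow>
    comp1 K A B C g f \<in> obj (Hom K A C)"
  using cat_functor.fob_in[OF Comp_functor, of A B C "(g, f)"] by (simp add: prod_cat_simps)

lemma comp2_in: "\<lbrakk>A \<in> Ob K; B \<in> Ob K; C \<in> Ob K; f \<in> obj (Hom K A B); g \<in> obj (Hom K B C);
    f' \<in> obj (Hom K A B); g' \<in> obj (Hom K B C); \<alpha> \<in> arr (Hom K A B) f f'; \<beta> \<in> arr (Hom K B C) g g'\<rbrakk> \<Longrightarrow>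
    comp2 K A B C g g' f f' \<beta> \<alpha> \<in> arr (Hom K A C) (comp1 K A B C g f) (comp1 K A B C g' f')"
  using cat_functor.far_in[OF Comp_functor, of A B C "(g, f)" "(g', f')" "(\<beta>, \<alpha>)"]
  by (simp add: prod_cat_simps)

lemma comp2_one: "\<lbrakk>A \<in> Ob K; B \<in> Ob K; C \<in> Ob K; f \<in> obj (Hom K A B); g \<in> obj (Hom K B C)\<rbrakk> \<Longrightarrow>
    comp2 K A B C g g f f (one (Hom K B C) g) (one (Hom K A B) f) = one (Hom K A C) (comp1 K A B C g f)"
  using cat_functor.far_one[OF Comp_functor, of A B C "(g, f)"] by (simp add: prod_cat_simps)

lemma comp2_cmp: "\<lbrakk>A \<in> Ob K; B \<in> Ob K; C \<in> Ob K; f \<in> obj (Hom K A B); g \<in> obj (Hom K B C);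
    f' \<in> obj (Hom K A B); g' \<in> obj (Hom K B C); f'' \<in> obj (Hom K A B); g'' \<in> obj (Hom K B C);
    \<alpha> \<in> arr (Hom K A B) f f'; \<beta> \<in> arr (Hom K B C) g g';
    \<alpha>' \<in> arr (Hom K A B) f' f''; \<beta>' \<in> arr (Hom K B C) g' g''\<rbrakk> \<Longrightarrow>
    comp2 K A B C g g'' f f'' (cmp (Hom K B C) g g' g'' \<beta>' \<beta>) (cmp (Hom K A B) f f' f'' \<alpha>' \<alpha>) =
    cmp (Hom K A C) (comp1 K A B C g f) (comp1 K A B C g' f') (comp1 K A B C g'' f'')
      (comp2 K A B C g' g'' f' f'' \<beta>' \<alpha>') (comp2 K A B C g g' f f' \<beta> \<alpha>)"
  using cat_functor.far_cmp[OF Comp_functor, of A B C "(g, f)" "(g', f')" "(g'', f'')" "(\<beta>, \<alpha>)" "(\<beta>', \<alpha>')"]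
  by (simp add: prod_cat_simps)

lemma two_category_op2: "two_category (op2 K)"
proof (rule two_category.intro, goal_cases)
  case (3 A B C)
  then show ?case
    by unfold_locales (auto simp: prod_cat_simps comp1_in comp2_in comp2_one comp2_cmp)
qed (simp_all add: hom_category Id_in comp1_Id_left comp1_Id_right comp2_Id_left comp2_Id_right
    comp1_assoc comp2_assoc)

end

lemma category_prod_cat:
  assumes "category X" "category Y"
  shows "category (prod_cat X Y)"
  using assms by (auto simp: category_def prod_cat_simps)

lemma two_category_prod2:
  assumes "two_category K" "two_category M"
  shows "two_category (prod2 K M)"
proof -
  interpret K: two_category K by fact
  interpret M: two_category M by fact
  show ?thesis
  proof (rule two_category.intro, goal_cases)
    case (3 A B C)
    then show ?case
      by unfold_locales
        (auto simp: prod2_simps prod_cat_simps K.comp1_in K.comp2_in K.comp2_one K.comp2_cmp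
          M.comp1_in M.comp2_in M.comp2_one M.comp2_cmp)
  qed (auto simp: prod2_simps prod_cat_simps category_prod_cat
      K.hom_category K.Id_in K.comp1_Id_left K.comp1_Id_right K.comp2_Id_left K.comp2_Id_right
      K.comp1_assoc K.comp2_assoc
      M.hom_category M.Id_in M.comp1_Id_left M.comp1_Id_right M.comp2_Id_left M.comp2_Id_right
      M.comp1_assoc M.comp2_assoc)
qed

lemma is_iso_one: "category X \<Longrightarrow> a \<in> obj X \<Longrightarrow> is_iso X a a (one X a)"
  by (auto simp: is_iso_def category.one_in category.cmp_one_left)

text \<open>With identity compositors the coherence axioms collapse to unit laws.\<close>

lemma strict_psfI:
  assumes "two_category K" "two_category M"
    and ob: "\<And>A. A \<in> Ob K \<Longrightarrow> pob F A \<in> Ob M"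
    and hom: "\<And>A B. A \<in> Ob K \<Longrightarrow> B \<in> Ob K \<Longrightarrow>
      cat_functor (Hom K A B) (Hom M (pob F A) (pob F B)) (phom F A B)"
    and Id: "\<And>A. A \<in> Ob K \<Longrightarrow> map1 F A A (Id K A) = Id M (pob F A)"
    and c1: "\<And>A B C f g. \<lbrakk>A \<in> Ob K; B \<in> Ob K; C \<in> Ob K; f \<in> obj (Hom K A B); g \<in> obj (Hom K B C)\<rbrakk> \<Longrightarrow>
      comp1 M (pob F A) (pob F B) (pob F C) (map1 F B C g) (map1 F A B f) = map1 F A C (comp1 K A B C g f)"
    and c2: "\<And>A B C f g f' g' \<alpha> \<beta>. \<lbrakk>A \<in> Ob K; B \<in> Ob K; C \<in> Ob K;
        f \<in> obj (Hom K A B); f' \<in> obj (Hom K A B); g \<in> obj (Hom K B C); g' \<in> obj (Hom K B C);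
        \<alpha> \<in> arr (Hom K A B) f f'; \<beta> \<in> arr (Hom K B C) g g'\<rbrakk> \<Longrightarrow>
      comp2 M (pob F A) (pob F B) (pob F C) (map1 F B C g) (map1 F B C g') (map1 F A B f) (map1 F A B f')
        (map2 F B C g g' \<beta>) (map2 F A B f f' \<alpha>) =
      map2 F A C (comp1 K A B C g f) (comp1 K A B C g' f') (comp2 K A B C g g' f f' \<beta> \<alpha>)"
    and pcomp: "\<And>A B C f g. \<lbrakk>A \<in> Ob K; B \<in> Ob K; C \<in> Ob K; f \<in> obj (Hom K A B); g \<in> obj (Hom K B C)\<rbrakk> \<Longrightarrow>
      pcomp F A B C g f = one (Hom M (pob F A) (pob F C)) (map1 F A C (comp1 K A B C g f))"
  shows "normal_pseudo_functor K M F"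
proof -
  interpret K: two_category K by fact
  interpret M: two_category M by fact
  note [simp] = ob K.comp1_in K.comp2_in K.Id_in cat_functor.fob_in[OF hom] cat_functor.far_in[OF hom]
    category.cmp_one_left[OF M.hom_category] category.cmp_one_right[OF M.hom_category]
    category.one_in[OF M.hom_category]
  show ?thesis
    by (rule normal_pseudo_functor.intro)
      (simp_all add: hom Id c1 c2 pcomp is_iso_one[OF M.hom_category] M.comp2_one K.comp1_assoc
        K.comp1_Id_left K.comp1_Id_right)
qed

lemma id_psf_normal:
  assumes "two_category K"
  shows "normal_pseudo_functor K K (id_psf K)"
  by (rule strict_psfI) (use assms in \<open>auto simp: id_psf_def id_ftr_def cat_functor_def\<close>)

lemma op_psf_normal:
  assumes "normal_pseudo_functor K M F"
  shows "normal_pseudo_functor (op2 K) (op2 M) (op_psf F)"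
proof -
  interpret F: normal_pseudo_functor K M F by fact
  show ?thesis
    by (rule normal_pseudo_functor.intro)
      (simp_all add: op_psf_def F.pob_in F.phom_functor F.map1_Id F.pcomp_iso F.pcomp_natural F.pcomp_assoc
        F.pcomp_Id_left F.pcomp_Id_right)
qed

lemma prod_psf_simps [simp]:
  "pob (prod_psf F G) P = (pob F (fst P), pob G (snd P))"
  "map1 (prod_psf F G) P Q u = (map1 F (fst P) (fst Q) (fst u), map1 G (snd P) (snd Q) (snd u))"
  "map2 (prod_psf F G) P Q u v \<delta> = (map2 F (fst P) (fst Q) (fst u) (fst v) (fst \<delta>),
     map2 G (snd P) (snd Q) (snd u) (snd v) (snd \<delta>))"
  "pcomp (prod_psf F G) P Q R u v = (pcomp F (fst P) (fst Q) (fst R) (fst u) (fst v),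
     pcomp G (snd P) (snd Q) (snd R) (snd u) (snd v))"
  by (auto simp: prod_psf_def split: prod.splits)

lemma is_iso_prod_cat:
  "is_iso (prod_cat X Y) p q u \<longleftrightarrow> is_iso X (fst p) (fst q) (fst u) \<and> is_iso Y (snd p) (snd q) (snd u)"
  by (auto simp: is_iso_def prod_cat_simps mem_Times_iff)

lemma prod_psf_normal:
  assumes "normal_pseudo_functor K M F" "normal_pseudo_functor K' M' F'"
  shows "normal_pseudo_functor (prod2 K K') (prod2 M M') (prod_psf F F')"
proof -
  interpret F: normal_pseudo_functor K M F by fact
  interpret F': normal_pseudo_functor K' M' F' by fact
  show ?thesis
  proof (rule normal_pseudo_functor.intro, goal_cases)
    case (2 P Q)
    then interpret X: cat_functor "Hom K (fst P) (fst Q)" "Hom M (pob F (fst P)) (pob F (fst Q))"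
        "phom F (fst P) (fst Q)"
      by (intro F.phom_functor) (auto simp: prod2_simps)
    from 2 interpret Y: cat_functor "Hom K' (snd P) (snd Q)" "Hom M' (pob F' (snd P)) (pob F' (snd Q))"
        "phom F' (snd P) (snd Q)"
      by (intro F'.phom_functor) (auto simp: prod2_simps)
    show ?case
      by unfold_locales (auto simp: prod2_simps prod_cat_simps X.fob_in X.far_in X.far_one X.far_cmp
          Y.fob_in Y.far_in Y.far_one Y.far_cmp)
  qed (auto simp: prod2_simps prod_cat_simps is_iso_prod_cat F.pob_in F.map1_Id F.pcomp_iso F.pcomp_natural
      F.pcomp_assoc F.pcomp_Id_left F.pcomp_Id_right
      F'.pob_in F'.map1_Id F'.pcomp_iso F'.pcomp_natural F'.pcomp_assoc F'.pcomp_Id_left F'.pcomp_Id_right)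
qed

lemma app_comp_psf [simp]:
  "app1 (comp_psf K M N G F) f = app1 G (app1 F f)"
  "is2 K \<alpha> \<Longrightarrow> app2 (comp_psf K M N G F) \<alpha> = app2 G (app2 F \<alpha>)"
  "pob (comp_psf K M N G F) A = pob G (pob F A)"
  by (auto simp: app_defs comp_psf_def comp_ftr_def elim!: is2E)

lemma coh_comp_psf:
  fixes N :: "('q, 'c, 'z) twocat" (structure)
  assumes "psf K M F" "psf M N G" and fg: "is1 K f" "is1 K g" "cd f = dm g"
  shows "coh K N (comp_psf K M N G F) g f =
    app2 G (coh K M F g f) \<bullet> coh M N G (app1 F g) (app1 F f)"
proof (rule cell_eqI)
  show "raw2 (coh K N (comp_psf K M N G F) g f) =
    raw2 (app2 G (coh K M F g f) \<bullet> coh M N G (app1 F g) (app1 F f))"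
    using fg by (elim is1E) (auto simp: app_defs comp_psf_def Let_def op_defs)
qed simp_all

text \<open>The compositor of \<open>G F\<close> is \<open>G(\<phi>) \<gamma>\<close>. In each axiom, naturality of \<open>\<gamma>\<close> moves it past the image of a cell of
  \<open>M\<close>, after which the axiom for \<open>F\<close> applies under \<open>G\<close> and the axiom for \<open>G\<close> applies outside.\<close>

lemma comp_psf_normal:
  fixes N :: "('q, 'c, 'z) twocat" (structure)
  assumes "psf K M F" "psf M N G"
  shows "normal_pseudo_functor K N (comp_psf K M N G F)"
proof -
  interpret F: psf K M F by fact
  interpret G: psf M N G by fact
  let ?c = "coh K M F" and ?d = "coh M N G"
  show ?thesis
  proof (rule psfI, goal_cases)
    case (10 g \<alpha>)
    note * = this
    let ?f = "src \<alpha>" and ?f' = "trg \<alpha>" and ?Gg = "app1 G (app1 F g)"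
    have "coh K N (comp_psf K M N G F) g ?f' \<bullet> ?Gg |> app2 G (app2 F \<alpha>) =
        app2 G (?c g ?f') \<bullet> ?d (app1 F g) (app1 F ?f') \<bullet> ?Gg |> app2 G (app2 F \<alpha>)"
      using * by (simp add: coh_comp_psf[OF assms])
    also have "\<dots> = app2 G (?c g ?f' \<bullet>\<^bsub>M\<^esub> app1 F g |>\<^bsub>M\<^esub> app2 F \<alpha>) \<bullet> ?d (app1 F g) (app1 F ?f)"
      using * G.coh_lw[of "app1 F g" "app2 F \<alpha>"] by simp
    also have "\<dots> = app2 G (app2 F (g |>\<^bsub>K\<^esub> \<alpha>)) \<bullet> coh K N (comp_psf K M N G F) g ?f"
      using * by (simp add: F.coh_lw coh_comp_psf[OF assms])
    finally show ?case using * by simp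
  next
    case (11 f \<beta>)
    note * = this
    let ?g = "src \<beta>" and ?g' = "trg \<beta>" and ?Gf = "app1 G (app1 F f)"
    have "coh K N (comp_psf K M N G F) ?g' f \<bullet> app2 G (app2 F \<beta>) <| ?Gf =
        app2 G (?c ?g' f) \<bullet> ?d (app1 F ?g') (app1 F f) \<bullet> app2 G (app2 F \<beta>) <| ?Gf"
      using * by (simp add: coh_comp_psf[OF assms])
    also have "\<dots> = app2 G (?c ?g' f \<bullet>\<^bsub>M\<^esub> app2 F \<beta> <|\<^bsub>M\<^esub> app1 F f) \<bullet> ?d (app1 F ?g) (app1 F f)"
      using * G.coh_rw[of "app1 F f" "app2 F \<beta>"] by simp
    also have "\<dots> = app2 G (app2 F (\<beta> <|\<^bsub>K\<^esub> f)) \<bullet> coh K N (comp_psf K M N G F) ?g f"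
      using * by (simp add: F.coh_rw coh_comp_psf[OF assms])
    finally show ?case using * by simp
  next
    case (12 f g h)
    note * = this
    let ?f = "app1 F f" and ?g = "app1 F g" and ?h = "app1 F h"
    have rw: "app2 G (?c h g <|\<^bsub>M\<^esub> ?f) \<bullet> ?d (?h \<odot>\<^bsub>M\<^esub> ?g) ?f =
        ?d (app1 F (h \<odot>\<^bsub>K\<^esub> g)) ?f \<bullet> app2 G (?c h g) <| app1 G ?f"
      using * G.coh_rw[of ?f "?c h g"] by simp
    have "coh K N (comp_psf K M N G F) h (g \<odot>\<^bsub>K\<^esub> f) \<bullet>
        app1 G ?h |> coh K N (comp_psf K M N G F) g f =
      app2 G (?c h (g \<odot>\<^bsub>K\<^esub> f)) \<bullet> (?d ?h (app1 F (g \<odot>\<^bsub>K\<^esub> f)) \<bullet>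
        app1 G ?h |> app2 G (?c g f)) \<bullet> app1 G ?h |> ?d ?g ?f"
      using * by (simp add: coh_comp_psf[OF assms])
    also have "\<dots> = app2 G (?c h (g \<odot>\<^bsub>K\<^esub> f) \<bullet>\<^bsub>M\<^esub> ?h |>\<^bsub>M\<^esub> ?c g f) \<bullet>
        (?d ?h (?g \<odot>\<^bsub>M\<^esub> ?f) \<bullet> app1 G ?h |> ?d ?g ?f)"
      using * G.coh_lw[of ?h "?c g f"] by simp
    also have "\<dots> = app2 G (?c (h \<odot>\<^bsub>K\<^esub> g) f \<bullet>\<^bsub>M\<^esub> ?c h g <|\<^bsub>M\<^esub> ?f) \<bullet>
        (?d (?h \<odot>\<^bsub>M\<^esub> ?g) ?f \<bullet> ?d ?h ?g <| app1 G ?f)"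
      using * F.coh_assoc[of f g h] G.coh_assoc[of ?f ?g ?h] by (simp del: F.app2_vc G.app2_vc)
    also have "\<dots> = app2 G (?c (h \<odot>\<^bsub>K\<^esub> g) f) \<bullet> (app2 G (?c h g <|\<^bsub>M\<^esub> ?f) \<bullet>
        ?d (?h \<odot>\<^bsub>M\<^esub> ?g) ?f) \<bullet> ?d ?h ?g <| app1 G ?f"
      using * by simp
    also have "\<dots> = coh K N (comp_psf K M N G F) (h \<odot>\<^bsub>K\<^esub> g) f \<bullet>
        coh K N (comp_psf K M N G F) h g <| app1 G ?f"
      unfolding rw using * by (simp add: coh_comp_psf[OF assms])
    finally show ?case using * by simp
  qed (simp_all add: coh_comp_psf[OF assms] F.K.two_cat_axioms G.M.two_cat_axioms)
qed

section \<open>Hom 2-functors\<close>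

text \<open>A pair \<open>(f, g)\<close> acts on \<open>h\<close> by \<open>(g h) f\<close> and a pair of 2-morphisms \<open>(\<alpha>, \<beta>)\<close> by \<open>(\<beta> h) \<star> \<alpha>\<close>. The next three
  lemmas say that the latter is natural in \<open>h\<close> and respects vertical and horizontal composition; all
  are instances of interchange.\<close>

lemma hom_psf_simps:
  "pob (hom_psf K) P = Hom K (fst P) (snd P)"
  "map1 (hom_psf K) P Q u = restrict_ftr (Hom K (fst P) (snd P)) \<lparr>
     fob = (\<lambda>h. comp1 K (fst Q) (fst P) (snd Q) (comp1 K (fst P) (snd P) (snd Q) (snd u) h) (fst u)),
     far = (\<lambda>h h' \<theta>. rwhisk K (fst Q) (fst P) (snd Q) (comp1 K (fst P) (snd P) (snd Q) (snd u) h)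
       (comp1 K (fst P) (snd P) (snd Q) (snd u) h') (fst u) (lwhisk K (fst P) (snd P) (snd Q) (snd u) h h' \<theta>))\<rparr>"
  "map2 (hom_psf K) P Q u v \<delta> = (\<lambda>h \<in> obj (Hom K (fst P) (snd P)).
     comp2 K (fst Q) (fst P) (snd Q) (comp1 K (fst P) (snd P) (snd Q) (snd u) h)
       (comp1 K (fst P) (snd P) (snd Q) (snd v) h) (fst u) (fst v)
       (rwhisk K (fst P) (snd P) (snd Q) (snd u) (snd v) h (snd \<delta>)) (fst \<delta>))"
  "pcomp (hom_psf K) P Q R v u = one (Hom CAT (pob (hom_psf K) P) (pob (hom_psf K) R))
     (map1 (hom_psf K) P R (comp1 (prod2 (op2 K) K) P Q R v u))"
  by (auto simp: hom_psf_def Let_def split: prod.splits)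

lemma repr_psf_simps:
  "pob (repr_psf K Y) X = Hom K X Y"
  "map1 (repr_psf K Y) X X' f = restrict_ftr (Hom K X Y) \<lparr>
     fob = (\<lambda>h. comp1 K X' X Y h f), far = (\<lambda>h h' \<theta>. rwhisk K X' X Y h h' f \<theta>)\<rparr>"
  "map2 (repr_psf K Y) X X' f f' \<alpha> = (\<lambda>h \<in> obj (Hom K X Y). lwhisk K X' X Y h f f' \<alpha>)"
  "pcomp (repr_psf K Y) X X' X'' g f = one (Hom CAT (pob (repr_psf K Y) X) (pob (repr_psf K Y) X''))
     (map1 (repr_psf K Y) X X'' (comp1 (op2 K) X X' X'' g f))"
  by (simp_all add: repr_psf_def Let_def)

lemma restrict_map1_hom_psf:
  "restrict_ftr (Hom K (fst P) (snd P)) (map1 (hom_psf K) P Q u) = map1 (hom_psf K) P Q u"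
  by (simp add: hom_psf_simps)

lemmas restrict_map1_hom_psf_pair = restrict_map1_hom_psf[of K "(X, Y)" for K X Y, simplified]

context two_cat
begin

lemma hom_act_natural:
  assumes "is2 K \<theta>" "is2 K \<beta>" "is2 K \<alpha>" "cd (src \<theta>) = dm (src \<beta>)" "cd (src \<alpha>) = dm (src \<theta>)"
  shows "(trg \<beta> |> \<theta>) <| trg \<alpha> \<bullet> (\<beta> <| src \<theta>) \<star> \<alpha> = (\<beta> <| trg \<theta>) \<star> \<alpha> \<bullet> (src \<beta> |> \<theta>) <| src \<alpha>"
proof -
  have "(trg \<beta> |> \<theta>) <| trg \<alpha> \<bullet> (\<beta> <| src \<theta>) \<star> \<alpha> = (trg \<beta> |> \<theta> \<bullet> \<beta> <| src \<theta>) \<star> (id2 K (trg \<alpha>) \<bullet> \<alpha>)"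
    using assms by (subst interchange) (simp_all add: rw_def[of K _ "trg \<alpha>"])
  also have "\<dots> = (\<beta> <| trg \<theta> \<bullet> src \<beta> |> \<theta>) \<star> (\<alpha> \<bullet> id2 K (src \<alpha>))"
    using assms exchange[of \<theta> \<beta>] by simp
  also have "\<dots> = (\<beta> <| trg \<theta>) \<star> \<alpha> \<bullet> (src \<beta> |> \<theta>) <| src \<alpha>"
    using assms by (subst interchange) (simp_all add: rw_def[of K _ "src \<alpha>"])
  finally show ?thesis .
qed

lemma hom_act_vc:
  assumes "is1 K h" "is2 K \<beta>" "is2 K \<beta>'" "is2 K \<alpha>" "is2 K \<alpha>'" "cd h = dm (src \<beta>)" "cd (src \<alpha>) = dm h"
    "trg \<alpha> = src \<alpha>'" "trg \<beta> = src \<beta>'"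
  shows "((\<beta>' \<bullet> \<beta>) <| h) \<star> (\<alpha>' \<bullet> \<alpha>) = (\<beta>' <| h) \<star> \<alpha>' \<bullet> (\<beta> <| h) \<star> \<alpha>"
  using assms is2_frame[of K \<beta>] is2_frame[of K \<alpha>] by (simp add: interchange)

lemma hom_act_comp2:
  assumes "is1 K h" "is2 K \<beta>" "is2 K \<beta>'" "is2 K \<alpha>" "is2 K \<alpha>'" "cd h = dm (src \<beta>)" "cd (src \<alpha>) = dm h"
    "cd (src \<alpha>') = dm (src \<alpha>)" "cd (src \<beta>) = dm (src \<beta>')"
  shows "((\<beta>' \<star> \<beta>) <| h) \<star> (\<alpha> \<star> \<alpha>') =
    (\<beta>' <| ((trg \<beta> \<odot> h) \<odot> trg \<alpha>)) \<star> \<alpha>' \<bullet> (src \<beta>' |> ((\<beta> <| h) \<star> \<alpha>)) <| src \<alpha>'"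
proof -
  let ?x = "(\<beta> <| h) \<star> \<alpha>"
  have "(\<beta>' <| ((trg \<beta> \<odot> h) \<odot> trg \<alpha>)) \<star> \<alpha>' \<bullet> (src \<beta>' |> ?x) <| src \<alpha>' =
      (\<beta>' <| trg ?x \<bullet> src \<beta>' |> ?x) \<star> (\<alpha>' \<bullet> id2 K (src \<alpha>'))"
    using assms by (subst interchange) (simp_all add: rw_def[of K _ "src \<alpha>'"])
  also have "\<dots> = (\<beta>' \<star> ?x) \<star> \<alpha>'"
    using assms by (subst hc_left_first[symmetric]) simp_all
  also have "\<dots> = ((\<beta>' \<star> \<beta>) <| h) \<star> (\<alpha> \<star> \<alpha>')"
    using assms by (simp add: rw_def hc_assoc)
  finally show ?thesis by simp
qed

lemma hom_psf_map1_in: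
  assumes "X \<in> Ob K" "Y \<in> Ob K" "X' \<in> Ob K" "Y' \<in> Ob K" "f \<in> obj (Hom K X' X)" "g \<in> obj (Hom K Y Y')"
  shows "cat_functor (Hom K X Y) (Hom K X' Y') (map1 (hom_psf K) (X, Y) (X', Y') (f, g))"
proof -
  interpret XY: category "Hom K X Y" using assms by (intro cat)
  have "cat_functor (Hom K X Y) (Hom K X' Y') \<lparr>fob = (\<lambda>h. comp1 K X' X Y' (comp1 K X Y Y' g h) f),
     far = (\<lambda>h h' \<theta>. rwhisk K X' X Y' (comp1 K X Y Y' g h) (comp1 K X Y Y' g h') f (lwhisk K X Y Y' g h h' \<theta>))\<rparr>"
  proof (unfold_locales, goal_cases)
    case (4 h h' h'' \<theta> \<theta>')
    then show ?case
      using assms arg_cong[OF comp2_cmp[of X Y Y' h g h' g h'' g \<theta> "one (Hom K Y Y') g" \<theta>' "one (Hom K Y Y') g"],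
          of "\<lambda>x. rwhisk K X' X Y' (comp1 K X Y Y' g h) (comp1 K X Y Y' g h'') f x"]
      using comp2_cmp[of X' X Y' f "comp1 K X Y Y' g h" f "comp1 K X Y Y' g h'" f "comp1 K X Y Y' g h''"
        "one (Hom K X' X) f" "lwhisk K X Y Y' g h h' \<theta>" "one (Hom K X' X) f" "lwhisk K X Y Y' g h' h'' \<theta>'"]
      by (simp add: comp1_in comp2_in category.one_in[OF cat] category.cmp_one_left[OF cat])
  qed (use assms in \<open>simp_all add: comp1_in comp2_in comp2_one category.one_in[OF cat]\<close>)
  then show ?thesis
    by (simp add: hom_psf_simps XY.category_axioms)
qed

lemma hom_psf_phom:
  assumes "P \<in> Ob (prod2 (op2 K) K)" "Q \<in> Ob (prod2 (op2 K) K)"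
  shows "cat_functor (Hom (prod2 (op2 K) K) P Q) (Hom CAT (pob (hom_psf K) P) (pob (hom_psf K) Q))
    (phom (hom_psf K) P Q)"
proof -
  obtain X Y X' Y' where PQ [simp]: "P = (X, Y)" "Q = (X', Y')" and
    [simp]: "X \<in> Ob K" "Y \<in> Ob K" "X' \<in> Ob K" "Y' \<in> Ob K"
    using assms by (cases P; cases Q) (auto simp: prod2_simps)
  show ?thesis
  proof (unfold_locales, goal_cases)
    case (1 u)
    then show ?case
      by (cases u) (auto simp: CAT_simps functor_cat_simps prod2_simps prod_cat_simps hom_psf_map1_in
          hom_psf_simps(1) restrict_map1_hom_psf_pair)
  next
    case (2 u v \<delta>)
    obtain f g f' g' \<alpha> \<beta> where [simp]: "u = (f, g)" "v = (f', g')" "\<delta> = (\<alpha>, \<beta>)"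
      by (cases u; cases v; cases \<delta>)
    have [simp]: "f \<in> obj (Hom K X' X)" "f' \<in> obj (Hom K X' X)" "g \<in> obj (Hom K Y Y')" "g' \<in> obj (Hom K Y Y')"
      "\<alpha> \<in> arr (Hom K X' X) f f'" "\<beta> \<in> arr (Hom K Y Y') g g'"
      using 2 by (simp_all add: prod2_simps prod_cat_simps)
    show ?case
      unfolding CAT_simps functor_cat_simps
    proof (intro conjI, simp add: hom_psf_simps, unfold_locales, goal_cases)
      case (1 h)
      then show ?case
        by (simp add: hom_psf_simps comp1_in comp2_in category.one_in[OF cat])
    next
      case (2 h h' \<theta>)
      then show ?case
        using arg_cong[OF hom_act_natural[of "Cell (Mor X Y h) (Mor X Y h') \<theta>"
          "Cell (Mor Y Y' g) (Mor Y Y' g') \<beta>" "Cell (Mor X' X f) (Mor X' X f') \<alpha>"], of raw2]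
        by (simp add: hom_psf_simps is2_Cell) (simp add: op_defs)
    qed
  next
    case (3 u)
    then show ?case
      by (cases u) (auto simp: hom_psf_simps CAT_simps functor_cat_simps prod2_simps prod_cat_simps comp2_one comp1_in
        intro!: restrict_ext)
  next
    case (4 u v w \<delta> \<delta>')
    obtain f g f' g' f'' g'' \<alpha> \<beta> \<alpha>' \<beta>' where [simp]: "u = (f, g)" "v = (f', g')" "w = (f'', g'')"
      "\<delta> = (\<alpha>, \<beta>)" "\<delta>' = (\<alpha>', \<beta>')"
      by (cases u; cases v; cases w; cases \<delta>; cases \<delta>')
    have [simp]: "f \<in> obj (Hom K X' X)" "f' \<in> obj (Hom K X' X)" "f'' \<in> obj (Hom K X' X)"
      "g \<in> obj (Hom K Y Y')" "g' \<in> obj (Hom K Y Y')" "g'' \<in> obj (Hom K Y Y')"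
      "\<alpha> \<in> arr (Hom K X' X) f f'" "\<beta> \<in> arr (Hom K Y Y') g g'"
      "\<alpha>' \<in> arr (Hom K X' X) f' f''" "\<beta>' \<in> arr (Hom K Y Y') g' g''"
      using 4 by (simp_all add: prod2_simps prod_cat_simps)
    have "raw2 (((Cell (Mor Y Y' g') (Mor Y Y' g'') \<beta>' \<bullet> Cell (Mor Y Y' g) (Mor Y Y' g') \<beta>) <| Mor X Y h) \<star>
        (Cell (Mor X' X f') (Mor X' X f'') \<alpha>' \<bullet> Cell (Mor X' X f) (Mor X' X f') \<alpha>)) =
      raw2 ((Cell (Mor Y Y' g') (Mor Y Y' g'') \<beta>' <| Mor X Y h) \<star> Cell (Mor X' X f') (Mor X' X f'') \<alpha>' \<bullet>
        (Cell (Mor Y Y' g) (Mor Y Y' g') \<beta> <| Mor X Y h) \<star> Cell (Mor X' X f) (Mor X' X f') \<alpha>)"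
      if "h \<in> obj (Hom K X Y)" for h
      by (rule arg_cong[OF hom_act_vc]) (use that in \<open>simp_all add: is2_Cell is1_Mor\<close>)
    then show ?case
      by (auto simp: hom_psf_simps CAT_simps functor_cat_simps prod2_simps prod_cat_simps op_defs
          intro!: restrict_ext)
  qed
qed

lemma hom_psf_comp1:
  assumes "X \<in> Ob K" "Y \<in> Ob K" "X' \<in> Ob K" "Y' \<in> Ob K" "X'' \<in> Ob K" "Y'' \<in> Ob K"
    "f \<in> obj (Hom K X' X)" "g \<in> obj (Hom K Y Y')" "f' \<in> obj (Hom K X'' X')" "g' \<in> obj (Hom K Y' Y'')"
  shows "comp1 CAT (Hom K X Y) (Hom K X' Y') (Hom K X'' Y'')
      (map1 (hom_psf K) (X', Y') (X'', Y'') (f', g')) (map1 (hom_psf K) (X, Y) (X', Y') (f, g)) =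
    map1 (hom_psf K) (X, Y) (X'', Y'') (comp1 K X'' X' X f f', comp1 K Y Y' Y'' g' g)"
  unfolding CAT_simps
proof (rule ftr_eqI[of "Hom K X Y"])
  fix h h' \<theta> assume *: "h \<in> obj (Hom K X Y)" "h' \<in> obj (Hom K X Y)" "\<theta> \<in> arr (Hom K X Y) h h'"
  let ?\<theta> = "Cell (Mor X Y h) (Mor X Y h') \<theta>"
  have "(Mor Y' Y'' g' |> ((Mor Y Y' g |> ?\<theta>) <| Mor X' X f)) <| Mor X'' X' f' =
      ((Mor Y' Y'' g' \<odot> Mor Y Y' g) |> ?\<theta>) <| (Mor X' X f \<odot> Mor X'' X' f')"
    using assms * by (simp add: is2_Cell is1_Mor)
  from arg_cong[OF this, of raw2]
  show "far (restrict_ftr (Hom K X Y) (comp_ftr (map1 (hom_psf K) (X', Y') (X'', Y'') (f', g'))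
      (map1 (hom_psf K) (X, Y) (X', Y') (f, g)))) h h' \<theta> =
    far (map1 (hom_psf K) (X, Y) (X'', Y'') (comp1 K X'' X' X f f', comp1 K Y Y' Y'' g' g)) h h' \<theta>"
    using assms * by (simp add: comp_ftr_def hom_psf_simps comp1_in comp2_in category.one_in[OF cat] op_defs)
qed (use assms in \<open>simp_all add: hom_psf_simps comp_ftr_def comp1_in comp1_assoc\<close>)

lemma hom_psf_comp2:
  assumes "X \<in> Ob K" "Y \<in> Ob K" "X' \<in> Ob K" "Y' \<in> Ob K" "X'' \<in> Ob K" "Y'' \<in> Ob K"
    "f \<in> obj (Hom K X' X)" "g \<in> obj (Hom K Y Y')" "f' \<in> obj (Hom K X'' X')" "g' \<in> obj (Hom K Y' Y'')"
    "k \<in> obj (Hom K X' X)" "l \<in> obj (Hom K Y Y')" "k' \<in> obj (Hom K X'' X')" "l' \<in> obj (Hom K Y' Y'')"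
    "\<alpha> \<in> arr (Hom K X' X) f k" "\<beta> \<in> arr (Hom K Y Y') g l"
    "\<alpha>' \<in> arr (Hom K X'' X') f' k'" "\<beta>' \<in> arr (Hom K Y' Y'') g' l'"
  shows "comp2 CAT (Hom K X Y) (Hom K X' Y') (Hom K X'' Y'')
      (map1 (hom_psf K) (X', Y') (X'', Y'') (f', g')) (map1 (hom_psf K) (X', Y') (X'', Y'') (k', l'))
      (map1 (hom_psf K) (X, Y) (X', Y') (f, g)) (map1 (hom_psf K) (X, Y) (X', Y') (k, l))
      (map2 (hom_psf K) (X', Y') (X'', Y'') (f', g') (k', l') (\<alpha>', \<beta>'))
      (map2 (hom_psf K) (X, Y) (X', Y') (f, g) (k, l) (\<alpha>, \<beta>)) =
    map2 (hom_psf K) (X, Y) (X'', Y'')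
      (comp1 K X'' X' X f f', comp1 K Y Y' Y'' g' g) (comp1 K X'' X' X k k', comp1 K Y Y' Y'' l' l)
      (comp2 K X'' X' X f k f' k' \<alpha> \<alpha>', comp2 K Y Y' Y'' g' l' g l \<beta>' \<beta>)"
proof -
  have e: "raw2 (((Cell (Mor Y' Y'' g') (Mor Y' Y'' l') \<beta>' \<star> Cell (Mor Y Y' g) (Mor Y Y' l) \<beta>) <| Mor X Y h) \<star>
      (Cell (Mor X' X f) (Mor X' X k) \<alpha> \<star> Cell (Mor X'' X' f') (Mor X'' X' k') \<alpha>')) =
    raw2 ((Cell (Mor Y' Y'' g') (Mor Y' Y'' l') \<beta>' <| ((Mor Y Y' l \<odot> Mor X Y h) \<odot> Mor X' X k)) \<star>
        Cell (Mor X'' X' f') (Mor X'' X' k') \<alpha>' \<bullet>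
      (Mor Y' Y'' g' |> ((Cell (Mor Y Y' g) (Mor Y Y' l) \<beta> <| Mor X Y h) \<star> Cell (Mor X' X f) (Mor X' X k) \<alpha>)) <|
        Mor X'' X' f')"
    if "h \<in> obj (Hom K X Y)" for h
    by (rule arg_cong[OF hom_act_comp2[where
        \<beta> = "Cell (Mor Y Y' g) (Mor Y Y' l) \<beta>" and \<beta>' = "Cell (Mor Y' Y'' g') (Mor Y' Y'' l') \<beta>'" and
        \<alpha> = "Cell (Mor X' X f) (Mor X' X k) \<alpha>" and \<alpha>' = "Cell (Mor X'' X' f') (Mor X'' X' k') \<alpha>'",
        simplified]]) (use assms that in \<open>simp_all add: is2_Cell is1_Mor\<close>)
  show ?thesis
    unfolding CAT_simps hom_psf_simps
  proof (simp only: fst_conv snd_conv, rule restrict_ext, goal_cases)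
    case (1 h)
    then show ?case
      using assms e[OF 1]
      by (simp add: comp1_in comp2_in category.one_in[OF cat] op_defs)
  qed
qed

lemma hom_psf_normal: "normal_pseudo_functor (prod2 (op2 K) K) CAT (hom_psf K)"
proof (rule strict_psfI, goal_cases)
  case 1
  show ?case
    by (intro two_category_prod2 two_category_op2 two_category_axioms)
next
  case 2
  show ?case by (rule two_category_CAT)
next
  case (3 P)
  then show ?case by (auto simp: prod2_simps CAT_simps hom_psf_simps cat)
next
  case (4 P Q)
  then show ?case by (rule hom_psf_phom)
next
  case (5 P)
  then have "fst P \<in> Ob K" "snd P \<in> Ob K" by (auto simp: prod2_simps)
  then show ?case
    unfolding prod2_simps CAT_simps hom_psf_simps
    by - (rule ftr_eqI[of "Hom K (fst P) (snd P)"],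
      simp_all add: comp1_Id_left comp1_Id_right comp2_Id_left comp2_Id_right id_ftr_def)
next
  case (6 P Q R u v)
  then show ?case
    using hom_psf_comp1[of "fst P" "snd P" "fst Q" "snd Q" "fst R" "snd R" "fst u" "snd u" "fst v" "snd v"]
    by (simp add: prod2_simps prod_cat_simps mem_Times_iff hom_psf_simps(1))
next
  case (7 P Q R u v u' v' \<delta> \<delta>')
  then show ?case
    using hom_psf_comp2[of "fst P" "snd P" "fst Q" "snd Q" "fst R" "snd R" "fst u" "snd u" "fst v" "snd v"
        "fst u'" "snd u'" "fst v'" "snd v'" "fst \<delta>" "snd \<delta>" "fst \<delta>'" "snd \<delta>'"]
    by (simp add: prod2_simps prod_cat_simps mem_Times_iff hom_psf_simps(1))
next
  case (8 P Q R u v)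
  then show ?case by (simp add: hom_psf_simps(4))
qed

text \<open>\<open>K(-,Y)\<close> is the restriction of the hom 2-functor along the identity of \<open>Y\<close>.\<close>

lemma repr_hom:
  assumes "X \<in> Ob K" "X' \<in> Ob K" "Y \<in> Ob K" "f \<in> obj (Hom K X' X)"
  shows "map1 (repr_psf K Y) X X' f = map1 (hom_psf K) (X, Y) (X', Y) (f, Id K Y)"
    and "f' \<in> obj (Hom K X' X) \<Longrightarrow> \<alpha> \<in> arr (Hom K X' X) f f' \<Longrightarrow> map2 (repr_psf K Y) X X' f f' \<alpha> =
      map2 (hom_psf K) (X, Y) (X', Y) (f, Id K Y) (f', Id K Y) (\<alpha>, one (Hom K Y Y) (Id K Y))"
proof -
  show "map1 (repr_psf K Y) X X' f = map1 (hom_psf K) (X, Y) (X', Y) (f, Id K Y)"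
    using assms unfolding repr_psf_simps hom_psf_simps
    by - (rule ftr_eqI[of "Hom K X Y"], simp_all add: comp1_Id_left comp2_Id_left)
  show "f' \<in> obj (Hom K X' X) \<Longrightarrow> \<alpha> \<in> arr (Hom K X' X) f f' \<Longrightarrow> map2 (repr_psf K Y) X X' f f' \<alpha> =
      map2 (hom_psf K) (X, Y) (X', Y) (f, Id K Y) (f', Id K Y) (\<alpha>, one (Hom K Y Y) (Id K Y))"
    using assms unfolding repr_psf_simps hom_psf_simps
    by - (simp only: fst_conv snd_conv, rule restrict_ext, simp add: comp1_Id_left comp2_one Id_in)
qed

lemma repr_psf_normal:
  assumes Y: "Y \<in> Ob K"
  shows "normal_pseudo_functor (op2 K) CAT (repr_psf K Y)"
proof (rule strict_psfI, goal_cases)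
  case 1
  show ?case by (intro two_category_op2)
next
  case 2
  show ?case by (rule two_category_CAT)
next
  case (3 X)
  then show ?case using Y by (simp add: CAT_simps repr_psf_simps cat)
next
  case (4 X X')
  then have [simp]: "X \<in> Ob K" "X' \<in> Ob K" by simp_all
  interpret H: cat_functor "Hom (prod2 (op2 K) K) (X, Y) (X', Y)"
    "Hom CAT (pob (hom_psf K) (X, Y)) (pob (hom_psf K) (X', Y))" "phom (hom_psf K) (X, Y) (X', Y)"
    using Y by (intro hom_psf_phom) (simp_all add: prod2_simps)
  note [simp] = prod2_simps prod_cat_simps hom_psf_simps(1) repr_psf_simps(1) repr_hom Y Id_in
    category.one_in[OF cat]
  show ?case
  proof (unfold_locales, goal_cases)
    case (1 f)
    then show ?case using H.fob_in[of "(f, Id K Y)"] by simp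
  next
    case (2 f f' \<alpha>)
    then show ?case using H.far_in[of "(f, Id K Y)" "(f', Id K Y)" "(\<alpha>, one (Hom K Y Y) (Id K Y))"] by simp
  next
    case (3 f)
    then show ?case using H.far_one[of "(f, Id K Y)"] by simp
  next
    case (4 f f' f'' \<alpha> \<alpha>')
    then show ?case
      using H.far_cmp[of "(f, Id K Y)" "(f', Id K Y)" "(f'', Id K Y)" "(\<alpha>, one (Hom K Y Y) (Id K Y))"
        "(\<alpha>', one (Hom K Y Y) (Id K Y))"]
      by (simp add: category.cmp_in[OF cat] category.cmp_one_left[OF cat])
  qed
next
  case (5 X)
  then show ?case
    using Y unfolding op2_simps CAT_simps repr_psf_simps
    by - (rule ftr_eqI[of "Hom K X Y"], simp_all add: comp1_Id_right comp2_Id_right id_ftr_def)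
next
  case (6 X X' X'' f g)
  then show ?case
    using Y hom_psf_comp1[of X Y X' Y X'' Y f "Id K Y" g "Id K Y"]
    by (simp add: repr_hom repr_psf_simps(1) Id_in comp1_in comp1_Id_left)
next
  case (7 X X' X'' f g f' g' \<alpha> \<beta>)
  then show ?case
    using Y hom_psf_comp2[of X Y X' Y X'' Y f "Id K Y" g "Id K Y" f' "Id K Y" g' "Id K Y" \<alpha>
        "one (Hom K Y Y) (Id K Y)" \<beta> "one (Hom K Y Y) (Id K Y)"]
    by (simp add: repr_hom repr_psf_simps(1) Id_in comp1_in comp2_in comp1_Id_left comp2_one
        category.one_in[OF cat])
next
  case (8 X X' X'' f g)
  then show ?case by (simp add: repr_psf_simps(4))
qed

end

section \<open>Weak equivalences of categories\<close>

text \<open>Fully faithful and essentially surjective: a property of the functor alone, for which no inverse has to be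
  carried along.\<close>

definition weak_equivalence :: "('a, 'x) cat \<Rightarrow> ('b, 'y) cat \<Rightarrow> ('a, 'x, 'b, 'y) ftr \<Rightarrow> bool" where
  "weak_equivalence X Y F \<longleftrightarrow>
    (\<forall>a \<in> obj X. \<forall>b \<in> obj X. bij_betw (far F a b) (arr X a b) (arr Y (fob F a) (fob F b))) \<and>
    (\<forall>y \<in> obj Y. \<exists>a \<in> obj X. \<exists>k. is_iso Y (fob F a) y k)"

lemma is_iso_functor_cat:
  assumes "category X" "category Y" "cat_functor X Y F" "cat_functor X Y G"
    and \<alpha>: "nat_trans X Y F G \<alpha>" "\<alpha> \<in> extensional (obj X)"
    and iso: "\<And>a. a \<in> obj X \<Longrightarrow> is_iso Y (fob F a) (fob G a) (\<alpha> a)"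
  shows "is_iso (functor_cat X Y) F G \<alpha>"
proof -
  interpret X: category X by fact
  interpret Y: category Y by fact
  interpret F: cat_functor X Y F by fact
  interpret G: cat_functor X Y G by fact
  interpret \<alpha>: nat_trans X Y F G \<alpha> by fact
  obtain \<beta> where \<beta>: "\<And>a. a \<in> obj X \<Longrightarrow> \<beta> a \<in> arr Y (fob G a) (fob F a)"
    and \<beta>\<alpha>: "\<And>a. a \<in> obj X \<Longrightarrow> cmp Y (fob F a) (fob G a) (fob F a) (\<beta> a) (\<alpha> a) = one Y (fob F a)"
    and \<alpha>\<beta>: "\<And>a. a \<in> obj X \<Longrightarrow> cmp Y (fob G a) (fob F a) (fob G a) (\<alpha> a) (\<beta> a) = one Y (fob G a)"
    using iso unfolding is_iso_def by metis
  have "nat_trans X Y G F (restrict \<beta> (obj X))"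
  proof
    fix a b f assume *: "a \<in> obj X" "b \<in> obj X" "f \<in> arr X a b"
    note [simp] = * F.fob_in G.fob_in F.far_in G.far_in \<alpha>.component_in \<beta> Y.cmp_in
    have "cmp Y (fob G a) (fob F a) (fob F b) (far F a b f) (\<beta> a) =
        cmp Y (fob G a) (fob F a) (fob F b) (cmp Y (fob F a) (fob F b) (fob F b)
          (cmp Y (fob F b) (fob G b) (fob F b) (\<beta> b) (\<alpha> b)) (far F a b f)) (\<beta> a)"
      by (simp add: \<beta>\<alpha> Y.cmp_one_left)
    also have "\<dots> = cmp Y (fob G a) (fob G b) (fob F b) (\<beta> b) (cmp Y (fob G a) (fob F a) (fob G b)
        (cmp Y (fob F a) (fob F b) (fob G b) (\<alpha> b) (far F a b f)) (\<beta> a))"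
      by (simp add: Y.cmp_assoc)
    also have "\<dots> = cmp Y (fob G a) (fob G b) (fob F b) (\<beta> b) (far G a b f)"
      by (simp add: Y.cmp_assoc Y.cmp_one_right \<alpha>\<beta> flip: \<alpha>.naturality)
    finally show "cmp Y (fob G a) (fob F a) (fob F b) (far F a b f) (restrict \<beta> (obj X) a) =
        cmp Y (fob G a) (fob G b) (fob F b) (restrict \<beta> (obj X) b) (far G a b f)"
      by simp
  qed (simp add: \<beta>)
  then show ?thesis
    unfolding is_iso_def
    by (intro conjI bexI[of _ "restrict \<beta> (obj X)"])
      (use \<alpha> \<beta> \<beta>\<alpha> \<alpha>\<beta> in \<open>auto simp: functor_cat_simps intro!: restrict_ext\<close>)
qed

lemma functor_cat_is_isoD:
  assumes "is_iso (functor_cat X Y) F G \<alpha>" "a \<in> obj X"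
  shows "is_iso Y (fob F a) (fob G a) (\<alpha> a)"
proof -
  obtain \<beta> where \<beta>: "nat_trans X Y F G \<alpha>" "nat_trans X Y G F \<beta>"
    "cmp (functor_cat X Y) F G F \<beta> \<alpha> = one (functor_cat X Y) F"
    "cmp (functor_cat X Y) G F G \<alpha> \<beta> = one (functor_cat X Y) G"
    using assms unfolding is_iso_def by (auto simp: functor_cat_simps(2))
  with assms(2) show ?thesis
    unfolding is_iso_def
    by (auto simp: functor_cat_simps nat_trans_def dest!: fun_cong[of _ _ a] intro!: bexI[of _ "\<beta> a"])
qed

text \<open>Choose \<open>s y\<close> with an isomorphism \<open>e y : F (s y) \<rightarrow> y\<close> for each \<open>y\<close>. Since \<open>F\<close> is fully faithful, there are unique
  arrows \<open>S k\<close> and \<open>\<eta> a\<close> with \<open>F (S k) = e' k e\<close> and \<open>F (\<eta> a) = e'\<close>, where \<open>e'\<close> is inverse to \<open>e\<close>. Every equation in the domain of \<open>F\<close>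
  that is needed follows by applying \<open>F\<close>.\<close>

lemma weak_equivalence_adjoint:
  assumes cats: "category X" "category Y" and F: "cat_functor X Y F" "restrict_ftr X F = F"
    and w: "weak_equivalence X Y F"
  shows "\<exists>E. adjoint_equivalence CAT X Y E \<and> fwd E = F"
proof -
  interpret X: category X by fact
  interpret Y: category Y by fact
  interpret F: cat_functor X Y F by fact
  have bij: "bij_betw (far F a b) (arr X a b) (arr Y (fob F a) (fob F b))"
    if "a \<in> obj X" "b \<in> obj X" for a b
    using w that unfolding weak_equivalence_def by blast
  have "\<exists>s e e'. \<forall>y \<in> obj Y. s y \<in> obj X \<and> e y \<in> arr Y (fob F (s y)) y \<and> e' y \<in> arr Y y (fob F (s y)) \<and>
      cmp Y (fob F (s y)) y (fob F (s y)) (e' y) (e y) = one Y (fob F (s y)) \<and>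
      cmp Y y (fob F (s y)) y (e y) (e' y) = one Y y"
    using w unfolding weak_equivalence_def is_iso_def by metis
  then obtain s e e' where s [simp]: "\<And>y. y \<in> obj Y \<Longrightarrow> s y \<in> obj X"
    and e [simp]: "\<And>y. y \<in> obj Y \<Longrightarrow> e y \<in> arr Y (fob F (s y)) y"
    and e' [simp]: "\<And>y. y \<in> obj Y \<Longrightarrow> e' y \<in> arr Y y (fob F (s y))"
    and e'e [simp]: "\<And>y. y \<in> obj Y \<Longrightarrow> cmp Y (fob F (s y)) y (fob F (s y)) (e' y) (e y) = one Y (fob F (s y))"
    and ee' [simp]: "\<And>y. y \<in> obj Y \<Longrightarrow> cmp Y y (fob F (s y)) y (e y) (e' y) = one Y y"
    by metis
  have e'e_ext [simp]: "\<And>y z x. y \<in> obj Y \<Longrightarrow> z \<in> obj Y \<Longrightarrow> x \<in> arr Y z (fob F (s y)) \<Longrightarrow>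
      cmp Y z y (fob F (s y)) (e' y) (cmp Y z (fob F (s y)) y (e y) x) = x"
    and ee'_ext [simp]: "\<And>y z x. y \<in> obj Y \<Longrightarrow> z \<in> obj Y \<Longrightarrow> x \<in> arr Y z y \<Longrightarrow>
      cmp Y z (fob F (s y)) y (e y) (cmp Y z y (fob F (s y)) (e' y) x) = x"
    by (simp_all add: F.fob_in Y.cmp_one_left flip: Y.cmp_assoc)
  define pre where "pre a b = the_inv_into (arr X a b) (far F a b)" for a b
  have pre [simp]: "pre a b g \<in> arr X a b" "far F a b (pre a b g) = g"
    if "a \<in> obj X" "b \<in> obj X" "g \<in> arr Y (fob F a) (fob F b)" for a b g
    using bij[OF that(1,2)] that(3) unfolding pre_def bij_betw_def
    by (auto intro: the_inv_into_into f_the_inv_into_f)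
  have faithful: "f = g" if "far F a b f = far F a b g" "a \<in> obj X" "b \<in> obj X" "f \<in> arr X a b" "g \<in> arr X a b"
    for a b f g
    using bij[OF that(2,3)] that unfolding bij_betw_def inj_on_def by blast
  define S where "S = restrict_ftr Y \<lparr>fob = s, far = (\<lambda>y z k. pre (s y) (s z)
      (cmp Y (fob F (s y)) z (fob F (s z)) (e' z) (cmp Y (fob F (s y)) y z k (e y))))\<rparr>"
  define \<eta> where "\<eta> = (\<lambda>a \<in> obj X. pre a (s (fob F a)) (e' (fob F a)))"
  define \<epsilon> where "\<epsilon> = restrict e (obj Y)"
  note [simp] = F.fob_in F.far_in F.far_one F.far_cmp X.cmp_in Y.cmp_in X.one_in Y.one_in
    X.cmp_one_left X.cmp_one_right Y.cmp_one_left Y.cmp_one_right X.cmp_assoc Y.cmp_assoc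
  have Sob [simp]: "fob S y = s y" if "y \<in> obj Y" for y
    using that by (simp add: S_def)
  have Sar [simp]: "far S y z k \<in> arr X (s y) (s z)"
    "far F (s y) (s z) (far S y z k) =
      cmp Y (fob F (s y)) z (fob F (s z)) (e' z) (cmp Y (fob F (s y)) y z k (e y))"
    if "y \<in> obj Y" "z \<in> obj Y" "k \<in> arr Y y z" for y z k
    using that by (simp_all add: S_def)
  have S: "cat_functor Y X S"
  proof (unfold_locales, goal_cases)
    case (3 y)
    then show ?case by (intro faithful[of "s y" "s y" "far S y y (one Y y)"]) simp_all
  next
    case (4 y z w k l)
    then show ?case by (intro faithful[of "s y" "s w" "far S y w (cmp Y y z w l k)"]) simp_all
  qed simp_all
  have \<eta> [simp]: "\<eta> a \<in> arr X a (s (fob F a))" "far F a (s (fob F a)) (\<eta> a) = e' (fob F a)"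
    if "a \<in> obj X" for a
    using that by (simp_all add: \<eta>_def)
  have SF: "cat_functor X X (restrict_ftr X (comp_ftr S F))" "cat_functor Y Y (restrict_ftr Y (comp_ftr F S))"
    using cats F(1) S by (simp_all add: cat_functor_comp)
  have "is_iso (functor_cat X X) (restrict_ftr X id_ftr) (restrict_ftr X (comp_ftr S F)) \<eta>"
  proof (rule is_iso_functor_cat)
    show "nat_trans X X (restrict_ftr X id_ftr) (restrict_ftr X (comp_ftr S F)) \<eta>"
    proof (unfold_locales, goal_cases)
      case (2 a b f)
      have "cmp X a (s (fob F a)) (s (fob F b)) (far S (fob F a) (fob F b) (far F a b f)) (\<eta> a) =
          cmp X a b (s (fob F b)) (\<eta> b) f"
        by (rule faithful[of a "s (fob F b)"]) (use 2 in simp_all)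
      with 2 show ?case by (simp add: id_ftr_def comp_ftr_def)
    qed (simp add: id_ftr_def comp_ftr_def)
    fix a assume a: "a \<in> obj X"
    have "cmp X a (s (fob F a)) a (pre (s (fob F a)) a (e (fob F a))) (\<eta> a) = one X a"
      "cmp X (s (fob F a)) a (s (fob F a)) (\<eta> a) (pre (s (fob F a)) a (e (fob F a))) = one X (s (fob F a))"
      by (rule faithful[of a a] faithful[of "s (fob F a)" "s (fob F a)"]; use a in simp)+
    with a show "is_iso X (fob (restrict_ftr X id_ftr) a) (fob (restrict_ftr X (comp_ftr S F)) a) (\<eta> a)"
      by (auto simp: is_iso_def id_ftr_def comp_ftr_def intro!: bexI[of _ "pre (s (fob F a)) a (e (fob F a))"])
  qed (use cats SF in \<open>simp_all add: cat_functor_id \<eta>_def\<close>)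
  moreover have "is_iso (functor_cat Y Y) (restrict_ftr Y (comp_ftr F S)) (restrict_ftr Y id_ftr) \<epsilon>"
  proof (rule is_iso_functor_cat)
    show "nat_trans Y Y (restrict_ftr Y (comp_ftr F S)) (restrict_ftr Y id_ftr) \<epsilon>"
      by unfold_locales (auto simp: id_ftr_def comp_ftr_def \<epsilon>_def)
    fix y assume y: "y \<in> obj Y"
    then show "is_iso Y (fob (restrict_ftr Y (comp_ftr F S)) y) (fob (restrict_ftr Y id_ftr) y) (\<epsilon> y)"
      by (auto simp: is_iso_def id_ftr_def comp_ftr_def \<epsilon>_def intro!: bexI[of _ "e' y"])
  qed (use cats SF in \<open>simp_all add: cat_functor_id \<epsilon>_def\<close>)
  moreover have "cmp X (s y) (s (fob F (s y))) (s y) (far S (fob F (s y)) y (e y)) (\<eta> (s y)) = one X (s y)"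
    if "y \<in> obj Y" for y
    by (rule faithful[of "s y" "s y"]) (use that in simp_all)
  moreover have "restrict_ftr Y S = S"
    by (simp add: S_def)
  moreover have "far S (fob F (s y)) (fob F (s y)) (one Y (fob F (s y))) = one X (s (fob F (s y)))"
    "far S y y (one Y y) = one X (s y)" if "y \<in> obj Y" for y
    using cat_functor.far_one[OF S] that by simp_all
  ultimately have "adjoint_equivalence CAT X Y \<lparr>fwd = F, bwd = S, unt = \<eta>, cou = \<epsilon>\<rparr>"
    using cats F S
    by unfold_locales
      (auto simp: CAT_simps functor_cat_simps comp_ftr_def id_ftr_def \<epsilon>_def intro!: restrict_ext)
  then show ?thesis
    by (intro exI[of _ "\<lparr>fwd = F, bwd = S, unt = \<eta>, cou = \<epsilon>\<rparr>"]) simp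
qed

text \<open>
  Naturality of \<open>\<eta>\<close> recovers \<open>f\<close> from \<open>G (F f)\<close>, so \<open>F\<close> is faithful, and likewise \<open>G\<close> by \<open>\<epsilon>\<close>. Given \<open>g : F a \<rightarrow> F b\<close>,
  the arrow \<open>f = i (G g) \<eta>\<close>, with \<open>i\<close> inverse to \<open>\<eta>\<close>, satisfies \<open>G (F f) = G g\<close>, hence \<open>F f = g\<close>.
\<close>

lemma weak_equivalence_of_isos:
  assumes cats: "category X" "category Y" and "cat_functor X Y F" "cat_functor Y X G"
    and \<eta>: "is_iso (functor_cat X X) (restrict_ftr X id_ftr) (restrict_ftr X (comp_ftr G F)) \<eta>"
    and \<epsilon>: "is_iso (functor_cat Y Y) (restrict_ftr Y (comp_ftr F G)) (restrict_ftr Y id_ftr) \<epsilon>"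
  shows "weak_equivalence X Y F"
proof -
  interpret X: category X by fact
  interpret Y: category Y by fact
  interpret F: cat_functor X Y F by fact
  interpret G: cat_functor Y X G by fact
  have \<eta>_iso: "is_iso X a (fob G (fob F a)) (\<eta> a)" if "a \<in> obj X" for a
    using functor_cat_is_isoD[OF \<eta> that] that by (simp add: id_ftr_def comp_ftr_def)
  have \<epsilon>_iso: "is_iso Y (fob F (fob G y)) y (\<epsilon> y)" if "y \<in> obj Y" for y
    using functor_cat_is_isoD[OF \<epsilon> that] that by (simp add: id_ftr_def comp_ftr_def)
  interpret \<eta>: nat_trans X X "restrict_ftr X id_ftr" "restrict_ftr X (comp_ftr G F)" \<eta>
    using is_iso_arr[OF \<eta>] by (simp add: functor_cat_simps)
  interpret \<epsilon>: nat_trans Y Y "restrict_ftr Y (comp_ftr F G)" "restrict_ftr Y id_ftr" \<epsilon>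
    using is_iso_arr[OF \<epsilon>] by (simp add: functor_cat_simps)
  have \<eta>_nat: "cmp X a (fob G (fob F a)) (fob G (fob F b)) (far G (fob F a) (fob F b) (far F a b f)) (\<eta> a) =
      cmp X a b (fob G (fob F b)) (\<eta> b) f" if "a \<in> obj X" "b \<in> obj X" "f \<in> arr X a b" for a b f
    using \<eta>.naturality[OF that] that by (simp add: id_ftr_def comp_ftr_def)
  have \<epsilon>_nat: "cmp Y (fob F (fob G a)) a b f (\<epsilon> a) =
      cmp Y (fob F (fob G a)) (fob F (fob G b)) b (\<epsilon> b) (far F (fob G a) (fob G b) (far G a b f))"
    if "a \<in> obj Y" "b \<in> obj Y" "f \<in> arr Y a b" for a b f
    using \<epsilon>.naturality[OF that] that by (simp add: id_ftr_def comp_ftr_def)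
  note [simp] = F.fob_in F.far_in G.fob_in G.far_in X.cmp_in Y.cmp_in X.one_in Y.one_in
    X.cmp_one_left X.cmp_one_right Y.cmp_one_left Y.cmp_one_right X.cmp_assoc Y.cmp_assoc
  have F_faithful: "f = g" if fg: "a \<in> obj X" "b \<in> obj X" "f \<in> arr X a b" "g \<in> arr X a b" "far F a b f = far F a b g"
    for a b f g
  proof -
    obtain i where i: "i \<in> arr X (fob G (fob F b)) b" "cmp X b (fob G (fob F b)) b i (\<eta> b) = one X b"
      "\<eta> b \<in> arr X b (fob G (fob F b))"
      using \<eta>_iso[OF fg(2)] unfolding is_iso_def by blast
    have "cmp X a b (fob G (fob F b)) (\<eta> b) f = cmp X a b (fob G (fob F b)) (\<eta> b) g"
      using fg by (simp flip: \<eta>_nat)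
    then have "cmp X a (fob G (fob F b)) b i (cmp X a b (fob G (fob F b)) (\<eta> b) f) =
        cmp X a (fob G (fob F b)) b i (cmp X a b (fob G (fob F b)) (\<eta> b) g)"
      by simp
    then show ?thesis
      using i fg by (simp del: X.cmp_assoc flip: X.cmp_assoc)
  qed
  have G_faithful: "f = g" if fg: "a \<in> obj Y" "b \<in> obj Y" "f \<in> arr Y a b" "g \<in> arr Y a b" "far G a b f = far G a b g"
    for a b f g
  proof -
    obtain i where i: "i \<in> arr Y a (fob F (fob G a))" "cmp Y a (fob F (fob G a)) a (\<epsilon> a) i = one Y a"
      "\<epsilon> a \<in> arr Y (fob F (fob G a)) a"
      using \<epsilon>_iso[OF fg(1)] unfolding is_iso_def by blast
    have "cmp Y (fob F (fob G a)) a b f (\<epsilon> a) = cmp Y (fob F (fob G a)) a b g (\<epsilon> a)"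
      using fg by (simp add: \<epsilon>_nat)
    then have "cmp Y a (fob F (fob G a)) b (cmp Y (fob F (fob G a)) a b f (\<epsilon> a)) i =
        cmp Y a (fob F (fob G a)) b (cmp Y (fob F (fob G a)) a b g (\<epsilon> a)) i"
      by simp
    then show ?thesis
      using i fg by simp
  qed
  have full: "\<exists>f \<in> arr X a b. far F a b f = g"
    if ab: "a \<in> obj X" "b \<in> obj X" and g: "g \<in> arr Y (fob F a) (fob F b)" for a b g
  proof -
    let ?GFa = "fob G (fob F a)" and ?GFb = "fob G (fob F b)"
    obtain i where i: "i \<in> arr X ?GFb b" "cmp X ?GFb b ?GFb (\<eta> b) i = one X ?GFb" "\<eta> b \<in> arr X b ?GFb"
      using \<eta>_iso[OF ab(2)] unfolding is_iso_def by blast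
    obtain j where j: "j \<in> arr X ?GFa a" "cmp X ?GFa a ?GFa (\<eta> a) j = one X ?GFa" "\<eta> a \<in> arr X a ?GFa"
      using \<eta>_iso[OF ab(1)] unfolding is_iso_def by blast
    define f where "f = cmp X a ?GFb b i (cmp X a ?GFa ?GFb (far G (fob F a) (fob F b) g) (\<eta> a))"
    have f: "f \<in> arr X a b"
      using ab g i j by (simp add: f_def)
    have "cmp X a ?GFa ?GFb (far G (fob F a) (fob F b) (far F a b f)) (\<eta> a) =
        cmp X a ?GFb ?GFb (cmp X ?GFb b ?GFb (\<eta> b) i) (cmp X a ?GFa ?GFb (far G (fob F a) (fob F b) g) (\<eta> a))"
      using ab g i(1,3) j f by (simp add: \<eta>_nat f_def)
    then have "cmp X a ?GFa ?GFb (far G (fob F a) (fob F b) (far F a b f)) (\<eta> a) =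
        cmp X a ?GFa ?GFb (far G (fob F a) (fob F b) g) (\<eta> a)"
      using ab g i j by simp
    then have "cmp X ?GFa a ?GFb (cmp X a ?GFa ?GFb (far G (fob F a) (fob F b) (far F a b f)) (\<eta> a)) j =
        cmp X ?GFa a ?GFb (cmp X a ?GFa ?GFb (far G (fob F a) (fob F b) g) (\<eta> a)) j"
      by simp
    then have "far G (fob F a) (fob F b) (far F a b f) = far G (fob F a) (fob F b) g"
      using ab g j f by simp
    then show ?thesis
      using ab f g by (intro bexI[of _ f] G_faithful) simp_all
  qed
  show ?thesis
    unfolding weak_equivalence_def bij_betw_def inj_on_def
  proof (intro conjI ballI impI)
    fix y assume "y \<in> obj Y"
    then show "\<exists>a\<in>obj X. \<exists>k. is_iso Y (fob F a) y k"
      using \<epsilon>_iso G.fob_in by blast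
  next
    fix a b assume "a \<in> obj X" "b \<in> obj X"
    then show "far F a b ` arr X a b = arr Y (fob F a) (fob F b)"
      using full by (auto simp: image_iff) metis
  qed (use F_faithful in blast)
qed

text \<open>
  On arrows, \<open>Q\<close> is \<open>F\<close> followed by conjugation with the isomorphisms \<open>k\<close>.
\<close>

lemma weak_equivalence_transport:
  assumes "category Y" and F: "\<And>a. a \<in> obj X \<Longrightarrow> fob F a \<in> obj Y"
     "\<And>a b f. a \<in> obj X \<Longrightarrow> b \<in> obj X \<Longrightarrow> f \<in> arr X a b \<Longrightarrow> far F a b f \<in> arr Y (fob F a) (fob F b)"
    and Q: "\<And>a. a \<in> obj X \<Longrightarrow> fob Q a \<in> obj Y"
     "\<And>a b f. a \<in> obj X \<Longrightarrow> b \<in> obj X \<Longrightarrow> f \<in> arr X a b \<Longrightarrow> far Q a b f \<in> arr Y (fob Q a) (fob Q b)"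
    and iso: "\<And>a. a \<in> obj X \<Longrightarrow> is_iso Y (fob Q a) (fob F a) (k a)"
    and nat: "\<And>a b f. a \<in> obj X \<Longrightarrow> b \<in> obj X \<Longrightarrow> f \<in> arr X a b \<Longrightarrow>
      cmp Y (fob Q a) (fob F a) (fob F b) (far F a b f) (k a) =
      cmp Y (fob Q a) (fob Q b) (fob F b) (k b) (far Q a b f)"
    and w: "weak_equivalence X Y F"
  shows "weak_equivalence X Y Q"
proof -
  interpret Y: category Y by fact
  note [simp] = F Q Y.cmp_in Y.cmp_assoc Y.cmp_one_left Y.cmp_one_right
  obtain l where k [simp]: "\<And>a. a \<in> obj X \<Longrightarrow> k a \<in> arr Y (fob Q a) (fob F a)"
    and l [simp]: "\<And>a. a \<in> obj X \<Longrightarrow> l a \<in> arr Y (fob F a) (fob Q a)"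
    and lk [simp]: "\<And>a. a \<in> obj X \<Longrightarrow> cmp Y (fob Q a) (fob F a) (fob Q a) (l a) (k a) = one Y (fob Q a)"
    and kl [simp]: "\<And>a. a \<in> obj X \<Longrightarrow> cmp Y (fob F a) (fob Q a) (fob F a) (k a) (l a) = one Y (fob F a)"
    using iso unfolding is_iso_def by metis
  have lk_ext [simp]: "cmp Y y (fob F a) (fob Q a) (l a) (cmp Y y (fob Q a) (fob F a) (k a) x) = x"
    if "a \<in> obj X" "y \<in> obj Y" "x \<in> arr Y y (fob Q a)" for a y x
    using that by (simp del: Y.cmp_assoc flip: Y.cmp_assoc)
  have kl_ext [simp]: "cmp Y y (fob Q a) (fob F a) (k a) (cmp Y y (fob F a) (fob Q a) (l a) x) = x"
    if "a \<in> obj X" "y \<in> obj Y" "x \<in> arr Y y (fob F a)" for a y x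
    using that by (simp del: Y.cmp_assoc flip: Y.cmp_assoc)
  show ?thesis
    unfolding weak_equivalence_def
  proof (intro conjI ballI)
    fix a b assume ab: "a \<in> obj X" "b \<in> obj X"
    let ?c = "\<lambda>g. cmp Y (fob Q a) (fob F b) (fob Q b) (l b) (cmp Y (fob Q a) (fob F a) (fob F b) g (k a))"
    have "bij_betw (far F a b) (arr X a b) (arr Y (fob F a) (fob F b))"
      using w ab unfolding weak_equivalence_def by blast
    moreover have "bij_betw ?c (arr Y (fob F a) (fob F b)) (arr Y (fob Q a) (fob Q b))"
      by (rule bij_betw_byWitness[where f' = "\<lambda>g. cmp Y (fob F a) (fob Q b) (fob F b) (k b)
          (cmp Y (fob F a) (fob Q a) (fob Q b) g (l a))"]) (use ab in auto)
    ultimately have "bij_betw (?c \<circ> far F a b) (arr X a b) (arr Y (fob Q a) (fob Q b))"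
      by (rule bij_betw_trans)
    then show "bij_betw (far Q a b) (arr X a b) (arr Y (fob Q a) (fob Q b))"
      by (rule bij_betw_cong[THEN iffD1, rotated]) (use ab in \<open>simp add: nat\<close>)
  next
    fix y assume y: "y \<in> obj Y"
    then obtain a i j where a: "a \<in> obj X" "i \<in> arr Y (fob F a) y" "j \<in> arr Y y (fob F a)"
      "cmp Y (fob F a) y (fob F a) j i = one Y (fob F a)" "cmp Y y (fob F a) y i j = one Y y"
      using w unfolding weak_equivalence_def is_iso_def by meson
    have ji: "cmp Y (fob Q a) y (fob F a) j (cmp Y (fob Q a) (fob F a) y i (k a)) = k a"
      using a y by (simp del: Y.cmp_assoc flip: Y.cmp_assoc)
    have "is_iso Y (fob Q a) y (cmp Y (fob Q a) (fob F a) y i (k a))"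
      unfolding is_iso_def
      by (intro conjI bexI[of _ "cmp Y y (fob F a) (fob Q a) (l a) j"]) (use a y ji in simp_all)
    with a show "\<exists>a\<in>obj X. \<exists>k. is_iso Y (fob Q a) y k" by blast
  qed
qed

text \<open>The unit and counit of an equivalence in \<open>Ps\<close> are natural isomorphisms at each object.\<close>

lemma Ps_equivalence_weak:
  assumes "adjoint_equivalence (Ps K CAT) F G E"
  shows "pseudo_nat_trans K CAT F G (fwd E)"
    and "A \<in> Ob K \<Longrightarrow> weak_equivalence (pob F A) (pob G A) (tob (fwd E) A)"
proof -
  interpret adjoint_equivalence "Ps K CAT" F G E by fact
  have FG: "normal_pseudo_functor K CAT F" "normal_pseudo_functor K CAT G"
    using source_in target_in by (simp_all add: Ps_def)
  show p: "pseudo_nat_trans K CAT F G (fwd E)"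
    using fwd_in by (simp add: Ps_def pnt_cat_def)
  have q: "pseudo_nat_trans K CAT G F (bwd E)"
    using bwd_in by (simp add: Ps_def pnt_cat_def)
  assume A: "A \<in> Ob K"
  note c = normal_pseudo_functor.pob_in[OF FG(1) A] normal_pseudo_functor.pob_in[OF FG(2) A]
  have comp: "is_iso (functor_cat (pob H A) (pob H A)) (tob \<rho> A) (tob \<sigma> A) (\<Gamma> A)"
    if i: "is_iso (pnt_cat K CAT H H) \<rho> \<sigma> \<Gamma>" for H \<rho> \<sigma> \<Gamma>
  proof -
    obtain \<Delta> where "modification K CAT H H \<rho> \<sigma> \<Gamma>" "modification K CAT H H \<sigma> \<rho> \<Delta>"
      "cmp (pnt_cat K CAT H H) \<rho> \<sigma> \<rho> \<Delta> \<Gamma> = one (pnt_cat K CAT H H) \<rho>"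
      "cmp (pnt_cat K CAT H H) \<sigma> \<rho> \<sigma> \<Gamma> \<Delta> = one (pnt_cat K CAT H H) \<sigma>"
      using i unfolding is_iso_def by (auto simp: pnt_cat_def)
    then show ?thesis
      using A unfolding is_iso_def
      by (intro conjI bexI[of _ "\<Delta> A"])
        (auto simp: pnt_cat_def CAT_simps dest: modification.component_in dest!: fun_cong[of _ _ A])
  qed
  have u: "is_iso (pnt_cat K CAT F F) (id_pnt K CAT F) (comp_pnt K CAT F G F (bwd E) (fwd E)) (unt E)"
    and v: "is_iso (pnt_cat K CAT G G) (comp_pnt K CAT G F G (fwd E) (bwd E)) (id_pnt K CAT G) (cou E)"
    using unt_iso cou_iso by (simp_all add: Ps_def)
  have t: "tob (id_pnt K CAT H) A = restrict_ftr (pob H A) id_ftr"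
    "tob (comp_pnt K CAT H H' H \<sigma> \<rho>) A = restrict_ftr (pob H A) (comp_ftr (tob \<sigma> A) (tob \<rho> A))" for H H' \<sigma> \<rho>
    using A by (simp_all add: id_pnt_def comp_pnt_def restrict_pnt_def CAT_simps)
  show "weak_equivalence (pob F A) (pob G A) (tob (fwd E) A)"
  proof (rule weak_equivalence_of_isos)
    show "cat_functor (pob F A) (pob G A) (tob (fwd E) A)" "cat_functor (pob G A) (pob F A) (tob (bwd E) A)"
      using pseudo_nat_trans.tob_in[OF p A] pseudo_nat_trans.tob_in[OF q A]
      by (simp_all add: CAT_simps functor_cat_simps)
    show "is_iso (functor_cat (pob F A) (pob F A)) (restrict_ftr (pob F A) id_ftr)
        (restrict_ftr (pob F A) (comp_ftr (tob (bwd E) A) (tob (fwd E) A))) (unt E A)"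
      using comp[OF u] by (simp add: t)
    show "is_iso (functor_cat (pob G A) (pob G A))
        (restrict_ftr (pob G A) (comp_ftr (tob (fwd E) A) (tob (bwd E) A)))
        (restrict_ftr (pob G A) id_ftr) (cou E A)"
      using comp[OF v] by (simp add: t)
  qed (use c in \<open>simp_all add: CAT_simps\<close>)
qed

text \<open>Combines the adjoint inverses of the components with the passage from pointwise adjoint equivalences to
  adjoint equivalences in \<open>Ps\<close>.\<close>

lemma weak_equivalence_Ps:
  assumes "two_category K" and FG: "normal_pseudo_functor K CAT F" "normal_pseudo_functor K CAT G"
    and \<rho>: "pseudo_nat_trans K CAT F G \<rho>"
    and w: "\<And>A. A \<in> Ob K \<Longrightarrow> weak_equivalence (pob F A) (pob G A) (tob \<rho> A)"
  shows "\<exists>E. adjoint_equivalence (Ps K CAT) F G E"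
proof -
  have "\<exists>E. adjoint_equivalence CAT (pob F A) (pob G A) E \<and> fwd E = tob \<rho> A" if A: "A \<in> Ob K" for A
    by (rule weak_equivalence_adjoint)
      (use w[OF A] pseudo_nat_trans.tob_in[OF \<rho> A] normal_pseudo_functor.pob_in[OF FG(1) A]
        normal_pseudo_functor.pob_in[OF FG(2) A] in \<open>simp_all add: CAT_simps functor_cat_simps\<close>)
  then obtain e where "\<And>A. A \<in> Ob K \<Longrightarrow> adjoint_equivalence CAT (pob F A) (pob G A) (e A) \<and> fwd (e A) = tob \<rho> A"
    by metis
  moreover have "pnt K CAT F G \<rho>"
    using assms two_category_CAT by (simp add: pnt_def psf_def two_cat_def)
  ultimately have "pointwise_adj K CAT F G \<rho> e"
    by (simp add: pointwise_adj_def pointwise_adj_axioms_def)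
  then show ?thesis
    by (blast dest: pointwise_adj.adjoint_equivalence_Ps)
qed

section \<open>Pseudo-natural transformations between CAT-valued pseudo-functors\<close>

text \<open>Cells of \<open>CAT\<close> are families of arrows, and a whiskering with an identity 2-morphism evaluates to a
  single arrow. The lemmas of this section evaluate the axioms at an object \<open>x\<close> once and for all.\<close>

locale CAT_pair = F: psf K CAT F + G: psf K CAT G
  for K :: "('o, 'a, 'x) twocat" and F G :: "('o, 'a, 'x, ('b, 'y) cat, ('b, 'y, 'b, 'y) ftr, 'b \<Rightarrow> 'y) psf"
begin

lemma cats: "A \<in> Ob K \<Longrightarrow> category (pob F A)" "A \<in> Ob K \<Longrightarrow> category (pob G A)"
  using F.pob_in G.pob_in by (auto simp: CAT_simps)

lemma map1_functor:
  assumes "A \<in> Ob K" "B \<in> Ob K" "f \<in> obj (Hom K A B)"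
  shows "cat_functor (pob F A) (pob F B) (map1 F A B f)" "cat_functor (pob G A) (pob G B) (map1 G A B f)"
  using cat_functor.fob_in[OF F.phom_functor, of A B f] cat_functor.fob_in[OF G.phom_functor, of A B f] assms
  by (simp_all add: CAT_simps functor_cat_simps)

lemma map2_nat_trans:
  assumes "A \<in> Ob K" "B \<in> Ob K" "f \<in> obj (Hom K A B)" "f' \<in> obj (Hom K A B)" "\<alpha> \<in> arr (Hom K A B) f f'"
  shows "nat_trans (pob F A) (pob F B) (map1 F A B f) (map1 F A B f') (map2 F A B f f' \<alpha>)"
    "nat_trans (pob G A) (pob G B) (map1 G A B f) (map1 G A B f') (map2 G A B f f' \<alpha>)"
  using cat_functor.far_in[OF F.phom_functor, of A B f f' \<alpha>] cat_functor.far_in[OF G.phom_functor, of A B f f' \<alpha>] assms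
  by (simp_all add: CAT_simps functor_cat_simps)

lemma pcomp_nat_trans:
  assumes "A \<in> Ob K" "B \<in> Ob K" "C \<in> Ob K" "f \<in> obj (Hom K A B)" "g \<in> obj (Hom K B C)" "x \<in> obj (pob F A)"
  shows "pcomp F A B C g f x \<in> arr (pob F C) (fob (map1 F B C g) (fob (map1 F A B f) x))
      (fob (map1 F A C (comp1 K A B C g f)) x)"
  using nat_trans.component_in[of "pob F A" "pob F C" _ _ "pcomp F A B C g f" x]
    is_iso_arr[OF F.pcomp_iso[OF assms(1-5)]] assms(6)
  by (simp add: CAT_simps functor_cat_simps) (fastforce simp: comp_ftr_def)

lemma pcomp_nat_trans':
  assumes "A \<in> Ob K" "B \<in> Ob K" "C \<in> Ob K" "f \<in> obj (Hom K A B)" "g \<in> obj (Hom K B C)" "x \<in> obj (pob G A)"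
  shows "pcomp G A B C g f x \<in> arr (pob G C) (fob (map1 G B C g) (fob (map1 G A B f) x))
      (fob (map1 G A C (comp1 K A B C g f)) x)"
  using nat_trans.component_in[of "pob G A" "pob G C" _ _ "pcomp G A B C g f" x]
    is_iso_arr[OF G.pcomp_iso[OF assms(1-5)]] assms(6)
  by (simp add: CAT_simps functor_cat_simps) (fastforce simp: comp_ftr_def)

lemma pnt_component_iso:
  assumes \<rho>: "pseudo_nat_trans K CAT F G \<rho>" and *: "A \<in> Ob K" "B \<in> Ob K" "f \<in> obj (Hom K A B)"
    and x: "x \<in> obj (pob F A)"
  shows "is_iso (pob G B) (fob (map1 G A B f) (fob (tob \<rho> A) x)) (fob (tob \<rho> B) (fob (map1 F A B f) x))
     (tcell \<rho> A B f x)"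
  using functor_cat_is_isoD[OF pseudo_nat_trans.tcell_iso[OF \<rho> *, unfolded CAT_simps(2)] x] x
  by (simp add: CAT_simps comp_ftr_def)

lemma pnt_component_natural:
  assumes \<rho>: "pseudo_nat_trans K CAT F G \<rho>" and *: "A \<in> Ob K" "B \<in> Ob K" "f \<in> obj (Hom K A B)"
    and **: "f' \<in> obj (Hom K A B)" "\<alpha> \<in> arr (Hom K A B) f f'"
    and x: "x \<in> obj (pob F A)"
  shows "cmp (pob G B) (fob (map1 G A B f) (fob (tob \<rho> A) x)) (fob (map1 G A B f') (fob (tob \<rho> A) x))
      (fob (tob \<rho> B) (fob (map1 F A B f') x)) (tcell \<rho> A B f' x) (map2 G A B f f' \<alpha> (fob (tob \<rho> A) x)) =
    cmp (pob G B) (fob (map1 G A B f) (fob (tob \<rho> A) x)) (fob (tob \<rho> B) (fob (map1 F A B f) x))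
      (fob (tob \<rho> B) (fob (map1 F A B f') x))
      (far (tob \<rho> B) (fob (map1 F A B f) x) (fob (map1 F A B f') x) (map2 F A B f f' \<alpha> x)) (tcell \<rho> A B f x)"
proof -
  have "cat_functor (pob F A) (pob G A) (tob \<rho> A)" "cat_functor (pob F B) (pob G B) (tob \<rho> B)"
    using pseudo_nat_trans.tob_in[OF \<rho>] * by (simp_all add: CAT_simps functor_cat_simps)
  then interpret \<rho>A: cat_functor "pob F A" "pob G A" "tob \<rho> A" + \<rho>B: cat_functor "pob F B" "pob G B" "tob \<rho> B"
    by simp_all
  interpret Ff: cat_functor "pob F A" "pob F B" "map1 F A B f" using * by (rule map1_functor)
  interpret Ff': cat_functor "pob F A" "pob F B" "map1 F A B f'" using * ** by (intro map1_functor)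
  interpret Gf: cat_functor "pob G A" "pob G B" "map1 G A B f" using * by (intro map1_functor)
  interpret Gf': cat_functor "pob G A" "pob G B" "map1 G A B f'" using * ** by (intro map1_functor)
  interpret F\<alpha>: nat_trans "pob F A" "pob F B" "map1 F A B f" "map1 F A B f'" "map2 F A B f f' \<alpha>"
    using * ** by (intro map2_nat_trans)
  interpret G\<alpha>: nat_trans "pob G A" "pob G B" "map1 G A B f" "map1 G A B f'" "map2 G A B f f' \<alpha>"
    using * ** by (intro map2_nat_trans)
  show ?thesis
    using fun_cong[OF pseudo_nat_trans.tcell_natural[OF \<rho> * **], of x] x *
    by (simp add: CAT_simps functor_cat_simps comp_ftr_def \<rho>A.fob_in \<rho>B.fob_in Ff.fob_in Ff'.fob_in Gf.fob_in
        Gf'.fob_in Gf.far_one \<rho>B.far_in F\<alpha>.component_in G\<alpha>.component_in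
        category.cmp_one_left[OF cats(2)] category.cmp_one_right[OF cats(2)] category.one_in[OF cats(2)])
qed

lemma CAT_pntI:
  assumes ob: "\<And>A. A \<in> Ob K \<Longrightarrow> cat_functor (pob F A) (pob G A) (tob \<rho> A)"
      "\<And>A. A \<in> Ob K \<Longrightarrow> restrict_ftr (pob F A) (tob \<rho> A) = tob \<rho> A"
    and ext: "\<And>A B f. \<lbrakk>A \<in> Ob K; B \<in> Ob K; f \<in> obj (Hom K A B)\<rbrakk> \<Longrightarrow>
      tcell \<rho> A B f \<in> extensional (obj (pob F A))"
    and iso: "\<And>A B f x. \<lbrakk>A \<in> Ob K; B \<in> Ob K; f \<in> obj (Hom K A B); x \<in> obj (pob F A)\<rbrakk> \<Longrightarrow>
      is_iso (pob G B) (fob (map1 G A B f) (fob (tob \<rho> A) x)) (fob (tob \<rho> B) (fob (map1 F A B f) x))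
        (tcell \<rho> A B f x)"
    and nat: "\<And>A B f x y t. \<lbrakk>A \<in> Ob K; B \<in> Ob K; f \<in> obj (Hom K A B); x \<in> obj (pob F A); y \<in> obj (pob F A);
        t \<in> arr (pob F A) x y\<rbrakk> \<Longrightarrow>
      cmp (pob G B) (fob (map1 G A B f) (fob (tob \<rho> A) x)) (fob (tob \<rho> B) (fob (map1 F A B f) x))
        (fob (tob \<rho> B) (fob (map1 F A B f) y))
        (far (tob \<rho> B) (fob (map1 F A B f) x) (fob (map1 F A B f) y) (far (map1 F A B f) x y t))
        (tcell \<rho> A B f x) =
      cmp (pob G B) (fob (map1 G A B f) (fob (tob \<rho> A) x)) (fob (map1 G A B f) (fob (tob \<rho> A) y))
        (fob (tob \<rho> B) (fob (map1 F A B f) y)) (tcell \<rho> A B f y)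
        (far (map1 G A B f) (fob (tob \<rho> A) x) (fob (tob \<rho> A) y) (far (tob \<rho> A) x y t))"
    and nat2: "\<And>A B f f' \<alpha> x. \<lbrakk>A \<in> Ob K; B \<in> Ob K; f \<in> obj (Hom K A B); f' \<in> obj (Hom K A B);
        \<alpha> \<in> arr (Hom K A B) f f'; x \<in> obj (pob F A)\<rbrakk> \<Longrightarrow>
      cmp (pob G B) (fob (map1 G A B f) (fob (tob \<rho> A) x)) (fob (map1 G A B f') (fob (tob \<rho> A) x))
        (fob (tob \<rho> B) (fob (map1 F A B f') x)) (tcell \<rho> A B f' x) (map2 G A B f f' \<alpha> (fob (tob \<rho> A) x)) =
      cmp (pob G B) (fob (map1 G A B f) (fob (tob \<rho> A) x)) (fob (tob \<rho> B) (fob (map1 F A B f) x))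
        (fob (tob \<rho> B) (fob (map1 F A B f') x))
        (far (tob \<rho> B) (fob (map1 F A B f) x) (fob (map1 F A B f') x) (map2 F A B f f' \<alpha> x)) (tcell \<rho> A B f x)"
    and id: "\<And>A x. \<lbrakk>A \<in> Ob K; x \<in> obj (pob F A)\<rbrakk> \<Longrightarrow>
      tcell \<rho> A A (Id K A) x = one (pob G A) (fob (tob \<rho> A) x)"
    and comp: "\<And>A B C f g x. \<lbrakk>A \<in> Ob K; B \<in> Ob K; C \<in> Ob K; f \<in> obj (Hom K A B); g \<in> obj (Hom K B C);
        x \<in> obj (pob F A)\<rbrakk> \<Longrightarrow>
      cmp (pob G C) (fob (map1 G B C g) (fob (map1 G A B f) (fob (tob \<rho> A) x)))
        (fob (map1 G A C (comp1 K A B C g f)) (fob (tob \<rho> A) x))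
        (fob (tob \<rho> C) (fob (map1 F A C (comp1 K A B C g f)) x))
        (tcell \<rho> A C (comp1 K A B C g f) x) (pcomp G A B C g f (fob (tob \<rho> A) x)) =
      cmp (pob G C) (fob (map1 G B C g) (fob (map1 G A B f) (fob (tob \<rho> A) x)))
        (fob (tob \<rho> C) (fob (map1 F B C g) (fob (map1 F A B f) x)))
        (fob (tob \<rho> C) (fob (map1 F A C (comp1 K A B C g f)) x))
        (far (tob \<rho> C) (fob (map1 F B C g) (fob (map1 F A B f) x)) (fob (map1 F A C (comp1 K A B C g f)) x)
          (pcomp F A B C g f x))
        (cmp (pob G C) (fob (map1 G B C g) (fob (map1 G A B f) (fob (tob \<rho> A) x)))
          (fob (map1 G B C g) (fob (tob \<rho> B) (fob (map1 F A B f) x)))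
          (fob (tob \<rho> C) (fob (map1 F B C g) (fob (map1 F A B f) x)))
          (tcell \<rho> B C g (fob (map1 F A B f) x))
          (far (map1 G B C g) (fob (map1 G A B f) (fob (tob \<rho> A) x)) (fob (tob \<rho> B) (fob (map1 F A B f) x))
            (tcell \<rho> A B f x)))"
  shows "pseudo_nat_trans K CAT F G \<rho>"
proof -
  note [simp] = cat_functor.fob_in[OF ob(1)] cat_functor.far_in[OF ob(1)] cat_functor.far_one[OF ob(1)]
    cat_functor.fob_in[OF map1_functor(1)] cat_functor.fob_in[OF map1_functor(2)]
    cat_functor.far_in[OF map1_functor(1)] cat_functor.far_in[OF map1_functor(2)]
    cat_functor.far_one[OF map1_functor(1)] cat_functor.far_one[OF map1_functor(2)]
    category.cmp_one_left[OF cats(2)] category.cmp_one_right[OF cats(2)] category.one_in[OF cats(2)]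
    category.cmp_one_left[OF cats(1)] category.cmp_one_right[OF cats(1)] category.one_in[OF cats(1)]
    category.cmp_in[OF cats(2)] is_iso_arr[OF iso] F.K.comp1_in
    nat_trans.component_in[OF map2_nat_trans(1)] nat_trans.component_in[OF map2_nat_trans(2)]
  show ?thesis
  proof (rule pseudo_nat_trans.intro, goal_cases)
    case (1 A)
    then show ?case using ob by (simp add: CAT_simps functor_cat_simps)
  next
    case (2 A B f)
    then show ?case
      unfolding CAT_simps
    proof (intro is_iso_functor_cat, goal_cases)
      case 5
      then show ?case
        by unfold_locales (simp_all add: comp_ftr_def nat)
    next
      case (7 x)
      then show ?case by (simp add: comp_ftr_def iso)
    qed (simp_all add: cats ext cat_functor_comp[OF ob(1) map1_functor(2)]
        cat_functor_comp[OF map1_functor(1) ob(1)])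
  next
    case (3 A B f f' \<alpha>)
    then show ?case
      unfolding CAT_simps functor_cat_simps
      by (intro restrict_ext) (simp add: comp_ftr_def nat2)
  next
    case (4 A)
    then show ?case
      using ext[OF 4 4 F.K.Id_in[OF 4]] id[OF 4]
      by (auto simp: CAT_simps functor_cat_simps extensional_def fun_eq_iff restrict_def)
  next
    case (5 A B C f g)
    then show ?case
      unfolding CAT_simps functor_cat_simps
      by (intro restrict_ext) (simp add: comp_ftr_def comp pcomp_nat_trans pcomp_nat_trans')
  qed
qed

end

lemma CAT_pairI:
  "two_category K \<Longrightarrow> normal_pseudo_functor K CAT F \<Longrightarrow> normal_pseudo_functor K CAT G \<Longrightarrow> CAT_pair K F G"
  by (simp add: CAT_pair_def psf_def two_cat_def two_category_CAT)

lemma psf_iff: "psf K M F \<longleftrightarrow> two_category K \<and> two_category M \<and> normal_pseudo_functor K M F"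
  by (simp add: psf_def two_cat_def)

lemma hom_from_fixed_normal:
  assumes "two_category C" "two_category D" "normal_pseudo_functor C D L" "Y \<in> Ob D"
  shows "normal_pseudo_functor (op2 C) CAT (hom_from_fixed C D L Y)"
  unfolding hom_from_fixed_def
  by (rule comp_psf_normal) (use assms in \<open>simp_all add: psf_iff two_category.two_category_op2 two_category_CAT
    op_psf_normal two_cat.repr_psf_normal two_cat_def\<close>)

lemma hom_from_normal:
  assumes "two_category C" "two_category D" "normal_pseudo_functor C D L"
  shows "normal_pseudo_functor (prod2 (op2 C) D) CAT (hom_from C D L)"
  unfolding hom_from_def
  by (rule comp_psf_normal) (use assms in \<open>simp_all add: psf_iff two_category.two_category_op2 two_category_CAT
    two_category_prod2 op_psf_normal prod_psf_normal id_psf_normal two_cat.hom_psf_normal two_cat_def\<close>)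

lemma hom_to_normal:
  assumes "two_category C" "two_category D" "normal_pseudo_functor D C R"
  shows "normal_pseudo_functor (prod2 (op2 C) D) CAT (hom_to C D R)"
  unfolding hom_to_def
  by (rule comp_psf_normal) (use assms in \<open>simp_all add: psf_iff two_category.two_category_op2 two_category_CAT
    two_category_prod2 op_psf_normal prod_psf_normal id_psf_normal two_cat.hom_psf_normal two_cat_def\<close>)

section \<open>Universal counits\<close>

text \<open>The hom-valued pseudo-functors are composites of general constructions. The lemmas up to the next definition
  reduce them to the expected formulas; in particular their compositors are whiskerings of those of \<open>L\<close> and \<open>R\<close>.\<close>

lemma hom_from_fixed_simps:
  "pob (hom_from_fixed C D L Y) X = Hom D (pob L X) Y"
  "map1 (hom_from_fixed C D L Y) X X' f = map1 (repr_psf D Y) (pob L X) (pob L X') (map1 L X' X f)"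
  "map2 (hom_from_fixed C D L Y) X X' f f' \<alpha> =
    map2 (repr_psf D Y) (pob L X) (pob L X') (map1 L X' X f) (map1 L X' X f') (map2 L X' X f f' \<alpha>)"
  by (simp_all add: hom_from_fixed_def comp_psf_def op_psf_def comp_ftr_def repr_psf_simps(1))

lemma hom_from_simps:
  "pob (hom_from C D L) P = Hom D (pob L (fst P)) (snd P)"
  "map1 (hom_from C D L) P Q u = map1 (hom_psf D) (pob L (fst P), snd P) (pob L (fst Q), snd Q)
     (map1 L (fst Q) (fst P) (fst u), snd u)"
  "map2 (hom_from C D L) P Q u v \<delta> = map2 (hom_psf D) (pob L (fst P), snd P) (pob L (fst Q), snd Q)
     (map1 L (fst Q) (fst P) (fst u), snd u) (map1 L (fst Q) (fst P) (fst v), snd v)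
     (map2 L (fst Q) (fst P) (fst u) (fst v) (fst \<delta>), snd \<delta>)"
  by (simp_all add: hom_from_def comp_psf_def op_psf_def comp_ftr_def id_psf_def id_ftr_def hom_psf_simps(1))

lemma hom_to_simps:
  "pob (hom_to C D R) P = Hom C (fst P) (pob R (snd P))"
  "map1 (hom_to C D R) P Q u = map1 (hom_psf C) (fst P, pob R (snd P)) (fst Q, pob R (snd Q))
     (fst u, map1 R (snd P) (snd Q) (snd u))"
  "map2 (hom_to C D R) P Q u v \<delta> = map2 (hom_psf C) (fst P, pob R (snd P)) (fst Q, pob R (snd Q))
     (fst u, map1 R (snd P) (snd Q) (snd u)) (fst v, map1 R (snd P) (snd Q) (snd v))
     (fst \<delta>, map2 R (snd P) (snd Q) (snd u) (snd v) (snd \<delta>))"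
  by (simp_all add: hom_to_def comp_psf_def comp_ftr_def id_psf_def id_ftr_def hom_psf_simps(1))

lemma hom_from_fixed_pcomp:
  assumes "two_category C" "two_category D" "normal_pseudo_functor C D L"
    and "Y \<in> Ob D" "X \<in> Ob C" "X' \<in> Ob C" "X'' \<in> Ob C"
    and "f \<in> obj (Hom C X' X)" "f' \<in> obj (Hom C X'' X')" "h \<in> obj (Hom D (pob L X) Y)"
  shows "pcomp (hom_from_fixed C D L Y) X X' X'' f' f h =
    lwhisk D (pob L X'') (pob L X) Y h
      (comp1 D (pob L X'') (pob L X') (pob L X) (map1 L X' X f) (map1 L X'' X' f'))
      (map1 L X'' X (comp1 C X'' X' X f f')) (pcomp L X'' X' X f f')"
proof -
  interpret L: psf C D L using assms by (simp add: psf_iff)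
  have *: "map1 L X' X f \<in> obj (Hom D (pob L X') (pob L X))"
    "map1 L X'' X' f' \<in> obj (Hom D (pob L X'') (pob L X'))"
    "map1 L X'' X (comp1 C X'' X' X f f') \<in> obj (Hom D (pob L X'') (pob L X))"
    "pcomp L X'' X' X f f' \<in> arr (Hom D (pob L X'') (pob L X))
      (comp1 D (pob L X'') (pob L X') (pob L X) (map1 L X' X f) (map1 L X'' X' f'))
      (map1 L X'' X (comp1 C X'' X' X f f'))"
    using assms cat_functor.fob_in[OF L.phom_functor] is_iso_arr[OF L.pcomp_iso] by (simp_all add: L.K.comp1_in)
  then show ?thesis
    using assms
    by (simp add: comp_ftr_def hom_from_fixed_def comp_psf_def op_psf_def Let_def CAT_simps functor_cat_simps repr_psf_simps
        L.M.comp1_in L.M.comp2_in L.M.comp1_assoc category.cmp_one_right[OF L.M.cat] category.one_in[OF L.M.cat])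
qed

lemma hom_from_pcomp:
  assumes "two_category C" "two_category D" "normal_pseudo_functor C D L"
    and "X \<in> Ob C" "X' \<in> Ob C" "X'' \<in> Ob C" "Y \<in> Ob D" "Y' \<in> Ob D" "Y'' \<in> Ob D"
    and "f \<in> obj (Hom C X' X)" "f' \<in> obj (Hom C X'' X')" "g \<in> obj (Hom D Y Y')" "g' \<in> obj (Hom D Y' Y'')"
    and "h \<in> obj (Hom D (pob L X) Y)"
  shows "pcomp (hom_from C D L) (X, Y) (X', Y') (X'', Y'') (f', g') (f, g) h =
    lwhisk D (pob L X'') (pob L X) Y'' (comp1 D (pob L X) Y Y'' (comp1 D Y Y' Y'' g' g) h)
      (comp1 D (pob L X'') (pob L X') (pob L X) (map1 L X' X f) (map1 L X'' X' f'))
      (map1 L X'' X (comp1 C X'' X' X f f')) (pcomp L X'' X' X f f')"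
proof -
  interpret L: psf C D L using assms by (simp add: psf_iff)
  have *: "map1 L X' X f \<in> obj (Hom D (pob L X') (pob L X))"
    "map1 L X'' X' f' \<in> obj (Hom D (pob L X'') (pob L X'))"
    "map1 L X'' X (comp1 C X'' X' X f f') \<in> obj (Hom D (pob L X'') (pob L X))"
    "pcomp L X'' X' X f f' \<in> arr (Hom D (pob L X'') (pob L X))
      (comp1 D (pob L X'') (pob L X') (pob L X) (map1 L X' X f) (map1 L X'' X' f'))
      (map1 L X'' X (comp1 C X'' X' X f f'))"
    using assms cat_functor.fob_in[OF L.phom_functor] is_iso_arr[OF L.pcomp_iso] by (simp_all add: L.K.comp1_in)
  moreover have "lwhisk D (pob L X'') (pob L X) Y'' (comp1 D (pob L X) Y Y'' (comp1 D Y Y' Y'' g' g) h)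
      (comp1 D (pob L X'') (pob L X') (pob L X) (map1 L X' X f) (map1 L X'' X' f'))
      (map1 L X'' X (comp1 C X'' X' X f f')) (pcomp L X'' X' X f f') \<in> arr (Hom D (pob L X'') Y'')
      (comp1 D (pob L X'') (pob L X) Y'' (comp1 D (pob L X) Y Y'' (comp1 D Y Y' Y'' g' g) h)
        (comp1 D (pob L X'') (pob L X') (pob L X) (map1 L X' X f) (map1 L X'' X' f')))
      (comp1 D (pob L X'') (pob L X) Y'' (comp1 D (pob L X) Y Y'' (comp1 D Y Y' Y'' g' g) h)
        (map1 L X'' X (comp1 C X'' X' X f f')))"
    using assms * by (intro L.M.comp2_in) (simp_all add: L.M.comp1_in category.one_in[OF L.M.cat])
  ultimately show ?thesis
    using assms
    by (simp add: comp_ftr_def L.M.comp1_assoc hom_from_def comp_psf_def op_psf_def id_psf_def id_ftr_def Let_def CAT_simps functor_cat_simps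
        hom_psf_simps prod2_simps L.M.comp1_in L.M.comp2_in L.M.comp2_one
        category.cmp_one_right[OF L.M.cat] category.one_in[OF L.M.cat])
qed

lemma hom_to_pcomp:
  assumes "two_category C" "two_category D" "normal_pseudo_functor D C R"
    and "X \<in> Ob C" "X' \<in> Ob C" "X'' \<in> Ob C" "Y \<in> Ob D" "Y' \<in> Ob D" "Y'' \<in> Ob D"
    and "f \<in> obj (Hom C X' X)" "f' \<in> obj (Hom C X'' X')" "g \<in> obj (Hom D Y Y')" "g' \<in> obj (Hom D Y' Y'')"
    and "h \<in> obj (Hom C X (pob R Y))"
  shows "pcomp (hom_to C D R) (X, Y) (X', Y') (X'', Y'') (f', g') (f, g) h =
    rwhisk C X'' X (pob R Y'')
      (comp1 C X (pob R Y) (pob R Y'') (comp1 C (pob R Y) (pob R Y') (pob R Y'') (map1 R Y' Y'' g') (map1 R Y Y' g)) h)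
      (comp1 C X (pob R Y) (pob R Y'') (map1 R Y Y'' (comp1 D Y Y' Y'' g' g)) h)
      (comp1 C X'' X' X f f')
      (rwhisk C X (pob R Y) (pob R Y'')
        (comp1 C (pob R Y) (pob R Y') (pob R Y'') (map1 R Y' Y'' g') (map1 R Y Y' g))
        (map1 R Y Y'' (comp1 D Y Y' Y'' g' g)) h (pcomp R Y Y' Y'' g' g))"
proof -
  interpret R: psf D C R using assms by (simp add: psf_iff)
  have *: "map1 R Y Y' g \<in> obj (Hom C (pob R Y) (pob R Y'))"
    "map1 R Y' Y'' g' \<in> obj (Hom C (pob R Y') (pob R Y''))"
    "map1 R Y Y'' (comp1 D Y Y' Y'' g' g) \<in> obj (Hom C (pob R Y) (pob R Y''))"
    "pcomp R Y Y' Y'' g' g \<in> arr (Hom C (pob R Y) (pob R Y''))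
      (comp1 C (pob R Y) (pob R Y') (pob R Y'') (map1 R Y' Y'' g') (map1 R Y Y' g))
      (map1 R Y Y'' (comp1 D Y Y' Y'' g' g))"
    using assms cat_functor.fob_in[OF R.phom_functor] is_iso_arr[OF R.pcomp_iso] by (simp_all add: R.K.comp1_in)
  moreover have "rwhisk C X'' X (pob R Y'')
      (comp1 C X (pob R Y) (pob R Y'') (comp1 C (pob R Y) (pob R Y') (pob R Y'') (map1 R Y' Y'' g') (map1 R Y Y' g)) h)
      (comp1 C X (pob R Y) (pob R Y'') (map1 R Y Y'' (comp1 D Y Y' Y'' g' g)) h)
      (comp1 C X'' X' X f f')
      (rwhisk C X (pob R Y) (pob R Y'')
        (comp1 C (pob R Y) (pob R Y') (pob R Y'') (map1 R Y' Y'' g') (map1 R Y Y' g))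
        (map1 R Y Y'' (comp1 D Y Y' Y'' g' g)) h (pcomp R Y Y' Y'' g' g)) \<in> arr (Hom C X'' (pob R Y''))
      (comp1 C X'' X (pob R Y'') (comp1 C X (pob R Y) (pob R Y'')
        (comp1 C (pob R Y) (pob R Y') (pob R Y'') (map1 R Y' Y'' g') (map1 R Y Y' g)) h) (comp1 C X'' X' X f f'))
      (comp1 C X'' X (pob R Y'') (comp1 C X (pob R Y) (pob R Y'') (map1 R Y Y'' (comp1 D Y Y' Y'' g' g)) h)
        (comp1 C X'' X' X f f'))"
    using assms * by (intro R.M.comp2_in) (simp_all add: R.M.comp1_in category.one_in[OF R.M.cat])
  ultimately show ?thesis
    using assms
    by (simp add: comp_ftr_def R.M.comp1_assoc hom_to_def comp_psf_def id_psf_def id_ftr_def Let_def CAT_simps functor_cat_simps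
        hom_psf_simps prod2_simps R.M.comp1_in R.M.comp2_in R.M.comp2_one
        category.cmp_one_right[OF R.M.cat] category.one_in[OF R.M.cat])
qed

definition counit_ftr :: "('c, 'a, 'x) twocat \<Rightarrow> ('d, 'b, 'y) twocat \<Rightarrow> ('c, 'a, 'x, 'd, 'b, 'y) psf \<Rightarrow>
    'c \<Rightarrow> 'c \<Rightarrow> 'd \<Rightarrow> 'b \<Rightarrow> ('a, 'x, 'b, 'y) ftr" where
  "counit_ftr C D L X Z Y e = \<lparr>
     fob = (\<lambda>h. comp1 D (pob L X) (pob L Z) Y e (map1 L X Z h)),
     far = (\<lambda>h h' \<alpha>. lwhisk D (pob L X) (pob L Z) Y e (map1 L X Z h) (map1 L X Z h') (map2 L X Z h h' \<alpha>))\<rparr>"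

definition universal_counit :: "('c, 'a, 'x) twocat \<Rightarrow> ('d, 'b, 'y) twocat \<Rightarrow> ('c, 'a, 'x, 'd, 'b, 'y) psf \<Rightarrow>
    'd \<Rightarrow> 'c \<Rightarrow> 'b \<Rightarrow> bool" where
  "universal_counit C D L Y Z e \<longleftrightarrow> Z \<in> Ob C \<and> e \<in> obj (Hom D (pob L Z) Y) \<and>
     (\<forall>X \<in> Ob C. weak_equivalence (Hom C X Z) (Hom D (pob L X) Y) (counit_ftr C D L X Z Y e))"

lemma counit_ftr_functor:
  assumes "two_category C" "two_category D" "normal_pseudo_functor C D L"
    and "X \<in> Ob C" "Z \<in> Ob C" "Y \<in> Ob D" "e \<in> obj (Hom D (pob L Z) Y)"
  shows "cat_functor (Hom C X Z) (Hom D (pob L X) Y) (counit_ftr C D L X Z Y e)"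
proof -
  interpret L: psf C D L using assms by (simp add: psf_iff)
  interpret LXZ: cat_functor "Hom C X Z" "Hom D (pob L X) (pob L Z)" "phom L X Z"
    using assms by (intro L.phom_functor)
  show ?thesis
  proof (unfold_locales, goal_cases)
    case (4 f g h \<alpha> \<beta>)
    then show ?case
      using assms L.M.comp2_cmp[of "pob L X" "pob L Z" Y "map1 L X Z f" e "map1 L X Z g" e "map1 L X Z h" e
          "map2 L X Z f g \<alpha>" "one (Hom D (pob L Z) Y) e" "map2 L X Z g h \<beta>" "one (Hom D (pob L Z) Y) e"]
      by (simp add: counit_ftr_def LXZ.fob_in LXZ.far_in LXZ.far_cmp category.one_in[OF L.M.cat]
          category.cmp_one_left[OF L.M.cat])
  qed (use assms in \<open>simp_all add: counit_ftr_def LXZ.fob_in LXZ.far_in LXZ.far_one L.M.comp1_in L.M.comp2_in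
    L.M.comp2_one category.one_in[OF L.M.cat]\<close>)
qed

text \<open>The Yoneda argument: it suffices that \<open>h \<mapsto> e (L h)\<close> is naturally isomorphic to some weak equivalence \<open>P X\<close>.\<close>

lemma universal_counitI:
  assumes "two_category C" "two_category D" "normal_pseudo_functor C D L"
    and "Y \<in> Ob D" "Z \<in> Ob C" "e \<in> obj (Hom D (pob L Z) Y)"
    and P: "\<And>X. X \<in> Ob C \<Longrightarrow> cat_functor (Hom C X Z) (Hom D (pob L X) Y) (P X)"
      "\<And>X. X \<in> Ob C \<Longrightarrow> weak_equivalence (Hom C X Z) (Hom D (pob L X) Y) (P X)"
    and iso: "\<And>X h. X \<in> Ob C \<Longrightarrow> h \<in> obj (Hom C X Z) \<Longrightarrow>
      is_iso (Hom D (pob L X) Y) (fob (counit_ftr C D L X Z Y e) h) (fob (P X) h) (k X h)"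
    and nat: "\<And>X h h' \<alpha>. X \<in> Ob C \<Longrightarrow> h \<in> obj (Hom C X Z) \<Longrightarrow> h' \<in> obj (Hom C X Z) \<Longrightarrow> \<alpha> \<in> arr (Hom C X Z) h h' \<Longrightarrow>
      cmp (Hom D (pob L X) Y) (fob (counit_ftr C D L X Z Y e) h) (fob (P X) h) (fob (P X) h')
        (far (P X) h h' \<alpha>) (k X h) =
      cmp (Hom D (pob L X) Y) (fob (counit_ftr C D L X Z Y e) h) (fob (counit_ftr C D L X Z Y e) h') (fob (P X) h')
        (k X h') (far (counit_ftr C D L X Z Y e) h h' \<alpha>)"
  shows "universal_counit C D L Y Z e"
  unfolding universal_counit_def
proof (intro conjI ballI)
  fix X assume X: "X \<in> Ob C"
  interpret P: cat_functor "Hom C X Z" "Hom D (pob L X) Y" "P X" by (rule P(1)) fact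
  interpret Q: cat_functor "Hom C X Z" "Hom D (pob L X) Y" "counit_ftr C D L X Z Y e"
    using assms X by (intro counit_ftr_functor)
  show "weak_equivalence (Hom C X Z) (Hom D (pob L X) Y) (counit_ftr C D L X Z Y e)"
    by (rule weak_equivalence_transport[of _ _ "P X" _ "k X"])
      (use assms X in \<open>simp_all add: P.fob_in P.far_in Q.fob_in Q.far_in two_category.hom_category
        normal_pseudo_functor.pob_in[of C D L]\<close>)
qed fact+

text \<open>The structure cell of \<open>\<Psi>\<close> at \<open>h : X \<rightarrow> Z\<close> goes from \<open>\<Psi>(1) (L h)\<close> to \<open>\<Psi>(1 h)\<close> when evaluated at the identity of \<open>Z\<close>.\<close>

lemma bi_representation_universal:
  assumes CDL: "two_category C" "two_category D" "normal_pseudo_functor C D L" and Y: "Y \<in> Ob D"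
    and rep: "bi_representation C (hom_from_fixed C D L Y) Z \<Psi>"
  shows "\<exists>e. universal_counit C D L Y Z e"
proof -
  interpret L: psf C D L using CDL by (simp add: psf_iff)
  let ?F = "repr_psf C Z" and ?G = "hom_from_fixed C D L Y"
  have Z: "Z \<in> Ob C" and eq: "adjoint_equivalence (Ps (op2 C) CAT) ?F ?G \<Psi>"
    using rep by (simp_all add: bi_representation_def)
  interpret P: CAT_pair "op2 C" ?F ?G
    using CDL Y Z by (intro CAT_pairI L.K.two_category_op2 L.K.repr_psf_normal hom_from_fixed_normal)
  let ?\<rho> = "fwd \<Psi>"
  have \<rho>: "pseudo_nat_trans (op2 C) CAT ?F ?G ?\<rho>"
    by (rule Ps_equivalence_weak(1)) fact
  have \<rho>X: "cat_functor (Hom C X Z) (Hom D (pob L X) Y) (tob ?\<rho> X)" if "X \<in> Ob C" for X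
    using pseudo_nat_trans.tob_in[OF \<rho>, of X] that
    by (simp add: CAT_simps functor_cat_simps repr_psf_simps hom_from_fixed_simps)
  let ?e = "fob (tob ?\<rho> Z) (Id C Z)"
  have e: "?e \<in> obj (Hom D (pob L Z) Y)"
    using cat_functor.fob_in[OF \<rho>X[OF Z]] Z by (simp add: L.K.Id_in)
  note Lin = cat_functor.fob_in[OF L.phom_functor] cat_functor.far_in[OF L.phom_functor]
  have "universal_counit C D L Y Z ?e"
  proof (rule universal_counitI[OF CDL Y Z e, where P = "tob ?\<rho>" and k = "\<lambda>X h. tcell ?\<rho> Z X h (Id C Z)"], goal_cases)
    case (2 X)
    then show ?case
      using Ps_equivalence_weak(2)[OF eq, of X] by (simp add: repr_psf_simps hom_from_fixed_simps)
  next
    case (3 X h)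
    then show ?case
      using P.pnt_component_iso[OF \<rho>, of Z X h "Id C Z"] Z e
      by (simp add: repr_psf_simps hom_from_fixed_simps counit_ftr_def L.K.Id_in L.K.comp1_Id_left)
  next
    case (4 X h h' \<alpha>)
    then show ?case
      using P.pnt_component_natural[OF \<rho>, of Z X h h' \<alpha> "Id C Z"] Z e
      by (simp add: repr_psf_simps hom_from_fixed_simps counit_ftr_def L.K.Id_in L.K.comp1_Id_left L.K.comp2_Id_left)
  qed (rule \<rho>X)
  then show ?thesis by blast
qed

text \<open>As for bi-representations, using the structure cells at the pairs \<open>(h, 1)\<close>. Normality of \<open>R\<close> ensures that
  such a pair sends the identity of \<open>R Y\<close> to \<open>h\<close>.\<close>

lemma bi_adjunction_universal:
  assumes CDL: "two_category C" "two_category D" "normal_pseudo_functor C D L" and Y: "Y \<in> Ob D"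
    and adj: "bi_adjunction C D L R \<Phi>"
  shows "\<exists>e. universal_counit C D L Y (pob R Y) e"
proof -
  interpret L: psf C D L using CDL by (simp add: psf_iff)
  let ?F = "hom_to C D R" and ?G = "hom_from C D L" and ?Z = "pob R Y"
  have R: "normal_pseudo_functor D C R"
    and eq: "adjoint_equivalence (Ps (prod2 (op2 C) D) CAT) ?F ?G \<Phi>"
    using adj by (simp_all add: bi_adjunction_def)
  interpret R: psf D C R using CDL R by (simp add: psf_iff)
  have Z: "?Z \<in> Ob C" using Y by simp
  interpret P: CAT_pair "prod2 (op2 C) D" ?F ?G
    using CDL R by (intro CAT_pairI two_category_prod2 L.K.two_category_op2 hom_to_normal hom_from_normal)
  let ?\<rho> = "fwd \<Phi>"
  have \<rho>: "pseudo_nat_trans (prod2 (op2 C) D) CAT ?F ?G ?\<rho>"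
    by (rule Ps_equivalence_weak(1)) fact
  have \<rho>X: "cat_functor (Hom C X ?Z) (Hom D (pob L X) Y) (tob ?\<rho> (X, Y))" if "X \<in> Ob C" for X
    using pseudo_nat_trans.tob_in[OF \<rho>, of "(X, Y)"] that Y
    by (simp add: CAT_simps functor_cat_simps hom_to_simps hom_from_simps prod2_simps)
  let ?e = "fob (tob ?\<rho> (?Z, Y)) (Id C ?Z)"
  have e: "?e \<in> obj (Hom D (pob L ?Z) Y)"
    using cat_functor.fob_in[OF \<rho>X[OF Z]] Z by (simp add: L.K.Id_in)
  have RId: "map2 R Y Y (Id D Y) (Id D Y) (one (Hom D Y Y) (Id D Y)) = one (Hom C ?Z ?Z) (Id C ?Z)"
    using cat_functor.far_one[OF R.phom_functor, of Y Y "Id D Y"] Y by (simp add: R.map1_Id L.M.Id_in)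
  have "universal_counit C D L Y ?Z ?e"
  proof (rule universal_counitI[OF CDL Y Z e, where P = "\<lambda>X. tob ?\<rho> (X, Y)" and
        k = "\<lambda>X h. tcell ?\<rho> (?Z, Y) (X, Y) (h, Id D Y) (Id C ?Z)"], goal_cases)
    case (2 X)
    then show ?case
      using Ps_equivalence_weak(2)[OF eq, of "(X, Y)"] Y by (simp add: hom_to_simps hom_from_simps prod2_simps)
  next
    case (3 X h)
    then show ?case
      using P.pnt_component_iso[OF \<rho>, of "(?Z, Y)" "(X, Y)" "(h, Id D Y)" "Id C ?Z"] Z Y e
      by (simp add: hom_to_simps hom_from_simps hom_psf_simps prod2_simps prod_cat_simps counit_ftr_def
          L.K.Id_in L.M.Id_in R.map1_Id L.K.comp1_Id_left L.M.comp1_Id_left)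
  next
    case (4 X h h' \<alpha>)
    then show ?case
      using P.pnt_component_natural[OF \<rho>, of "(?Z, Y)" "(X, Y)" "(h, Id D Y)" "(h', Id D Y)"
          "(\<alpha>, one (Hom D Y Y) (Id D Y))" "Id C ?Z"] Z Y e
      by (simp add: hom_to_simps hom_from_simps hom_psf_simps prod2_simps prod_cat_simps counit_ftr_def
          L.K.Id_in L.M.Id_in R.map1_Id RId L.K.comp1_Id_left L.M.comp1_Id_left L.K.comp2_Id_left
          L.K.comp2_one L.M.comp2_one category.one_in[OF L.M.cat])
  qed (rule \<rho>X)
  then show ?thesis by blast
qed

section \<open>From universal counits to bi-representations\<close>

context psf
begin

text \<open>For \<open>E : F Z \<rightarrow> Y\<close> and \<open>h : X \<rightarrow> Z\<close>, \<open>f : X' \<rightarrow> X\<close> this is the cell \<open>E (F h) (F f) \<Rightarrow> E F(h f)\<close>.\<close>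

definition V :: "('p, 'b) mor \<Rightarrow> ('o, 'a) mor \<Rightarrow> ('o, 'a) mor \<Rightarrow> ('p, 'b, 'y) cell" where
  "V E h f = E |> coh K M F h f"

lemma V_iso [simp]:
  "is1 M E \<Longrightarrow> is1 K h \<Longrightarrow> is1 K f \<Longrightarrow> dm E = pob F (cd h) \<Longrightarrow> cd f = dm h \<Longrightarrow> iso2 M (V E h f)"
  by (simp add: V_def)

lemma V_is2 [simp]:
  "is1 M E \<Longrightarrow> is1 K h \<Longrightarrow> is1 K f \<Longrightarrow> dm E = pob F (cd h) \<Longrightarrow> cd f = dm h \<Longrightarrow> is2 M (V E h f)"
  by simp

lemma V_frame [simp]:
  "src (V E h f) = E \<odot> app1 F h \<odot> app1 F f" "trg (V E h f) = E \<odot> app1 F (h \<odot>\<^bsub>K\<^esub> f)"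
  by (simp_all add: V_def)

lemma V_natural_left:
  assumes "is1 M E" "is2 K \<alpha>" "is1 K f" "dm E = pob F (cd (src \<alpha>))" "cd f = dm (src \<alpha>)"
  shows "V E (trg \<alpha>) f \<bullet> (E |> app2 F \<alpha>) <| app1 F f = E |> app2 F (\<alpha> <|\<^bsub>K\<^esub> f) \<bullet> V E (src \<alpha>) f"
  using arg_cong[OF coh_rw[of f \<alpha>], of "\<lambda>x. E |> x"] assms by (simp add: V_def)

lemma V_natural_right:
  assumes "is1 M E" "is2 K \<alpha>" "is1 K h" "dm E = pob F (cd h)" "cd (src \<alpha>) = dm h"
  shows "V E h (trg \<alpha>) \<bullet> (E \<odot> app1 F h) |> app2 F \<alpha> = E |> app2 F (h |>\<^bsub>K\<^esub> \<alpha>) \<bullet> V E h (src \<alpha>)"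
  using arg_cong[OF coh_lw[of h \<alpha>], of "\<lambda>x. E |> x"] assms by (simp add: V_def)

lemma V_assoc:
  assumes "is1 M E" "is1 K h" "is1 K f" "is1 K f'" "dm E = pob F (cd h)" "cd f = dm h" "cd f' = dm f"
  shows "V E h (f \<odot>\<^bsub>K\<^esub> f') \<bullet> (E \<odot> app1 F h) |> coh K M F f f' = V E (h \<odot>\<^bsub>K\<^esub> f) f' \<bullet> V E h f <| app1 F f'"
  using arg_cong[OF coh_assoc[of f' f h], of "\<lambda>x. E |> x"] assms by (simp add: V_def)

lemma V_id1 [simp]:
  assumes "is1 M E" "is1 K h" "dm E = pob F (cd h)" "A = dm h"
  shows "V E h (id1 K A) = id2 M (E \<odot> app1 F h)"
  using assms by (simp add: V_def)

end

lemma weak_equivalence_restrict [simp]: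
  "weak_equivalence X Y (restrict_ftr X F) \<longleftrightarrow> weak_equivalence X Y F"
proof -
  have "bij_betw (far (restrict_ftr X F) a b) (arr X a b) (arr Y (fob F a) (fob F b)) \<longleftrightarrow>
      bij_betw (far F a b) (arr X a b) (arr Y (fob F a) (fob F b))" if "a \<in> obj X" "b \<in> obj X" for a b
    by (rule bij_betw_cong) (use that in simp)
  then show ?thesis
    by (simp add: weak_equivalence_def)
qed

text \<open>\<open>\<Psi>(h) = e (L h)\<close> is pseudo-natural because the compositor of \<open>L\<close> is natural, normal and associative.\<close>

lemma universal_bi_representation:
  assumes CDL: "two_category C" "two_category D" "normal_pseudo_functor C D L" and Y: "Y \<in> Ob D"
    and u: "universal_counit C D L Y Z e"
  shows "\<exists>\<Psi>. bi_representation C (hom_from_fixed C D L Y) Z \<Psi>"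
proof -
  interpret L: psf C D L using CDL by (simp add: psf_iff)
  let ?F = "repr_psf C Z" and ?G = "hom_from_fixed C D L Y"
  have Z: "Z \<in> Ob C" and e: "e \<in> obj (Hom D (pob L Z) Y)"
    using u by (simp_all add: universal_counit_def)
  have FG: "normal_pseudo_functor (op2 C) CAT ?F" "normal_pseudo_functor (op2 C) CAT ?G"
    using CDL Y Z by (simp_all add: L.K.repr_psf_normal hom_from_fixed_normal)
  interpret P: CAT_pair "op2 C" ?F ?G
    using FG by (intro CAT_pairI L.K.two_category_op2)
  let ?E = "Mor (pob L Z) Y e"
  have E: "is1 D ?E"
    using Y Z e by (simp add: is1_Mor)
  define \<rho> where "\<rho> = \<lparr>tob = (\<lambda>X. restrict_ftr (Hom C X Z) (counit_ftr C D L X Z Y e)),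
      tcell = (\<lambda>X X' f. \<lambda>h \<in> obj (Hom C X Z). raw2 (L.V ?E (Mor X Z h) (Mor X' X f)))\<rparr>"
  note Lin [simp] = cat_functor.fob_in[OF L.phom_functor] cat_functor.far_in[OF L.phom_functor]
  note [simp] = Y Z e L.K.comp1_in L.M.comp1_in L.K.comp2_in L.M.comp2_in category.one_in[OF L.K.cat]
    category.one_in[OF L.M.cat] hom_from_fixed_simps repr_psf_simps(1,2,3) L.M.comp1_assoc L.K.comp1_assoc
  note fc = counit_ftr_functor[OF CDL _ Z Y e]
  have "pseudo_nat_trans (op2 C) CAT ?F ?G \<rho>"
  proof (rule P.CAT_pntI, goal_cases)
    case (1 X)
    then show ?case
      using fc L.K.cat by (simp add: \<rho>_def)
  next
    case (2 X)
    then show ?case by (simp add: \<rho>_def)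
  next
    case (3 X X' f)
    then show ?case by (simp add: \<rho>_def)
  next
    case (4 X X' f h)
    then show ?case
      using L.V_iso[OF E, of "Mor X Z h" "Mor X' X f", unfolded L.M.iso2_iff]
      by (simp add: \<rho>_def counit_ftr_def is1_Mor) (simp add: op_defs app_defs)
  next
    case (5 X X' f h h' \<alpha>)
    then show ?case
      using arg_cong[OF L.V_natural_left[OF E, of "Cell (Mor X Z h) (Mor X Z h') \<alpha>" "Mor X' X f"], of raw2]
      by (simp del: L.M.lw_rw add: \<rho>_def counit_ftr_def is1_Mor is2_Cell) (simp add: L.V_def op_defs app_defs)
  next
    case (6 X X' f f' \<alpha> h)
    then show ?case
      using arg_cong[OF L.V_natural_right[OF E, of "Cell (Mor X' X f) (Mor X' X f') \<alpha>" "Mor X Z h"], of raw2]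
      by (simp add: \<rho>_def counit_ftr_def is1_Mor is2_Cell) (simp add: L.V_def op_defs app_defs)
  next
    case (7 X h)
    then show ?case
      using L.V_id1[OF E, of "Mor X Z h" X]
      by (simp add: \<rho>_def counit_ftr_def is1_Mor id1_def) (simp add: op_defs app_defs)
  next
    case (8 X X' X'' f f' h)
    then show ?case
      using arg_cong[OF L.V_assoc[OF E, of "Mor X Z h" "Mor X' X f" "Mor X'' X' f'"], of raw2]
        L.V_is2[OF E, of "Mor X Z h" "Mor X' X f", unfolded is2_def]
        L.M.is2_vc[OF L.M.is2_rw[OF L.V_is2[OF E, of "Mor X Z h" "Mor X' X f"], of "app1 L (Mor X'' X' f')"]
          L.V_is2[OF E, of "Mor X Z h \<odot>\<^bsub>C\<^esub> Mor X' X f" "Mor X'' X' f'"], unfolded is2_def]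
        cat_functor.far_one[OF L.phom_functor, of X'' Z]
        hom_from_fixed_pcomp[OF CDL Y, of X X' X'' f f' "comp1 D (pob L X) (pob L Z) Y e (map1 L X Z h)"]
      by (simp add: \<rho>_def counit_ftr_def is1_Mor repr_psf_simps(4) CAT_simps functor_cat_simps L.M.comp2_one)
        (simp add: category.cmp_one_left[OF L.M.cat] L.V_def op_defs app_defs)
  qed
  moreover have "weak_equivalence (pob ?F X) (pob ?G X) (tob \<rho> X)" if "X \<in> Ob C" for X
    using u that by (simp add: universal_counit_def \<rho>_def)
  ultimately obtain \<Psi> where "adjoint_equivalence (Ps (op2 C) CAT) ?F ?G \<Psi>"
    using weak_equivalence_Ps[OF L.K.two_category_op2 FG] by auto
  with Z show ?thesis
    by (auto simp: bi_representation_def)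
qed

section \<open>The right bi-adjoint\<close>

locale right_family = L: psf C D L
  for C :: "('c, 'a, 'x) twocat" and D :: "('d, 'a, 'x) twocat" (structure)
    and L :: "('c, 'a, 'x, 'd, 'a, 'x) psf" +
  fixes RO :: "'d \<Rightarrow> 'c" and e :: "'d \<Rightarrow> 'a"
  assumes univ: "Y \<in> Ob D \<Longrightarrow> universal_counit C D L Y (RO Y) (e Y)"
begin

abbreviation "E Y \<equiv> Mor (pob L (RO Y)) Y (e Y)"
abbreviation "L1 \<equiv> app1 L"
abbreviation "L2 \<equiv> app2 L"
abbreviation "\<phi> \<equiv> coh C D L"

lemma RO_in [simp]: "Y \<in> Ob D \<Longrightarrow> RO Y \<in> Ob C"
  using univ by (simp add: universal_counit_def)

lemma E_is1 [simp]: "Y \<in> Ob D \<Longrightarrow> is1 D (E Y)"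
  using univ by (simp add: universal_counit_def is1_Mor)

lemma E_weak:
  assumes "X \<in> Ob C" "Y \<in> Ob D"
  shows "weak_equivalence (Hom C X (RO Y)) (Hom D (pob L X) Y) (counit_ftr C D L X (RO Y) Y (e Y))"
  using univ assms by (simp add: universal_counit_def)

text \<open>Full faithfulness of the universal counit, for cells with boundary.\<close>

lemma E_bij:
  assumes "is1 C h" "is1 C h'" "dm h' = dm h" "cd h = RO Y" "cd h' = RO Y" "Y \<in> Ob D"
  shows "bij_betw (\<lambda>\<alpha>. raw2 (E Y |> L2 (Cell h h' \<alpha>)))
    (arr (Hom C (dm h) (RO Y)) (raw1 h) (raw1 h'))
    (arr (Hom D (pob L (dm h)) Y) (raw1 (E Y \<odot> L1 h)) (raw1 (E Y \<odot> L1 h')))"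
  using E_weak[of "dm h" Y] assms
  by (elim is1E) (auto simp: weak_equivalence_def counit_ftr_def op_defs app_defs)

lemma E_full:
  assumes "is1 C h" "is1 C h'" "dm h' = dm h" "cd h = RO Y" "cd h' = RO Y" "Y \<in> Ob D"
    and \<gamma>: "is2 D \<gamma>" "src \<gamma> = E Y \<odot> L1 h" "trg \<gamma> = E Y \<odot> L1 h'"
  obtains \<alpha> where "is2 C \<alpha>" "src \<alpha> = h" "trg \<alpha> = h'" "E Y |> L2 \<alpha> = \<gamma>"
proof -
  have "raw2 \<gamma> \<in> arr (Hom D (pob L (dm h)) Y) (raw1 (E Y \<odot> L1 h)) (raw1 (E Y \<odot> L1 h'))"
    using \<gamma> unfolding is2_def by simp
  then obtain a where a: "a \<in> arr (Hom C (dm h) (RO Y)) (raw1 h) (raw1 h')"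
    "raw2 (E Y |> L2 (Cell h h' a)) = raw2 \<gamma>"
    by (auto simp flip: bij_betw_imp_surj_on[OF E_bij[OF assms(1-6)]])
  then have "is2 C (Cell h h' a)"
    unfolding is2_def using assms by simp
  with a \<gamma> show ?thesis
    by (intro that[of "Cell h h' a"] cell_eqI) simp_all
qed

lemma E_faithful:
  assumes "is2 C \<alpha>" "is2 C \<beta>" "src \<alpha> = src \<beta>" "trg \<alpha> = trg \<beta>" "cd (src \<beta>) = RO Y" "Y \<in> Ob D"
    and "E Y |> L2 \<alpha> = E Y |> L2 \<beta>"
  shows "\<alpha> = \<beta>"
proof (rule cell_eqI)
  have "inj_on (\<lambda>a. raw2 (E Y |> L2 (Cell (src \<beta>) (trg \<beta>) a)))
      (arr (Hom C (dm (src \<beta>)) (RO Y)) (raw1 (src \<beta>)) (raw1 (trg \<beta>)))"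
    using E_bij[of "src \<beta>" "trg \<beta>" Y] assms by (simp add: bij_betw_def)
  moreover have "raw2 \<alpha> \<in> arr (Hom C (dm (src \<beta>)) (RO Y)) (raw1 (src \<beta>)) (raw1 (trg \<beta>))"
    "raw2 \<beta> \<in> arr (Hom C (dm (src \<beta>)) (RO Y)) (raw1 (src \<beta>)) (raw1 (trg \<beta>))"
    using assms(1-5) unfolding is2_def by simp_all
  moreover have "Cell (src \<beta>) (trg \<beta>) (raw2 \<alpha>) = \<alpha>" "Cell (src \<beta>) (trg \<beta>) (raw2 \<beta>) = \<beta>"
    using assms(3,4) by (metis cell.collapse)+
  ultimately show "raw2 \<alpha> = raw2 \<beta>"
    using assms(7) unfolding inj_on_def by metis
qed (use assms in simp_all)

lemma E_eso:
  assumes u: "is1 D u" "dm u = pob L X" "X \<in> Ob C"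
  obtains h \<gamma> where "is1 C h" "dm h = X" "cd h = RO (cd u)" "iso2 D \<gamma>" "src \<gamma> = u" "trg \<gamma> = E (cd u) \<odot> L1 h"
proof -
  let ?Y = "cd u"
  have Y: "?Y \<in> Ob D" "raw1 u \<in> obj (Hom D (pob L X) ?Y)"
    using u unfolding is1_def by simp_all
  then obtain h k where h: "h \<in> obj (Hom C X (RO ?Y))"
    and k: "is_iso (Hom D (pob L X) ?Y) (fob (counit_ftr C D L X (RO ?Y) ?Y (e ?Y)) h) (raw1 u) k"
    using E_weak[OF u(3), of ?Y] unfolding weak_equivalence_def by blast
  let ?h = "Mor X (RO ?Y) h" and ?\<kappa> = "Cell (E ?Y \<odot> L1 (Mor X (RO ?Y) h)) u k"
  have hh: "is1 C ?h"
    using h u Y by (simp add: is1_Mor)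
  then have "is1 D (E ?Y \<odot> L1 ?h)"
    using Y by simp
  moreover have "raw1 (E ?Y \<odot> L1 ?h) = fob (counit_ftr C D L X (RO ?Y) ?Y (e ?Y)) h"
    by (simp add: o1_def app1_def counit_ftr_def)
  ultimately have "iso2 D ?\<kappa>"
    unfolding L.M.iso2_iff is2_def using u k is_iso_arr[OF k] by simp
  with hh show ?thesis
    by (intro that[of ?h "inv2 D ?\<kappa>"]) simp_all
qed

text \<open>Full faithfulness applied to \<open>b\<close> composed with the inverse of \<open>a\<close>. This is how \<open>R\<close> on 2-morphisms and its
  compositor are obtained.\<close>

lemma factor:
  assumes "is1 C h" "is1 C h'" "dm h' = dm h" "cd h = RO Y" "cd h' = RO Y" "Y \<in> Ob D"
    and a: "iso2 D a" "trg a = E Y \<odot> L1 h" and b: "is2 D b" "src b = src a" "trg b = E Y \<odot> L1 h'"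
  shows "\<exists>\<alpha>. is2 C \<alpha> \<and> src \<alpha> = h \<and> trg \<alpha> = h' \<and> E Y |> L2 \<alpha> \<bullet> a = b"
proof -
  obtain \<alpha> where "is2 C \<alpha>" "src \<alpha> = h" "trg \<alpha> = h'" "E Y |> L2 \<alpha> = b \<bullet> inv2 D a"
    by (rule E_full[OF assms(1-6), of "b \<bullet> inv2 D a"]) (use a b in auto)
  then show ?thesis
    using a b by (intro exI[of _ \<alpha>]) simp
qed

text \<open>The cells of \<open>C\<close> below are defined by such factorisations, and equations between them are proved by this rule.\<close>

lemma factor_unique:
  assumes "E Y |> L2 \<alpha> \<bullet> a = E Y |> L2 \<beta> \<bullet> a" "iso2 D a" "is2 C \<alpha>" "is2 C \<beta>" "src \<alpha> = src \<beta>" "trg \<alpha> = trg \<beta>"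
    "cd (src \<beta>) = RO Y" "Y \<in> Ob D" "trg a = E Y \<odot> L1 (src \<beta>)"
  shows "\<alpha> = \<beta>"
proof (rule E_faithful)
  have [simp]: "cd (trg \<beta>) = RO Y"
    using is2_frame(2)[OF assms(4)] assms(7) by simp
  show "E Y |> L2 \<alpha> = E Y |> L2 \<beta>"
    by (rule L.M.iso2_epi[OF assms(1,2)]) (use assms in simp_all)
qed (use assms in simp_all)

text \<open>
  A lift of \<open>g : A \<rightarrow> B\<close> is a morphism \<open>R g\<close> with an invertible cell \<open>w : g e \<Rightarrow> e L(R g)\<close>. Identities are lifted to
  identities, since \<open>R\<close> has to preserve them strictly.
\<close>

definition lift :: "('d, 'a) mor \<Rightarrow> ('c, 'a) mor \<times> ('d, 'a, 'x) cell" where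
  "lift g = (if g = id1 D (dm g) then (id1 C (RO (dm g)), id2 D (E (dm g)))
     else (SOME p. is1 C (fst p) \<and> dm (fst p) = RO (dm g) \<and> cd (fst p) = RO (cd g) \<and> iso2 D (snd p) \<and>
       src (snd p) = g \<odot> E (dm g) \<and> trg (snd p) = E (cd g) \<odot> L1 (fst p)))"

definition "R1 g = fst (lift g)"
definition "w g = snd (lift g)"

lemma lift:
  assumes g: "is1 D g"
  shows is1_R1 [simp]: "is1 C (R1 g)" and dm_R1 [simp]: "dm (R1 g) = RO (dm g)"
    and cd_R1 [simp]: "cd (R1 g) = RO (cd g)" and w_iso [simp]: "iso2 D (w g)"
    and w_src [simp]: "src (w g) = g \<odot> E (dm g)" and w_trg [simp]: "trg (w g) = E (cd g) \<odot> L1 (R1 g)"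
proof -
  have "is1 C (R1 g) \<and> dm (R1 g) = RO (dm g) \<and> cd (R1 g) = RO (cd g) \<and> iso2 D (w g) \<and>
       src (w g) = g \<odot> E (dm g) \<and> trg (w g) = E (cd g) \<odot> L1 (R1 g)"
  proof (cases "g = id1 D (dm g)")
    case True
    then have "cd g = dm g" by (metis frame(2))
    then show ?thesis
      using g True L.M.o1_id1(2)[of "E (dm g)" "dm g"] by (simp add: R1_def w_def lift_def)
  next
    case False
    obtain h \<gamma> where "is1 C h" "dm h = RO (dm g)" "cd h = RO (cd g)" "iso2 D \<gamma>"
       "src \<gamma> = g \<odot> E (dm g)" "trg \<gamma> = E (cd g) \<odot> L1 h"
      by (rule E_eso[of "g \<odot> E (dm g)" "RO (dm g)"]) (use g in auto)
    then have "\<exists>p. is1 C (fst p) \<and> dm (fst p) = RO (dm g) \<and> cd (fst p) = RO (cd g) \<and> iso2 D (snd p) \<and>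
       src (snd p) = g \<odot> E (dm g) \<and> trg (snd p) = E (cd g) \<odot> L1 (fst p)"
      by (intro exI[of _ "(h, \<gamma>)"]) simp
    from someI_ex[OF this] False show ?thesis
      by (simp only: R1_def w_def lift_def if_False)
  qed
  then show "is1 C (R1 g)" "dm (R1 g) = RO (dm g)" "cd (R1 g) = RO (cd g)" "iso2 D (w g)"
    "src (w g) = g \<odot> E (dm g)" "trg (w g) = E (cd g) \<odot> L1 (R1 g)" by simp_all
qed

lemma w_is2 [simp]: "is1 D g \<Longrightarrow> is2 D (w g)"
  by simp

lemma lift_id1 [simp]: "R1 (id1 D A) = id1 C (RO A)" "w (id1 D A) = id2 D (E A)"
  by (simp_all add: R1_def w_def lift_def)

text \<open>The invertible cell \<open>g e (L h) \<Rightarrow> e L((R g) h)\<close> induced by \<open>w g\<close>; it measures how post-composition with \<open>g\<close> lifts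
  along the counits.\<close>

definition W :: "('d, 'a) mor \<Rightarrow> ('c, 'a) mor \<Rightarrow> ('d, 'a, 'x) cell" where
  "W g h = L.V (E (cd g)) (R1 g) h \<bullet> w g <| L1 h"

lemma W [simp]:
  assumes "is1 D g" "is1 C h" "cd h = RO (dm g)"
  shows W_iso: "iso2 D (W g h)" and W_is2: "is2 D (W g h)"
    and W_src: "src (W g h) = g \<odot> E (dm g) \<odot> L1 h" and W_trg: "trg (W g h) = E (cd g) \<odot> L1 (R1 g \<odot>\<^bsub>C\<^esub> h)"
proof -
  show "iso2 D (W g h)"
    unfolding W_def using assms by (intro L.M.iso2_vc) simp_all
  then show "is2 D (W g h)" by simp
qed (use assms in \<open>simp_all add: W_def\<close>)

lemma W_id1 [simp]:
  assumes "A \<in> Ob D" "is1 C h" "cd h = RO A"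
  shows "W (id1 D A) h = id2 D (E A \<odot> L1 h)"
  using assms by (simp add: W_def L.V_def)

lemma W_id1_right [simp]:
  assumes "is1 D g"
  shows "W g (id1 C (RO (dm g))) = w g"
  using assms by (simp add: W_def)

lemma W_natural_right:
  assumes g: "is1 D g" and \<alpha>: "is2 C \<alpha>" "cd (src \<alpha>) = RO (dm g)"
  shows "W g (trg \<alpha>) \<bullet> (g \<odot> E (dm g)) |> L2 \<alpha> = E (cd g) |> L2 (R1 g |>\<^bsub>C\<^esub> \<alpha>) \<bullet> W g (src \<alpha>)"
proof -
  have ex: "w g <| L1 (trg \<alpha>) \<bullet> (g \<odot> E (dm g)) |> L2 \<alpha> = (E (cd g) \<odot> L1 (R1 g)) |> L2 \<alpha> \<bullet> w g <| L1 (src \<alpha>)"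
    using L.M.exchange[of "L2 \<alpha>" "w g"] assms by simp
  have "W g (trg \<alpha>) \<bullet> (g \<odot> E (dm g)) |> L2 \<alpha> =
      L.V (E (cd g)) (R1 g) (trg \<alpha>) \<bullet> (w g <| L1 (trg \<alpha>) \<bullet> (g \<odot> E (dm g)) |> L2 \<alpha>)"
    using assms by (simp add: W_def)
  also have "\<dots> = (L.V (E (cd g)) (R1 g) (trg \<alpha>) \<bullet> (E (cd g) \<odot> L1 (R1 g)) |> L2 \<alpha>) \<bullet> w g <| L1 (src \<alpha>)"
    unfolding ex using assms by simp
  also have "\<dots> = E (cd g) |> L2 (R1 g |>\<^bsub>C\<^esub> \<alpha>) \<bullet> W g (src \<alpha>)"
    using assms by (subst L.V_natural_right) (simp_all add: W_def)
  finally show ?thesis .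
qed

text \<open>Lifting post-composition with \<open>g\<close> commutes with pre-composition with \<open>f\<close>.\<close>

lemma W_V:
  assumes "is1 D g" "is1 C h" "is1 C f" "cd h = RO (dm g)" "cd f = dm h"
  shows "W g (h \<odot>\<^bsub>C\<^esub> f) \<bullet> g |> L.V (E (dm g)) h f = L.V (E (cd g)) (R1 g \<odot>\<^bsub>C\<^esub> h) f \<bullet> W g h <| L1 f"
proof -
  have ex: "w g <| L1 (h \<odot>\<^bsub>C\<^esub> f) \<bullet> (g \<odot> E (dm g)) |> \<phi> h f =
      (E (cd g) \<odot> L1 (R1 g)) |> \<phi> h f \<bullet> w g <| (L1 h \<odot> L1 f)"
    using L.M.exchange[of "\<phi> h f" "w g"] assms by simp
  have "W g (h \<odot>\<^bsub>C\<^esub> f) \<bullet> g |> L.V (E (dm g)) h f =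
      L.V (E (cd g)) (R1 g) (h \<odot>\<^bsub>C\<^esub> f) \<bullet> (w g <| L1 (h \<odot>\<^bsub>C\<^esub> f) \<bullet> (g \<odot> E (dm g)) |> \<phi> h f)"
    using assms by (simp add: W_def L.V_def)
  also have "\<dots> = (L.V (E (cd g)) (R1 g) (h \<odot>\<^bsub>C\<^esub> f) \<bullet> (E (cd g) \<odot> L1 (R1 g)) |> \<phi> h f) \<bullet> w g <| (L1 h \<odot> L1 f)"
    unfolding ex using assms by simp
  also have "\<dots> = L.V (E (cd g)) (R1 g \<odot>\<^bsub>C\<^esub> h) f \<bullet> W g h <| L1 f"
    using assms by (subst L.V_assoc) (simp_all add: W_def)
  finally show ?thesis .
qed

text \<open>The action of \<open>R\<close> on 2-morphisms is the one that makes \<open>w\<close> natural.\<close>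

definition R2 :: "('d, 'a, 'x) cell \<Rightarrow> ('c, 'a, 'x) cell" where
  "R2 \<beta> = (SOME \<alpha>. is2 C \<alpha> \<and> src \<alpha> = R1 (src \<beta>) \<and> trg \<alpha> = R1 (trg \<beta>) \<and>
     E (cd (src \<beta>)) |> L2 \<alpha> \<bullet> w (src \<beta>) = w (trg \<beta>) \<bullet> \<beta> <| E (dm (src \<beta>)))"

lemma R2:
  assumes \<beta>: "is2 D \<beta>"
  shows is2_R2 [simp]: "is2 C (R2 \<beta>)" and src_R2 [simp]: "src (R2 \<beta>) = R1 (src \<beta>)"
    and trg_R2 [simp]: "trg (R2 \<beta>) = R1 (trg \<beta>)"
    and R2_w: "E (cd (src \<beta>)) |> L2 (R2 \<beta>) \<bullet> w (src \<beta>) = w (trg \<beta>) \<bullet> \<beta> <| E (dm (src \<beta>))"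
proof -
  have "\<exists>\<alpha>. is2 C \<alpha> \<and> src \<alpha> = R1 (src \<beta>) \<and> trg \<alpha> = R1 (trg \<beta>) \<and>
     E (cd (src \<beta>)) |> L2 \<alpha> \<bullet> w (src \<beta>) = w (trg \<beta>) \<bullet> \<beta> <| E (dm (src \<beta>))"
    by (rule factor) (use \<beta> in simp_all)
  from someI_ex[OF this] show "is2 C (R2 \<beta>)" "src (R2 \<beta>) = R1 (src \<beta>)" "trg (R2 \<beta>) = R1 (trg \<beta>)"
    "E (cd (src \<beta>)) |> L2 (R2 \<beta>) \<bullet> w (src \<beta>) = w (trg \<beta>) \<bullet> \<beta> <| E (dm (src \<beta>))"
    unfolding R2_def by auto
qed

lemma R2_eqI:
  assumes "is2 D \<beta>" "is2 C \<alpha>" "src \<alpha> = R1 (src \<beta>)" "trg \<alpha> = R1 (trg \<beta>)"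
    "E (cd (src \<beta>)) |> L2 \<alpha> \<bullet> w (src \<beta>) = w (trg \<beta>) \<bullet> \<beta> <| E (dm (src \<beta>))"
  shows "R2 \<beta> = \<alpha>"
  by (rule factor_unique[of "cd (src \<beta>)" _ "w (src \<beta>)"]) (use assms R2_w in simp_all)

text \<open>Whiskering the defining equation of \<open>R2 \<beta>\<close> with \<open>L h\<close>.\<close>

lemma W_natural_left:
  assumes \<beta>: "is2 D \<beta>" and h: "is1 C h" "cd h = RO (dm (src \<beta>))"
  shows "W (trg \<beta>) h \<bullet> \<beta> <| (E (dm (src \<beta>)) \<odot> L1 h) = E (cd (src \<beta>)) |> L2 (R2 \<beta> <|\<^bsub>C\<^esub> h) \<bullet> W (src \<beta>) h"
proof -
  let ?A = "dm (src \<beta>)" and ?B = "cd (src \<beta>)"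
  have e: "(E ?B |> L2 (R2 \<beta>)) <| L1 h \<bullet> w (src \<beta>) <| L1 h = w (trg \<beta>) <| L1 h \<bullet> \<beta> <| (E ?A \<odot> L1 h)"
    using arg_cong[OF R2_w[OF \<beta>], of "\<lambda>x. x <| L1 h"] assms by simp
  have "W (trg \<beta>) h \<bullet> \<beta> <| (E ?A \<odot> L1 h) =
      L.V (E ?B) (R1 (trg \<beta>)) h \<bullet> ((E ?B |> L2 (R2 \<beta>)) <| L1 h \<bullet> w (src \<beta>) <| L1 h)"
    unfolding e using assms by (simp add: W_def)
  also have "\<dots> = (L.V (E ?B) (trg (R2 \<beta>)) h \<bullet> (E ?B |> L2 (R2 \<beta>)) <| L1 h) \<bullet> w (src \<beta>) <| L1 h"
    using assms by simp
  also have "\<dots> = E ?B |> L2 (R2 \<beta> <|\<^bsub>C\<^esub> h) \<bullet> W (src \<beta>) h"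
    using assms by (subst L.V_natural_left) (simp_all add: W_def)
  finally show ?thesis .
qed

text \<open>The compositor of \<open>R\<close> is the cell making the chosen lifts compatible with composition.\<close>

definition Rc :: "('d, 'a) mor \<Rightarrow> ('d, 'a) mor \<Rightarrow> ('c, 'a, 'x) cell" where
  "Rc k g = (SOME \<alpha>. is2 C \<alpha> \<and> src \<alpha> = R1 k \<odot>\<^bsub>C\<^esub> R1 g \<and> trg \<alpha> = R1 (k \<odot> g) \<and>
     E (cd k) |> L2 \<alpha> \<bullet> W k (R1 g) \<bullet> k |> w g = w (k \<odot> g))"

lemma Rc:
  assumes kg: "is1 D k" "is1 D g" "cd g = dm k"
  shows is2_Rc [simp]: "is2 C (Rc k g)" and src_Rc [simp]: "src (Rc k g) = R1 k \<odot>\<^bsub>C\<^esub> R1 g"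
    and trg_Rc [simp]: "trg (Rc k g) = R1 (k \<odot> g)"
    and Rc_w: "E (cd k) |> L2 (Rc k g) \<bullet> W k (R1 g) \<bullet> k |> w g = w (k \<odot> g)"
proof -
  have "\<exists>\<alpha>. is2 C \<alpha> \<and> src \<alpha> = R1 k \<odot>\<^bsub>C\<^esub> R1 g \<and> trg \<alpha> = R1 (k \<odot> g) \<and>
     E (cd k) |> L2 \<alpha> \<bullet> W k (R1 g) \<bullet> k |> w g = w (k \<odot> g)"
    by (rule factor) (use kg in simp_all)
  from someI_ex[OF this] show "is2 C (Rc k g)" "src (Rc k g) = R1 k \<odot>\<^bsub>C\<^esub> R1 g" "trg (Rc k g) = R1 (k \<odot> g)"
    "E (cd k) |> L2 (Rc k g) \<bullet> W k (R1 g) \<bullet> k |> w g = w (k \<odot> g)"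
    unfolding Rc_def by auto
qed

lemma Rc_iso [simp]:
  assumes kg: "is1 D k" "is1 D g" "cd g = dm k"
  shows "iso2 C (Rc k g)"
proof -
  let ?a = "W k (R1 g) \<bullet> k |> w g"
  have a: "iso2 D ?a" "src ?a = (k \<odot> g) \<odot> E (dm g)" "trg ?a = E (cd k) \<odot> L1 (R1 k \<odot>\<^bsub>C\<^esub> R1 g)"
    using kg by simp_all
  have "\<exists>\<alpha>. is2 C \<alpha> \<and> src \<alpha> = R1 (k \<odot> g) \<and> trg \<alpha> = R1 k \<odot>\<^bsub>C\<^esub> R1 g \<and> E (cd k) |> L2 \<alpha> \<bullet> w (k \<odot> g) = ?a"
    by (rule factor) (use kg in simp_all)
  then obtain \<beta> where \<beta>: "is2 C \<beta>" "src \<beta> = R1 (k \<odot> g)" "trg \<beta> = R1 k \<odot>\<^bsub>C\<^esub> R1 g"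
    "E (cd k) |> L2 \<beta> \<bullet> w (k \<odot> g) = ?a" by blast
  have 1: "\<beta> \<bullet>\<^bsub>C\<^esub> Rc k g = id2 C (R1 k \<odot>\<^bsub>C\<^esub> R1 g)"
    by (rule factor_unique[of "cd k" _ ?a])
      (use kg \<beta> Rc_w[OF kg] in \<open>simp_all add: L.M.lw_vc[symmetric] del: L.M.lw_vc\<close>, use kg \<beta> Rc_w[OF kg] in simp)
  have 2: "Rc k g \<bullet>\<^bsub>C\<^esub> \<beta> = id2 C (R1 (k \<odot> g))"
    by (rule factor_unique[of "cd k" _ "w (k \<odot> g)"]) (use kg \<beta> Rc_w[OF kg] in simp_all)
  show ?thesis
    by (rule L.K.iso2I[of _ \<beta>]) (use kg \<beta> 1 2 in simp_all)
qed

text \<open>The defining equation of the compositor is the case \<open>h = 1\<close>; whiskering with \<open>L h\<close> and sliding the compositor of \<open>L\<close>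
  past \<open>w\<close> gives the general case. Associativity of the compositor and pseudo-naturality in \<open>D\<close> both rest on it.\<close>

lemma W_comp:
  assumes kg: "is1 D k" "is1 D g" "cd g = dm k" and h: "is1 C h" "cd h = RO (dm g)"
  shows "W (k \<odot> g) h = E (cd k) |> L2 (Rc k g <|\<^bsub>C\<^esub> h) \<bullet> W k (R1 g \<odot>\<^bsub>C\<^esub> h) \<bullet> k |> W g h"
proof -
  have e: "(E (cd k) |> L2 (Rc k g)) <| L1 h \<bullet> W k (R1 g) <| L1 h \<bullet> k |> (w g <| L1 h) = w (k \<odot> g) <| L1 h"
    using arg_cong[OF Rc_w[OF kg], of "\<lambda>x. x <| L1 h"] kg h by simp
  have "W (k \<odot> g) h = (L.V (E (cd k)) (trg (Rc k g)) h \<bullet> (E (cd k) |> L2 (Rc k g)) <| L1 h) \<bullet>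
      W k (R1 g) <| L1 h \<bullet> k |> (w g <| L1 h)"
    using kg h by (simp add: W_def[of "k \<odot> g"] flip: e)
  also have "\<dots> = E (cd k) |> L2 (Rc k g <|\<^bsub>C\<^esub> h) \<bullet> (L.V (E (cd k)) (R1 k \<odot>\<^bsub>C\<^esub> R1 g) h \<bullet> W k (R1 g) <| L1 h) \<bullet>
      k |> (w g <| L1 h)"
    using kg h by (subst L.V_natural_left) simp_all
  also have "\<dots> = E (cd k) |> L2 (Rc k g <|\<^bsub>C\<^esub> h) \<bullet> (W k (R1 g \<odot>\<^bsub>C\<^esub> h) \<bullet> k |> L.V (E (dm k)) (R1 g) h) \<bullet>
      k |> (w g <| L1 h)"
    using kg h by (subst W_V) simp_all
  also have "\<dots> = E (cd k) |> L2 (Rc k g <|\<^bsub>C\<^esub> h) \<bullet> W k (R1 g \<odot>\<^bsub>C\<^esub> h) \<bullet> k |> W g h"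
    using kg h by (simp add: W_def[of g])
  finally show ?thesis .
qed

lemma R2_id2 [simp]: "is1 D g \<Longrightarrow> R2 (id2 D g) = id2 C (R1 g)"
  by (rule R2_eqI) simp_all

lemma R2_vc [simp]:
  assumes "is2 D \<alpha>" "is2 D \<beta>" "trg \<alpha> = src \<beta>"
  shows "R2 (\<beta> \<bullet> \<alpha>) = R2 \<beta> \<bullet>\<^bsub>C\<^esub> R2 \<alpha>"
proof (rule R2_eqI)
  have s: "dm (src \<beta>) = dm (src \<alpha>)" "cd (src \<beta>) = cd (src \<alpha>)"
    using is2_frame[OF assms(1)] assms(3) by simp_all
  have "E (cd (src \<alpha>)) |> L2 (R2 \<beta>) \<bullet> E (cd (src \<alpha>)) |> L2 (R2 \<alpha>) \<bullet> w (src \<alpha>) =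
      (E (cd (src \<alpha>)) |> L2 (R2 \<beta>) \<bullet> w (src \<beta>)) \<bullet> \<alpha> <| E (dm (src \<alpha>))"
    using assms s R2_w[OF assms(1)] by simp
  also have "\<dots> = w (trg \<beta>) \<bullet> \<beta> <| E (dm (src \<alpha>)) \<bullet> \<alpha> <| E (dm (src \<alpha>))"
    using assms s R2_w[OF assms(2)] by simp
  finally show "E (cd (src (\<beta> \<bullet> \<alpha>))) |> L2 (R2 \<beta> \<bullet>\<^bsub>C\<^esub> R2 \<alpha>) \<bullet> w (src (\<beta> \<bullet> \<alpha>)) =
      w (trg (\<beta> \<bullet> \<alpha>)) \<bullet> (\<beta> \<bullet> \<alpha>) <| E (dm (src (\<beta> \<bullet> \<alpha>)))"
    using assms s by simp
qed (use assms in simp_all)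

end

context right_family
begin

definition R :: "('d, 'a, 'x, 'c, 'a, 'x) psf" where
  "R = \<lparr>pob = RO,
     phom = (\<lambda>A B. \<lparr>fob = (\<lambda>g. raw1 (R1 (Mor A B g))),
       far = (\<lambda>g g' \<beta>. raw2 (R2 (Cell (Mor A B g) (Mor A B g') \<beta>)))\<rparr>),
     pcomp = (\<lambda>A B B' k g. raw2 (Rc (Mor B B' k) (Mor A B g)))\<rparr>"

lemma R_raw:
  "raw1 (R1 (Mor A B g)) = map1 R A B g"
  "raw2 (R2 (Cell (Mor A B g) (Mor A B g') \<beta>)) = map2 R A B g g' \<beta>"
  "raw2 (Rc (Mor B B' k) (Mor A B g)) = pcomp R A B B' k g"
  "RO A = pob R A"
  by (simp_all add: R_def)

lemma app1_R [simp]: "is1 D g \<Longrightarrow> app1 R g = R1 g"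
  by (elim is1E) (auto simp: app1_def R_def is1_Mor intro!: mor.expand)

lemma app2_R [simp]: "is2 D \<beta> \<Longrightarrow> app2 R \<beta> = R2 \<beta>"
  by (rule cell_eqI, simp_all) (elim is2E, simp add: app2_def R_def)

lemma coh_R [simp]: "is1 D k \<Longrightarrow> is1 D g \<Longrightarrow> cd g = dm k \<Longrightarrow> coh D C R k g = Rc k g"
  by (rule cell_eqI, simp_all) (elim is1E, simp add: coh_def R_def)

text \<open>Here and in the next two lemmas both sides are compared after applying \<open>h \<mapsto> e (L h)\<close> and precomposing with the
  invertible cell built from \<open>w\<close>; both then become the same expression in \<open>w\<close>.\<close>

lemma Rc_natural_right:
  assumes k: "is1 D k" and \<alpha>: "is2 D \<alpha>" "cd (src \<alpha>) = dm k"
  shows "Rc k (trg \<alpha>) \<bullet>\<^bsub>C\<^esub> R1 k |>\<^bsub>C\<^esub> R2 \<alpha> = R2 (k |> \<alpha>) \<bullet>\<^bsub>C\<^esub> Rc k (src \<alpha>)"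
proof (rule factor_unique[of "cd k"])
  let ?g = "src \<alpha>" and ?g' = "trg \<alpha>" and ?A = "dm (src \<alpha>)"
  let ?a = "W k (R1 ?g) \<bullet> k |> w ?g"
  have n: "E (cd k) |> L2 (R1 k |>\<^bsub>C\<^esub> R2 \<alpha>) \<bullet> W k (R1 ?g) = W k (R1 ?g') \<bullet> (k \<odot> E (dm k)) |> L2 (R2 \<alpha>)"
    using W_natural_right[of k "R2 \<alpha>"] assms by simp
  have m: "(k \<odot> E (dm k)) |> L2 (R2 \<alpha>) \<bullet> k |> w ?g = k |> w ?g' \<bullet> k |> (\<alpha> <| E ?A)"
    using arg_cong[OF R2_w[OF \<alpha>(1)], of "\<lambda>x. k |> x"] assms by simp
  have "E (cd k) |> L2 (Rc k ?g' \<bullet>\<^bsub>C\<^esub> R1 k |>\<^bsub>C\<^esub> R2 \<alpha>) \<bullet> ?a =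
      E (cd k) |> L2 (Rc k ?g') \<bullet> (E (cd k) |> L2 (R1 k |>\<^bsub>C\<^esub> R2 \<alpha>) \<bullet> W k (R1 ?g)) \<bullet> k |> w ?g"
    using assms by simp
  also have "\<dots> = E (cd k) |> L2 (Rc k ?g') \<bullet> W k (R1 ?g') \<bullet> ((k \<odot> E (dm k)) |> L2 (R2 \<alpha>) \<bullet> k |> w ?g)"
    unfolding n using assms by simp
  also have "\<dots> = (E (cd k) |> L2 (Rc k ?g') \<bullet> W k (R1 ?g') \<bullet> k |> w ?g') \<bullet> k |> (\<alpha> <| E ?A)"
    unfolding m using assms by simp
  also have "\<dots> = w (k \<odot> ?g') \<bullet> (k |> \<alpha>) <| E ?A"
    using assms by (subst Rc_w) simp_all
  also have "\<dots> = E (cd k) |> L2 (R2 (k |> \<alpha>)) \<bullet> w (k \<odot> ?g)"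
    using R2_w[of "k |> \<alpha>"] assms by simp
  also have "\<dots> = E (cd k) |> L2 (R2 (k |> \<alpha>)) \<bullet> (E (cd k) |> L2 (Rc k ?g) \<bullet> ?a)"
    using assms by (subst Rc_w[of k ?g, symmetric]) simp_all
  also have "\<dots> = E (cd k) |> L2 (R2 (k |> \<alpha>) \<bullet>\<^bsub>C\<^esub> Rc k ?g) \<bullet> ?a"
    using assms by simp
  finally show "E (cd k) |> L2 (Rc k ?g' \<bullet>\<^bsub>C\<^esub> R1 k |>\<^bsub>C\<^esub> R2 \<alpha>) \<bullet> ?a =
    E (cd k) |> L2 (R2 (k |> \<alpha>) \<bullet>\<^bsub>C\<^esub> Rc k ?g) \<bullet> ?a" .
qed (use assms in simp_all)

lemma Rc_natural_left:
  assumes g: "is1 D g" and \<kappa>: "is2 D \<kappa>" "cd g = dm (src \<kappa>)"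
  shows "Rc (trg \<kappa>) g \<bullet>\<^bsub>C\<^esub> R2 \<kappa> <|\<^bsub>C\<^esub> R1 g = R2 (\<kappa> <| g) \<bullet>\<^bsub>C\<^esub> Rc (src \<kappa>) g"
proof (rule factor_unique[of "cd (src \<kappa>)"])
  let ?k = "src \<kappa>" and ?k' = "trg \<kappa>" and ?A = "dm g" and ?C = "cd (src \<kappa>)"
  let ?a = "W ?k (R1 g) \<bullet> ?k |> w g"
  have n: "E ?C |> L2 (R2 \<kappa> <|\<^bsub>C\<^esub> R1 g) \<bullet> W ?k (R1 g) = W ?k' (R1 g) \<bullet> \<kappa> <| (E (cd g) \<odot> L1 (R1 g))"
    using W_natural_left[of \<kappa> "R1 g"] assms by simp
  have m: "\<kappa> <| (E (cd g) \<odot> L1 (R1 g)) \<bullet> ?k |> w g = ?k' |> w g \<bullet> \<kappa> <| (g \<odot> E ?A)"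
    using L.M.exchange[of "w g" \<kappa>] assms by simp
  have "E ?C |> L2 (Rc ?k' g \<bullet>\<^bsub>C\<^esub> R2 \<kappa> <|\<^bsub>C\<^esub> R1 g) \<bullet> ?a =
      E ?C |> L2 (Rc ?k' g) \<bullet> (E ?C |> L2 (R2 \<kappa> <|\<^bsub>C\<^esub> R1 g) \<bullet> W ?k (R1 g)) \<bullet> ?k |> w g"
    using assms by simp
  also have "\<dots> = E ?C |> L2 (Rc ?k' g) \<bullet> W ?k' (R1 g) \<bullet> (\<kappa> <| (E (cd g) \<odot> L1 (R1 g)) \<bullet> ?k |> w g)"
    unfolding n using assms by simp
  also have "\<dots> = (E (cd ?k') |> L2 (Rc ?k' g) \<bullet> W ?k' (R1 g) \<bullet> ?k' |> w g) \<bullet> \<kappa> <| (g \<odot> E ?A)"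
    unfolding m using assms by simp
  also have "\<dots> = w (?k' \<odot> g) \<bullet> (\<kappa> <| g) <| E ?A"
    using assms by (subst Rc_w) simp_all
  also have "\<dots> = E ?C |> L2 (R2 (\<kappa> <| g)) \<bullet> w (?k \<odot> g)"
    using R2_w[of "\<kappa> <| g"] assms by simp
  also have "\<dots> = E ?C |> L2 (R2 (\<kappa> <| g)) \<bullet> (E ?C |> L2 (Rc ?k g) \<bullet> ?a)"
    using assms by (subst Rc_w[of ?k g, symmetric]) simp_all
  also have "\<dots> = E ?C |> L2 (R2 (\<kappa> <| g) \<bullet>\<^bsub>C\<^esub> Rc ?k g) \<bullet> ?a"
    using assms by simp
  finally show "E ?C |> L2 (Rc ?k' g \<bullet>\<^bsub>C\<^esub> R2 \<kappa> <|\<^bsub>C\<^esub> R1 g) \<bullet> ?a = E ?C |> L2 (R2 (\<kappa> <| g) \<bullet>\<^bsub>C\<^esub> Rc ?k g) \<bullet> ?a" .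
qed (use assms in simp_all)

text \<open>Both sides become \<open>w (l k g)\<close>.\<close>

lemma Rc_assoc:
  assumes lkg: "is1 D g" "is1 D k" "is1 D l" "cd g = dm k" "cd k = dm l"
  shows "Rc l (k \<odot> g) \<bullet>\<^bsub>C\<^esub> R1 l |>\<^bsub>C\<^esub> Rc k g = Rc (l \<odot> k) g \<bullet>\<^bsub>C\<^esub> Rc l k <|\<^bsub>C\<^esub> R1 g"
proof (rule factor_unique[of "cd l"])
  let ?b = "W l (R1 k \<odot>\<^bsub>C\<^esub> R1 g)"
  let ?a = "?b \<bullet> l |> W k (R1 g) \<bullet> (l \<odot> k) |> w g"
  have n: "E (cd l) |> L2 (R1 l |>\<^bsub>C\<^esub> Rc k g) \<bullet> ?b = W l (R1 (k \<odot> g)) \<bullet> (l \<odot> E (dm l)) |> L2 (Rc k g)"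
    using W_natural_right[of l "Rc k g"] assms by simp
  have m: "(l \<odot> E (dm l)) |> L2 (Rc k g) \<bullet> l |> W k (R1 g) \<bullet> (l \<odot> k) |> w g = l |> w (k \<odot> g)"
    using arg_cong[OF Rc_w[of k g], of "\<lambda>x. l |> x"] assms by simp
  have "E (cd l) |> L2 (Rc l (k \<odot> g) \<bullet>\<^bsub>C\<^esub> R1 l |>\<^bsub>C\<^esub> Rc k g) \<bullet> ?a =
      E (cd l) |> L2 (Rc l (k \<odot> g)) \<bullet> (E (cd l) |> L2 (R1 l |>\<^bsub>C\<^esub> Rc k g) \<bullet> ?b) \<bullet>
        l |> W k (R1 g) \<bullet> (l \<odot> k) |> w g"
    using assms by simp
  also have "\<dots> = E (cd l) |> L2 (Rc l (k \<odot> g)) \<bullet> W l (R1 (k \<odot> g)) \<bullet>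
      ((l \<odot> E (dm l)) |> L2 (Rc k g) \<bullet> l |> W k (R1 g) \<bullet> (l \<odot> k) |> w g)"
    unfolding n using assms by simp
  also have "\<dots> = w ((l \<odot> k) \<odot> g)"
    unfolding m using Rc_w[of l "k \<odot> g"] assms by simp
  also have "\<dots> = E (cd l) |> L2 (Rc (l \<odot> k) g) \<bullet> W (l \<odot> k) (R1 g) \<bullet> (l \<odot> k) |> w g"
    using Rc_w[of "l \<odot> k" g] assms by simp
  also have "\<dots> = E (cd l) |> L2 (Rc (l \<odot> k) g \<bullet>\<^bsub>C\<^esub> Rc l k <|\<^bsub>C\<^esub> R1 g) \<bullet> ?a"
    using W_comp[of l k "R1 g"] assms by simp
  finally show "E (cd l) |> L2 (Rc l (k \<odot> g) \<bullet>\<^bsub>C\<^esub> R1 l |>\<^bsub>C\<^esub> Rc k g) \<bullet> ?a =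
      E (cd l) |> L2 (Rc (l \<odot> k) g \<bullet>\<^bsub>C\<^esub> Rc l k <|\<^bsub>C\<^esub> R1 g) \<bullet> ?a" .
qed (use assms in simp_all)

lemma Rc_id1:
  assumes g: "is1 D g"
  shows "Rc g (id1 D (dm g)) = id2 C (R1 g)" "Rc (id1 D (cd g)) g = id2 C (R1 g)"
  by (rule factor_unique[of "cd g" _ "w g"]; use g Rc_w[of g "id1 D (dm g)"] Rc_w[of "id1 D (cd g)" g] in simp)+

lemma R_normal: "normal_pseudo_functor D C R"
proof (rule psfI)
  fix A assume "A \<in> Ob D"
  then show "pob R A \<in> Ob C" "app1 R (id1 D A) = id1 C (pob R A)"
    by (simp_all flip: R_raw(4))
qed (simp_all add: L.K.two_cat_axioms L.M.two_cat_axioms Rc_natural_right Rc_natural_left Rc_assoc Rc_id1)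

text \<open>The structure cell \<open>g e (L h) (L f) \<Rightarrow> e L((R g) h f)\<close> at \<open>(f, g)\<close>, evaluated at \<open>h\<close>.\<close>

definition T :: "('c, 'a) mor \<Rightarrow> ('d, 'a) mor \<Rightarrow> ('c, 'a) mor \<Rightarrow> ('d, 'a, 'x) cell" where
  "T f g h = L.V (E (cd g)) (R1 g \<odot>\<^bsub>C\<^esub> h) f \<bullet> W g h <| L1 f"

lemma T [simp]:
  assumes "is1 C f" "is1 D g" "is1 C h" "cd h = RO (dm g)" "cd f = dm h"
  shows T_iso: "iso2 D (T f g h)" and T_is2: "is2 D (T f g h)"
    and T_src: "src (T f g h) = g \<odot> E (dm g) \<odot> L1 h \<odot> L1 f"
    and T_trg: "trg (T f g h) = E (cd g) \<odot> L1 (R1 g \<odot>\<^bsub>C\<^esub> h \<odot>\<^bsub>C\<^esub> f)"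
proof -
  show "iso2 D (T f g h)"
    unfolding T_def using assms by (intro L.M.iso2_vc) simp_all
  then show "is2 D (T f g h)" by simp
qed (use assms in \<open>simp_all add: T_def\<close>)

lemma T_natural:
  assumes "is1 C f" "is1 D g" "is2 C \<theta>" "cd (src \<theta>) = RO (dm g)" "cd f = dm (src \<theta>)"
  shows "E (cd g) |> L2 ((R1 g |>\<^bsub>C\<^esub> \<theta>) <|\<^bsub>C\<^esub> f) \<bullet> T f g (src \<theta>) =
    T f g (trg \<theta>) \<bullet> (g |> (E (dm g) |> L2 \<theta>)) <| L1 f"
proof -
  let ?h = "src \<theta>" and ?h' = "trg \<theta>"
  have n: "W g ?h' <| L1 f \<bullet> ((g \<odot> E (dm g)) |> L2 \<theta>) <| L1 f =
      (E (cd g) |> L2 (R1 g |>\<^bsub>C\<^esub> \<theta>)) <| L1 f \<bullet> W g ?h <| L1 f"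
    using arg_cong[OF W_natural_right[of g \<theta>], of "\<lambda>x. x <| L1 f"] assms by simp
  have "T f g ?h' \<bullet> (g |> (E (dm g) |> L2 \<theta>)) <| L1 f =
      L.V (E (cd g)) (R1 g \<odot>\<^bsub>C\<^esub> ?h') f \<bullet> (W g ?h' <| L1 f \<bullet> ((g \<odot> E (dm g)) |> L2 \<theta>) <| L1 f)"
    using assms by (simp add: T_def)
  also have "\<dots> = (L.V (E (cd g)) (trg (R1 g |>\<^bsub>C\<^esub> \<theta>)) f \<bullet> (E (cd g) |> L2 (R1 g |>\<^bsub>C\<^esub> \<theta>)) <| L1 f) \<bullet> W g ?h <| L1 f"
    unfolding n using assms by simp
  also have "\<dots> = E (cd g) |> L2 ((R1 g |>\<^bsub>C\<^esub> \<theta>) <|\<^bsub>C\<^esub> f) \<bullet> T f g ?h"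
    using assms by (subst L.V_natural_left) (simp_all add: T_def)
  finally show ?thesis by simp
qed

lemma T_natural2:
  assumes "is2 C \<alpha>" "is2 D \<beta>" "is1 C h" "cd h = RO (dm (src \<beta>))" "cd (src \<alpha>) = dm h"
  shows "T (trg \<alpha>) (trg \<beta>) h \<bullet> (\<beta> <| (E (dm (src \<beta>)) \<odot> L1 h)) \<star> L2 \<alpha> =
    E (cd (src \<beta>)) |> L2 ((R2 \<beta> <|\<^bsub>C\<^esub> h) \<star>\<^bsub>C\<^esub> \<alpha>) \<bullet> T (src \<alpha>) (src \<beta>) h"
proof -
  let ?f = "src \<alpha>" and ?f' = "trg \<alpha>" and ?g = "src \<beta>" and ?g' = "trg \<beta>" and ?Y = "dm (src \<beta>)" and ?Y' = "cd (src \<beta>)"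
  have n: "W ?g' h <| L1 ?f' \<bullet> \<beta> <| (E ?Y \<odot> L1 h \<odot> L1 ?f') =
      (E ?Y' |> L2 (R2 \<beta> <|\<^bsub>C\<^esub> h)) <| L1 ?f' \<bullet> W ?g h <| L1 ?f'"
    using arg_cong[OF W_natural_left[of \<beta> h], of "\<lambda>x. x <| L1 ?f'"] assms by simp
  have x: "W ?g h <| L1 ?f' \<bullet> (?g \<odot> E ?Y \<odot> L1 h) |> L2 \<alpha> = (E ?Y' \<odot> L1 (R1 ?g \<odot>\<^bsub>C\<^esub> h)) |> L2 \<alpha> \<bullet> W ?g h <| L1 ?f"
    using L.M.exchange[of "L2 \<alpha>" "W ?g h"] assms by simp
  have "T ?f' ?g' h \<bullet> (\<beta> <| (E ?Y \<odot> L1 h)) \<star> L2 \<alpha> =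
      L.V (E ?Y') (R1 ?g' \<odot>\<^bsub>C\<^esub> h) ?f' \<bullet> (W ?g' h <| L1 ?f' \<bullet> \<beta> <| (E ?Y \<odot> L1 h \<odot> L1 ?f')) \<bullet>
        (?g \<odot> E ?Y \<odot> L1 h) |> L2 \<alpha>"
    using assms by (simp add: T_def L.M.hc_left_first)
  also have "\<dots> = (L.V (E ?Y') (trg (R2 \<beta> <|\<^bsub>C\<^esub> h)) ?f' \<bullet> (E ?Y' |> L2 (R2 \<beta> <|\<^bsub>C\<^esub> h)) <| L1 ?f') \<bullet>
      (W ?g h <| L1 ?f' \<bullet> (?g \<odot> E ?Y \<odot> L1 h) |> L2 \<alpha>)"
    unfolding n using assms by simp
  also have "\<dots> = E ?Y' |> L2 ((R2 \<beta> <|\<^bsub>C\<^esub> h) <|\<^bsub>C\<^esub> ?f') \<bullet>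
      (L.V (E ?Y') (R1 ?g \<odot>\<^bsub>C\<^esub> h) ?f' \<bullet> (E ?Y' \<odot> L1 (R1 ?g \<odot>\<^bsub>C\<^esub> h)) |> L2 \<alpha>) \<bullet> W ?g h <| L1 ?f"
    unfolding x using assms by (subst L.V_natural_left) simp_all
  also have "\<dots> = E ?Y' |> L2 ((R2 \<beta> <|\<^bsub>C\<^esub> h) \<star>\<^bsub>C\<^esub> \<alpha>) \<bullet> T ?f ?g h"
    using assms by (subst L.V_natural_right) (simp_all add: T_def L.K.hc_left_first)
  finally show ?thesis .
qed

lemma T_id1:
  assumes "is1 C h" "cd h = RO Y" "Y \<in> Ob D"
  shows "T (id1 C (dm h)) (id1 D Y) h = id2 D (E Y \<odot> L1 h)"
  using assms by (simp add: T_def)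

text \<open>The two lifts commute with the pre-compositions, which puts the cells for \<open>f\<close>, \<open>f'\<close> next to each other and those for
  \<open>g\<close>, \<open>g'\<close> next to each other. The former combine by associativity of the compositor of \<open>L\<close>, the latter by \<open>W_comp\<close>.\<close>

lemma T_comp:
  assumes f: "is1 C f" "is1 C f'" "cd f' = dm f" and g: "is1 D g" "is1 D g'" "cd g = dm g'"
    and h: "is1 C h" "cd h = RO (dm g)" "cd f = dm h"
  shows "T (f \<odot>\<^bsub>C\<^esub> f') (g' \<odot> g) h \<bullet> ((g' \<odot> g) \<odot> E (dm g) \<odot> L1 h) |> \<phi> f f' =
    E (cd g') |> L2 ((Rc g' g <|\<^bsub>C\<^esub> h) <|\<^bsub>C\<^esub> (f \<odot>\<^bsub>C\<^esub> f')) \<bullet>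
      T f' g' ((R1 g \<odot>\<^bsub>C\<^esub> h) \<odot>\<^bsub>C\<^esub> f) \<bullet> (g' |> T f g h) <| L1 f'"
proof -
  let ?E = "E (cd g')" and ?x = "R1 g' \<odot>\<^bsub>C\<^esub> R1 g \<odot>\<^bsub>C\<^esub> h" and ?y = "R1 g \<odot>\<^bsub>C\<^esub> h" and ?ff = "f \<odot>\<^bsub>C\<^esub> f'"
  let ?Z = "W g' ?y \<bullet> g' |> W g h"
  have WV: "W g' (?y \<odot>\<^bsub>C\<^esub> f) <| L1 f' \<bullet> (g' |> L.V (E (cd g)) ?y f) <| L1 f' =
      L.V ?E ?x f <| L1 f' \<bullet> W g' ?y <| (L1 f \<odot> L1 f')"
    using arg_cong[OF W_V[of g' ?y f], of "\<lambda>x. x <| L1 f'"] assms by simp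
  have VV: "L.V ?E (?x \<odot>\<^bsub>C\<^esub> f) f' \<bullet> L.V ?E ?x f <| L1 f' = L.V ?E ?x ?ff \<bullet> (?E \<odot> L1 ?x) |> \<phi> f f'"
    using L.V_assoc[of ?E ?x f f'] assms by simp
  have VR: "?E |> L2 ((Rc g' g <|\<^bsub>C\<^esub> h) <|\<^bsub>C\<^esub> ?ff) \<bullet> L.V ?E ?x ?ff =
      L.V ?E (R1 (g' \<odot> g) \<odot>\<^bsub>C\<^esub> h) ?ff \<bullet> (?E |> L2 (Rc g' g <|\<^bsub>C\<^esub> h)) <| L1 ?ff"
    using L.V_natural_left[of ?E "Rc g' g <|\<^bsub>C\<^esub> h" ?ff] assms by simp
  have x: "(?E \<odot> L1 ?x) |> \<phi> f f' \<bullet> ?Z <| (L1 f \<odot> L1 f') = ?Z <| L1 ?ff \<bullet> ((g' \<odot> g) \<odot> E (dm g) \<odot> L1 h) |> \<phi> f f'"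
    using L.M.exchange[of "\<phi> f f'" ?Z] assms by simp
  have WW: "(?E |> L2 (Rc g' g <|\<^bsub>C\<^esub> h)) <| L1 ?ff \<bullet> ?Z <| L1 ?ff = W (g' \<odot> g) h <| L1 ?ff"
    using W_comp[of g' g h] assms by simp
  have "?E |> L2 ((Rc g' g <|\<^bsub>C\<^esub> h) <|\<^bsub>C\<^esub> ?ff) \<bullet> T f' g' (?y \<odot>\<^bsub>C\<^esub> f) \<bullet> (g' |> T f g h) <| L1 f' =
      ?E |> L2 ((Rc g' g <|\<^bsub>C\<^esub> h) <|\<^bsub>C\<^esub> ?ff) \<bullet> L.V ?E (?x \<odot>\<^bsub>C\<^esub> f) f' \<bullet>
        (W g' (?y \<odot>\<^bsub>C\<^esub> f) <| L1 f' \<bullet> (g' |> L.V (E (cd g)) ?y f) <| L1 f') \<bullet> g' |> (W g h <| (L1 f \<odot> L1 f'))"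
    using assms by (simp add: T_def)
  also have "\<dots> = ?E |> L2 ((Rc g' g <|\<^bsub>C\<^esub> h) <|\<^bsub>C\<^esub> ?ff) \<bullet> (L.V ?E (?x \<odot>\<^bsub>C\<^esub> f) f' \<bullet> L.V ?E ?x f <| L1 f') \<bullet>
      ?Z <| (L1 f \<odot> L1 f')"
    unfolding WV using assms by simp
  also have "\<dots> = (?E |> L2 ((Rc g' g <|\<^bsub>C\<^esub> h) <|\<^bsub>C\<^esub> ?ff) \<bullet> L.V ?E ?x ?ff) \<bullet>
      ((?E \<odot> L1 ?x) |> \<phi> f f' \<bullet> ?Z <| (L1 f \<odot> L1 f'))"
    unfolding VV using assms by simp
  also have "\<dots> = L.V ?E (R1 (g' \<odot> g) \<odot>\<^bsub>C\<^esub> h) ?ff \<bullet> ((?E |> L2 (Rc g' g <|\<^bsub>C\<^esub> h)) <| L1 ?ff \<bullet> ?Z <| L1 ?ff) \<bullet>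
      ((g' \<odot> g) \<odot> E (dm g) \<odot> L1 h) |> \<phi> f f'"
    unfolding VR x using assms by simp
  also have "\<dots> = T ?ff (g' \<odot> g) h \<bullet> ((g' \<odot> g) \<odot> E (dm g) \<odot> L1 h) |> \<phi> f f'"
    unfolding WW using assms by (simp add: T_def)
  finally show ?thesis by simp
qed

end

section \<open>The bi-adjunction\<close>

lemma raw2_in: "is2 K \<alpha> \<Longrightarrow> raw2 \<alpha> \<in> arr (Hom K (dm (src \<alpha>)) (cd (src \<alpha>))) (raw1 (src \<alpha>)) (raw1 (trg \<alpha>))"
  by (simp add: is2_def)

context right_family
begin

definition \<Phi> where
  "\<Phi> = \<lparr>tob = (\<lambda>P. restrict_ftr (Hom C (fst P) (RO (snd P))) (counit_ftr C D L (fst P) (RO (snd P)) (snd P) (e (snd P)))),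
     tcell = (\<lambda>P Q u. \<lambda>h \<in> obj (Hom C (fst P) (RO (snd P))).
       raw2 (T (Mor (fst Q) (fst P) (fst u)) (Mor (snd P) (snd Q) (snd u)) (Mor (fst P) (RO (snd P)) h)))\<rparr>"

lemma \<Phi>_pnt: "pseudo_nat_trans (prod2 (op2 C) D) CAT (hom_to C D R) (hom_from C D L) \<Phi>"
proof -
  note CDL = L.K.two_category_axioms L.M.two_category_axioms L.normal_pseudo_functor_axioms
  interpret R: psf D C R
    using CDL R_normal by (simp add: psf_iff)
  interpret P: CAT_pair "prod2 (op2 C) D" "hom_to C D R" "hom_from C D L"
    using CDL R_normal by (intro CAT_pairI two_category_prod2 L.K.two_category_op2 hom_to_normal hom_from_normal)
  have e_in: "e Y \<in> obj (Hom D (pob L (pob R Y)) Y)" if "Y \<in> Ob D" for Y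
    using E_is1[OF that] by (simp add: is1_Mor R_raw(4))
  note fc = counit_ftr_functor[OF CDL]
  note [simp] = cat_functor.fob_in[OF L.phom_functor] cat_functor.far_in[OF L.phom_functor]
    cat_functor.fob_in[OF R.phom_functor] cat_functor.far_in[OF R.phom_functor]
    L.K.comp1_in L.M.comp1_in L.K.comp2_in L.M.comp2_in category.one_in[OF L.K.cat] category.one_in[OF L.M.cat]
    hom_to_simps hom_from_simps hom_psf_simps(1,2,3) prod2_simps prod_cat_simps
    L.M.comp1_assoc L.K.comp1_assoc R_raw e_in counit_ftr_def is1_Mor is2_Cell
  note unf = op_defs app_defs
  \<comment> \<open>Restricted functors are only evaluated on arrows known to lie in their domain. Where the simplifier has
    rebracketed the boundary of such an arrow, its membership is supplied in rebracketed form by \<open>raw2_in\<close>.\<close>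
  show ?thesis
  proof (rule P.CAT_pntI, goal_cases)
    case (1 P)
    then show ?case
      using fc[of "fst P" "pob R (snd P)" "snd P" "e (snd P)"] by (cases P) (simp add: \<Phi>_def L.K.cat del: counit_ftr_def)
  next
    case (2 P)
    then show ?case by (simp add: \<Phi>_def)
  next
    case (3 P Q u)
    then show ?case by (simp add: \<Phi>_def)
  next
    case (4 P Q u h)
    obtain X Y X' Y' f g where [simp]: "P = (X, Y)" "Q = (X', Y')" "u = (f, g)"
      by (cases P; cases Q; cases u)
    have "iso2 D (T (Mor X' X f) (Mor Y Y' g) (Mor X (RO Y) h))"
      using 4 by simp
    then show ?case
      using 4 T_src[of "Mor X' X f" "Mor Y Y' g" "Mor X (RO Y) h"] T_trg[of "Mor X' X f" "Mor Y Y' g" "Mor X (RO Y) h"]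
      by (simp add: \<Phi>_def L.M.iso2_iff unf)
  next
    case (5 P Q u h h' \<theta>)
    obtain X Y X' Y' f g where [simp]: "P = (X, Y)" "Q = (X', Y')" "u = (f, g)"
      by (cases P; cases Q; cases u)
    let ?f = "Mor X' X f" and ?g = "Mor Y Y' g" and ?\<theta> = "Cell (Mor X (RO Y) h) (Mor X (RO Y) h') \<theta>"
    have "E Y' |> L2 ((R1 ?g |>\<^bsub>C\<^esub> ?\<theta>) <|\<^bsub>C\<^esub> ?f) \<bullet> T ?f ?g (src ?\<theta>) = T ?f ?g (trg ?\<theta>) \<bullet> (?g |> (E Y |> L2 ?\<theta>)) <| L1 ?f"
      using T_natural[of ?f ?g ?\<theta>] 5 by simp
    note n = arg_cong[OF this, of raw2]
    have "is2 C ((R1 ?g |>\<^bsub>C\<^esub> ?\<theta>) <|\<^bsub>C\<^esub> ?f)"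
      using 5 by simp
    from n raw2_in[OF this] 5 show ?case
      by (simp add: \<Phi>_def unf)
  next
    case (6 P Q u v \<delta> h)
    obtain X Y X' Y' f g f' g' \<alpha> \<beta> where [simp]: "P = (X, Y)" "Q = (X', Y')" "u = (f, g)" "v = (f', g')" "\<delta> = (\<alpha>, \<beta>)"
      by (cases P; cases Q; cases u; cases v; cases \<delta>)
    let ?\<alpha> = "Cell (Mor X' X f) (Mor X' X f') \<alpha>" and ?\<beta> = "Cell (Mor Y Y' g) (Mor Y Y' g') \<beta>" and ?h = "Mor X (RO Y) h"
    have "T (trg ?\<alpha>) (trg ?\<beta>) ?h \<bullet> (?\<beta> <| (E Y \<odot> L1 ?h)) \<star> L2 ?\<alpha> =
        E Y' |> L2 ((R2 ?\<beta> <|\<^bsub>C\<^esub> ?h) \<star>\<^bsub>C\<^esub> ?\<alpha>) \<bullet> T (src ?\<alpha>) (src ?\<beta>) ?h"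
      using T_natural2[of ?\<alpha> ?\<beta> ?h] 6 by simp
    note n = arg_cong[OF this, of raw2]
    have "is2 C ((R2 ?\<beta> <|\<^bsub>C\<^esub> ?h) \<star>\<^bsub>C\<^esub> ?\<alpha>)"
      using 6 by simp
    from n raw2_in[OF this] 6 show ?case
      by (simp add: \<Phi>_def unf)
  next
    case (7 P h)
    obtain X Y where [simp]: "P = (X, Y)" by (cases P)
    from arg_cong[OF T_id1[of "Mor X (RO Y) h" Y], of raw2] 7 show ?case
      by (simp add: \<Phi>_def unf)
  next
    case (8 P Q S u v h)
    obtain X Y X' Y' X'' Y'' f g f' g' where [simp]: "P = (X, Y)" "Q = (X', Y')" "S = (X'', Y'')"
      "u = (f, g)" "v = (f', g')"
      by (cases P; cases Q; cases S; cases u; cases v)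
    let ?f = "Mor X' X f" and ?f' = "Mor X'' X' f'" and ?g = "Mor Y Y' g" and ?g' = "Mor Y' Y'' g'"
      and ?h = "Mor X (RO Y) h"
    have "T (?f \<odot>\<^bsub>C\<^esub> ?f') (?g' \<odot> ?g) ?h \<bullet> ((?g' \<odot> ?g) \<odot> E Y \<odot> L1 ?h) |> \<phi> ?f ?f' =
        E Y'' |> L2 ((Rc ?g' ?g <|\<^bsub>C\<^esub> ?h) <|\<^bsub>C\<^esub> (?f \<odot>\<^bsub>C\<^esub> ?f')) \<bullet>
          T ?f' ?g' ((R1 ?g \<odot>\<^bsub>C\<^esub> ?h) \<odot>\<^bsub>C\<^esub> ?f) \<bullet> (?g' |> T ?f ?g ?h) <| L1 ?f'"
      using T_comp[of ?f ?f' ?g ?g' ?h] 8 by simp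
    note n = arg_cong[OF this, of raw2]
    have "is2 C ((Rc ?g' ?g <|\<^bsub>C\<^esub> ?h) <|\<^bsub>C\<^esub> (?f \<odot>\<^bsub>C\<^esub> ?f'))" "is2 D (T ?f ?g ?h)"
      using 8 by simp_all
    from n raw2_in[OF this(1)] raw2_in[OF this(2)] 8 show ?case
      using hom_from_pcomp[OF CDL, of X X' X'' Y Y' Y'' f f' g g' "comp1 D (pob L X) (pob L (RO Y)) Y (e Y) (map1 L X (RO Y) h)"]
        hom_to_pcomp[OF CDL(1,2) R_normal, of X X' X'' Y Y' Y'' f f' g g' h]
      by (simp add: \<Phi>_def unf)
  qed
qed

theorem R_right_bi_adjoint: "right_bi_adjoint C D L R"
proof -
  note CDL = L.K.two_category_axioms L.M.two_category_axioms L.normal_pseudo_functor_axioms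
  have "\<exists>\<Psi>. adjoint_equivalence (Ps (prod2 (op2 C) D) CAT) (hom_to C D R) (hom_from C D L) \<Psi>"
  proof (rule weak_equivalence_Ps[OF _ _ _ \<Phi>_pnt])
    fix P assume "P \<in> Ob (prod2 (op2 C) D)"
    then show "weak_equivalence (pob (hom_to C D R) P) (pob (hom_from C D L) P) (tob \<Phi> P)"
      using E_weak[of "fst P" "snd P"]
      by (auto simp: \<Phi>_def hom_to_simps hom_from_simps prod2_simps simp flip: R_raw(4))
  qed (use CDL R_normal in \<open>simp_all add: two_category_prod2 L.K.two_category_op2 hom_to_normal hom_from_normal\<close>)
  then show ?thesis
    using R_normal CDL by (auto simp: right_bi_adjoint_def bi_adjunction_def)
qed

end

theorem theorem7p3:
  fixes C :: "('c, 'a, 'x) twocat" and D :: "('d, 'a, 'x) twocat"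
    and L :: "('c, 'a, 'x, 'd, 'a, 'x) psf"
  assumes "two_category C" and "two_category D" and "normal_pseudo_functor C D L"
  shows "(\<exists>R. right_bi_adjoint C D L R) \<longleftrightarrow>
    (\<forall>Y \<in> Ob D. \<exists>RY \<Psi>. bi_representation C (hom_from_fixed C D L Y) RY \<Psi>)"
proof
  assume "\<exists>R. right_bi_adjoint C D L R"
  then obtain R \<Phi> where "bi_adjunction C D L R \<Phi>"
    by (auto simp: right_bi_adjoint_def)
  then show "\<forall>Y \<in> Ob D. \<exists>RY \<Psi>. bi_representation C (hom_from_fixed C D L Y) RY \<Psi>"
    using bi_adjunction_universal[OF assms] universal_bi_representation[OF assms] by blast
next
  assume "\<forall>Y \<in> Ob D. \<exists>RY \<Psi>. bi_representation C (hom_from_fixed C D L Y) RY \<Psi>"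
  then have "\<forall>Y \<in> Ob D. \<exists>Z e. universal_counit C D L Y Z e"
    using bi_representation_universal[OF assms] by blast
  then obtain Z e where "\<And>Y. Y \<in> Ob D \<Longrightarrow> universal_counit C D L Y (Z Y) (e Y)"
    by metis
  then interpret right_family C D L Z e
    using assms by (simp add: right_family_def right_family_axioms_def psf_iff)
  show "\<exists>R. right_bi_adjoint C D L R"
    using R_right_bi_adjoint by blast
qed

end
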